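(* Let $\alpha=-1$ and $\kappa>0$. For any $z^0=(u^0,\rho^0)\in H^2(\mathbb S)\times H^1(\mathbb S)$, let $T$ be the maximal existence time of the solution $z=(u,\rho)$ of the generalized two-component Hunter–Saxton system with initial datum $z^0$. Then the solution blows up in finite time if and only if $$\liminf_{t\to T^-}\Big\{\inf_{x\in\mathbb S}u_x(t,x)\Big\}=-\infty .$$
   Context: $\mathbb S=\mathbb R/\mathbb Z$; $H^r(\mathbb S)$ are the $L^2$-based Sobolev spaces. For $(\alpha,\kappa)\in\mathbb R\times\mathbb R$, the generalized two-component Hunter–Saxton system is $$u_{txx}+(1-\alpha)u_xu_{xx}+uu_{xxx}-\kappa\rho\rho_x=0,\qquad \rho_t+u\rho_x=\alpha u_x\rho,\qquad t>0,\ x\in\mathbb R,$$ with $u(t,x+1)=u(t,x)$, $\rho(t,x+1)=\rho(t,x)$, $u(0,x)=u^0(x)$, $\rho(0,x)=\rho^0(x)$. Integrating the first equation twice in space gives $$u_t+uu_x=\partial_x^{-1}\Big(\tfrac{\kappa}{2}\rho^2+\tfrac{\alpha+2}{2}u_x^2+a(t)\Big)+h(t),\qquad \partial_x^{-1}f(x)=\int_0^x f(y)\,dy,$$ with $a(t)=-\frac{\kappa}{2}\int_{\mathbb S}\rho^2dx-\frac{\alpha+2}{2}\int_{\mathbb S}u_x^2dx$ and $h:[0,\infty)\to\mathbb R$ an arbitrary continuous function, which is fixed once and for all (e.g. $h\equiv0$); "the solution" means the solution of this integrated equation together with the $\rho$-equation. For $z^0\in H^s\times H^{s-1}$, $s\ge2$,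 there is a unique solution of class $C([0,T);H^s\times H^{s-1})\cap C^1([0,T);H^{s-1}\times H^{s-2})$ with maximal existence time $T=T(\|z^0\|_{H^s\times H^{s-1}})>0$. The solution "blows up in finite time" if $T<\infty$ and $\limsup_{t\to T^-}\|z(t)\|_{H^s\times H^{s-1}}=\infty$ (here $s=2$); the limit $t\to T^-$ in the criterion refers to a finite $T$. *)

theory Defs
  imports "HOL-Analysis.Analysis"
begin

text \<open>Functions on the circle are 1-periodic functions on the real line; integrals over the circle
  are Lebesgue integrals over \<^term>\<open>{0..1::real}\<close>.\<close>

definition periodic1 :: "(real \<Rightarrow> real) \<Rightarrow> bool" where
  "periodic1 f \<longleftrightarrow> (\<forall>x. f (x + 1) = f x)"

definition circle_integral :: "(real \<Rightarrow> real) \<Rightarrow> real" where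
  "circle_integral f = (LINT x:{0..1}|lebesgue. f x)"

definition test_function :: "(real \<Rightarrow> real) \<Rightarrow> bool" where
  "test_function \<phi> \<longleftrightarrow> periodic1 \<phi> \<and> (\<forall>k x. (deriv ^^ k) \<phi> differentiable at x)"

definition L2_circle :: "(real \<Rightarrow> real) set" where
  "L2_circle = {f. periodic1 f \<and> f \<in> borel_measurable lebesgue \<and>
                   set_integrable lebesgue {0..1} (\<lambda>x. (f x)\<^sup>2)}"

definition L2_norm :: "(real \<Rightarrow> real) \<Rightarrow> real" where
  "L2_norm f = sqrt (circle_integral (\<lambda>x. (f x)\<^sup>2))"

definition has_weak_deriv :: "nat \<Rightarrow> (real \<Rightarrow> real) \<Rightarrow> (real \<Rightarrow> real) \<Rightarrow> bool" where
  "has_weak_deriv j f g \<longleftrightarrow>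
     (\<forall>\<phi>. test_function \<phi> \<longrightarrow>
        circle_integral (\<lambda>x. f x * (deriv ^^ j) \<phi> x)
          = (-1) ^ j * circle_integral (\<lambda>x. g x * \<phi> x))"

text \<open>A square-integrable weak derivative is unique only up to null sets; \<open>weak_deriv\<close> picks an
  arbitrary representative, so it should be used only under integrals or almost everywhere.\<close>

definition weak_deriv :: "nat \<Rightarrow> (real \<Rightarrow> real) \<Rightarrow> (real \<Rightarrow> real)" where
  "weak_deriv j f = (SOME g. g \<in> L2_circle \<and> has_weak_deriv j f g)"

text \<open>For \<open>k \<ge> 1\<close> every class in \<open>H\<^sup>k\<close> contains exactly one continuous function, and we always use
  that representative. Elements of \<open>H\<^sup>2\<close> are then continuously differentiable, so that
  \<^const>\<open>deriv\<close> is their (classical) derivative. For \<open>k = 0\<close> functions stand for their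
  almost-everywhere classes.\<close>

definition sobolev :: "nat \<Rightarrow> (real \<Rightarrow> real) set" where
  "sobolev k = {f \<in> L2_circle. (\<forall>j\<le>k. \<exists>g\<in>L2_circle. has_weak_deriv j f g) \<and>
                               (k \<ge> 1 \<longrightarrow> continuous_on UNIV f)}"

definition sobolev_norm :: "nat \<Rightarrow> (real \<Rightarrow> real) \<Rightarrow> real" where
  "sobolev_norm k f = sqrt (\<Sum>j\<le>k. (L2_norm (weak_deriv j f))\<^sup>2)"

definition sobolev_pair_norm ::
    "nat \<Rightarrow> nat \<Rightarrow> (real \<Rightarrow> real) \<Rightarrow> (real \<Rightarrow> real) \<Rightarrow> real" where
  "sobolev_pair_norm k l f g = sqrt ((sobolev_norm k f)\<^sup>2 + (sobolev_norm l g)\<^sup>2)"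

text \<open>Curves \<open>f\<close> in \<open>H\<^sup>k\<close>, written \<open>f t x\<close>: the classes \<open>C(I; H\<^sup>k)\<close> and, with \<open>f'\<close> the derivative
  in time, \<open>C\<^sup>1(I; H\<^sup>k)\<close>. Derivatives are one-sided at an endpoint belonging to \<open>I\<close>.\<close>

definition C0_sobolev :: "real set \<Rightarrow> nat \<Rightarrow> (real \<Rightarrow> real \<Rightarrow> real) \<Rightarrow> bool" where
  "C0_sobolev I k f \<longleftrightarrow>
     (\<forall>t\<in>I. f t \<in> sobolev k \<and>
        ((\<lambda>s. sobolev_norm k (\<lambda>x. f s x - f t x)) \<longlongrightarrow> 0) (at t within I))"

definition C1_sobolev ::
    "real set \<Rightarrow> nat \<Rightarrow> (real \<Rightarrow> real \<Rightarrow> real) \<Rightarrow> (real \<Rightarrow> real \<Rightarrow> real) \<Rightarrow> bool" where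
  "C1_sobolev I k f f' \<longleftrightarrow>
     C0_sobolev I k f \<and> C0_sobolev I k f' \<and>
     (\<forall>t\<in>I. ((\<lambda>s. sobolev_norm k (\<lambda>x. (f s x - f t x) / (s - t) - f' t x)) \<longlongrightarrow> 0)
        (at t within I))"

definition antideriv0 :: "(real \<Rightarrow> real) \<Rightarrow> real \<Rightarrow> real" where
  "antideriv0 f x = interval_lebesgue_integral lborel 0 (ereal x) f"

definition hs_mean :: "real \<Rightarrow> real \<Rightarrow> (real \<Rightarrow> real) \<Rightarrow> (real \<Rightarrow> real) \<Rightarrow> real" where
  "hs_mean \<alpha> \<kappa> v r =
     - (\<kappa> / 2) * circle_integral (\<lambda>x. (r x)\<^sup>2)
     - ((\<alpha> + 2) / 2) * circle_integral (\<lambda>x. (deriv v x)\<^sup>2)"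

definition time_interval :: "ereal \<Rightarrow> real set" where
  "time_interval T = {t. 0 \<le> t \<and> ereal t < T}"

text \<open>Solutions of the integrated system on \<open>[0,T)\<close> (\<open>T = \<infinity>\<close> allowed) of class
  \<open>C([0,T); H\<^sup>2 \<times> H\<^sup>1) \<inter> C\<^sup>1([0,T); H\<^sup>1 \<times> L\<^sup>2)\<close>. The second equation is an identity in \<open>L\<^sup>2\<close>.\<close>

definition hs_solution ::
    "real \<Rightarrow> real \<Rightarrow> (real \<Rightarrow> real) \<Rightarrow> (real \<Rightarrow> real) \<Rightarrow> (real \<Rightarrow> real) \<Rightarrow> ereal \<Rightarrow>
     (real \<Rightarrow> real \<Rightarrow> real) \<Rightarrow> (real \<Rightarrow> real \<Rightarrow> real) \<Rightarrow> bool" where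
  "hs_solution \<alpha> \<kappa> h u0 \<rho>0 T u \<rho> \<longleftrightarrow>
     0 < T \<and> u 0 = u0 \<and> \<rho> 0 = \<rho>0 \<and>
     C0_sobolev (time_interval T) 2 u \<and> C0_sobolev (time_interval T) 1 \<rho> \<and>
     (\<exists>u_t \<rho>_t.
        C1_sobolev (time_interval T) 1 u u_t \<and> C1_sobolev (time_interval T) 0 \<rho> \<rho>_t \<and>
        (\<forall>t\<in>time_interval T.
           (\<forall>x. u_t t x + u t x * deriv (u t) x =
              antideriv0 (\<lambda>y. \<kappa> / 2 * (\<rho> t y)\<^sup>2 + (\<alpha> + 2) / 2 * (deriv (u t) y)\<^sup>2
                              + hs_mean \<alpha> \<kappa> (u t) (\<rho> t)) x + h t) \<and>
           (AE x in lebesgue.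
              \<rho>_t t x + u t x * weak_deriv 1 (\<rho> t) x = \<alpha> * deriv (u t) x * \<rho> t x)))"

definition max_existence_time ::
    "real \<Rightarrow> real \<Rightarrow> (real \<Rightarrow> real) \<Rightarrow> (real \<Rightarrow> real) \<Rightarrow> (real \<Rightarrow> real) \<Rightarrow> ereal" where
  "max_existence_time \<alpha> \<kappa> h u0 \<rho>0 = Sup {T. \<exists>u \<rho>. hs_solution \<alpha> \<kappa> h u0 \<rho>0 T u \<rho>}"

definition blows_up_in_finite_time ::
    "ereal \<Rightarrow> (real \<Rightarrow> real \<Rightarrow> real) \<Rightarrow> (real \<Rightarrow> real \<Rightarrow> real) \<Rightarrow> bool" where
  "blows_up_in_finite_time T u \<rho> \<longleftrightarrow>
     T < \<infinity> \<and>
     Limsup (at_left (real_of_ereal T)) (\<lambda>t. ereal (sobolev_pair_norm 2 1 (u t) (\<rho> t))) = \<infinity>"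

end

theory Submission imports Defs begin

text \<open>
  With \<open>v = u\<^sub>x\<close> and \<open>\<alpha> = - 1\<close> the system consists of two transport equations with the same velocity,
  \<open>v\<^sub>t + u v\<^sub>x = \<kappa> \<rho>\<^sup>2 / 2 - v\<^sup>2 / 2 + a\<close> and \<open>\<rho>\<^sub>t + u \<rho>\<^sub>x = - v \<rho>\<close>, where \<open>a \<le> 0\<close>.

  If \<open>v\<close> is unbounded from below near \<open>T\<close>, the norm is unbounded because \<open>v\<close> has mean zero and is therefore
  at most \<open>\<parallel>u\<^sub>x\<^sub>x\<parallel>\<close> in absolute value (\<open>L2_deriv_sup_bound\<close>).

  Conversely let \<open>v \<ge> - M\<close> on \<open>[0,T)\<close> with \<open>T\<close> finite. The second equation then bounds \<open>\<rho>\<close> in the supremum norm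
  (\<open>\<rho>_bounded\<close>), after which the first one bounds \<open>v\<close> from above, since the only positive term on its right-hand
  side is \<open>\<kappa> \<rho>\<^sup>2 / 2\<close> (\<open>v_bounded\<close>). With \<open>v\<close> and \<open>\<rho>\<close> bounded, the energy estimate for the differentiated
  equations is linear in \<open>\<parallel>v\<^sub>x\<parallel>\<^sup>2 + \<parallel>\<rho>\<^sub>x\<parallel>\<^sup>2\<close>, and Gronwall's inequality bounds the gradients
  (\<open>gradient_bounded\<close>). Finally \<open>u\<close> is bounded because its material derivative is (\<open>u_bounded\<close>). Thus all norms
  stay bounded up to \<open>T\<close>, and no blow-up occurs.

  The difficulty is regularity: \<open>v\<close> and \<open>\<rho>\<close> are only continuous in time with values in \<open>H\<^sup>1\<close> and differentiable in
  time with values in \<open>L\<^sup>2\<close>, so they cannot be differentiated along characteristics, and the equations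
  cannot be differentiated in space. The supremum bounds are therefore obtained from a maximum
  principle in energy form, using the square of a positive part (\<open>transport_max_principle\<close>), and the gradient
  bounds from energies of finite differences, whose increments \<open>d\<close> are sent to zero only after integration
  in time (\<open>transport_difference_energy\<close>, \<open>L2_norm_le_difference_quotients\<close>).

  Sobolev functions are defined by duality with smooth periodic functions. The lemma of du Bois-Reymond
  (\<open>du_Bois_Reymond\<close>), whose proof uses trigonometric polynomials as test functions, identifies them with
  primitives of square-integrable functions, for which the rules of calculus are proved directly.
\<close>

section \<open>Square-integrable functions on the circle\<close>

text \<open>Since a circle function is determined by its values on the unit interval, all integrals are taken
  against Lebesgue measure restricted to that interval, a finite measure; pointwise identities between
  classes become statements \<open>AE x in circle\<close>.\<close>

abbreviation circle :: "real measure" where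
  "circle \<equiv> lebesgue_on {0..1}"

lemma circle_integral_eq: "circle_integral f = integral\<^sup>L circle f"
  unfolding circle_integral_def set_lebesgue_integral_def by (simp add: integral_restrict_space)

lemma set_integrable_circle: "set_integrable lebesgue {0..1} f \<longleftrightarrow> integrable circle (f :: real \<Rightarrow> real)"
  unfolding set_integrable_def by (simp add: integrable_restrict_space)

lemma measurable_circle: "f \<in> borel_measurable lebesgue \<Longrightarrow> f \<in> borel_measurable circle"
  by (rule measurable_restrict_space1)

lemma L2_circle_iff:
  "f \<in> L2_circle \<longleftrightarrow> periodic1 f \<and> f \<in> borel_measurable lebesgue \<and> integrable circle (\<lambda>x. (f x)\<^sup>2)"
  by (simp add: L2_circle_def set_integrable_circle)

lemma L2_circleD:
  assumes "f \<in> L2_circle"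
  shows "periodic1 f" "f \<in> borel_measurable lebesgue" "f \<in> borel_measurable circle"
    "integrable circle (\<lambda>x. (f x)\<^sup>2)"
  using assms by (auto simp: L2_circle_iff intro: measurable_circle)

lemma L2_norm_sq: "(L2_norm f)\<^sup>2 = integral\<^sup>L circle (\<lambda>x. (f x)\<^sup>2)"
  unfolding L2_norm_def circle_integral_eq by simp

lemma L2_norm_nonneg [simp]: "0 \<le> L2_norm f"
  unfolding L2_norm_def circle_integral_eq by simp

lemma finite_measure_circle: "finite_measure circle"
  by (rule finite_measure_lebesgue_on) simp

lemma circle_integrable_const [simp]: "integrable circle (\<lambda>_. c :: real)"
  using finite_measure.integrable_const[OF finite_measure_circle] .

lemma measure_circle [simp]: "measure circle {0..1} = 1"
  by (simp add: measure_restrict_space)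

lemma square_integrable_mult:
  fixes f g :: "'a \<Rightarrow> real"
  assumes "f \<in> borel_measurable M" "g \<in> borel_measurable M"
    and "integrable M (\<lambda>x. (f x)\<^sup>2)" "integrable M (\<lambda>x. (g x)\<^sup>2)"
  shows "integrable M (\<lambda>x. f x * g x)"
proof (rule Bochner_Integration.integrable_bound)
  show "integrable M (\<lambda>x. (f x)\<^sup>2 + (g x)\<^sup>2)"
    using assms by simp
  show "(\<lambda>x. f x * g x) \<in> borel_measurable M"
    using assms by simp
  have "\<bar>a * b\<bar> \<le> \<bar>a\<^sup>2 + b\<^sup>2\<bar>" for a b :: real
  proof -
    have "0 \<le> (\<bar>a\<bar> - \<bar>b\<bar>)\<^sup>2" by simp
    then have "2 * (\<bar>a\<bar> * \<bar>b\<bar>) \<le> a\<^sup>2 + b\<^sup>2" by (simp add: power2_diff)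
    moreover have "0 \<le> \<bar>a\<bar> * \<bar>b\<bar>" by simp
    ultimately show ?thesis unfolding abs_mult by linarith
  qed
  then show "AE x in M. norm (f x * g x) \<le> norm ((f x)\<^sup>2 + (g x)\<^sup>2)"
    by simp
qed

text \<open>The quadratic form \<open>(s, r) \<mapsto> \<integral> (s f + r g)\<^sup>2\<close> is nonnegative, so its discriminant is not positive.
  The general measure allows for functions that are not periodic and for other intervals.\<close>

lemma Cauchy_Schwarz_integral:
  fixes f g :: "'a \<Rightarrow> real"
  assumes meas: "f \<in> borel_measurable M" "g \<in> borel_measurable M"
    and sq: "integrable M (\<lambda>x. (f x)\<^sup>2)" "integrable M (\<lambda>x. (g x)\<^sup>2)"
  shows "(integral\<^sup>L M (\<lambda>x. f x * g x))\<^sup>2 \<le> integral\<^sup>L M (\<lambda>x. (f x)\<^sup>2) * integral\<^sup>L M (\<lambda>x. (g x)\<^sup>2)"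
proof -
  define a b c where "a = integral\<^sup>L M (\<lambda>x. (f x)\<^sup>2)" "b = integral\<^sup>L M (\<lambda>x. f x * g x)"
    "c = integral\<^sup>L M (\<lambda>x. (g x)\<^sup>2)"
  have quad: "0 \<le> s\<^sup>2 * a + 2 * (s * r) * b + r\<^sup>2 * c" for s r
  proof -
    have "0 \<le> integral\<^sup>L M (\<lambda>x. (s * f x + r * g x)\<^sup>2)"
      by simp
    also have "(\<lambda>x. (s * f x + r * g x)\<^sup>2)
        = (\<lambda>x. s\<^sup>2 * (f x)\<^sup>2 + 2 * (s * r) * (f x * g x) + r\<^sup>2 * (g x)\<^sup>2)"
      by (auto simp: power2_eq_square algebra_simps)
    also have "integral\<^sup>L M \<dots> = s\<^sup>2 * a + 2 * (s * r) * b + r\<^sup>2 * c"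
      using sq square_integrable_mult[OF meas sq] by (simp add: a_b_c_def)
    finally show ?thesis .
  qed
  have "b\<^sup>2 \<le> a * c"
  proof (cases "a = 0")
    case True
    have "b = 0"
    proof (rule ccontr)
      assume "b \<noteq> 0"
      \<comment> \<open>For \<open>a = 0\<close> the form is affine in \<open>s\<close>, and here it takes the value \<open>- 1\<close>.\<close>
      then show False using quad[of "-(c + 1) / (2 * b)" 1] True by (simp add: field_simps)
    qed
    then show ?thesis using True by simp
  next
    case False
    then have "a > 0" by (simp add: a_b_c_def less_le)
    \<comment> \<open>The form at its minimizer, up to scaling.\<close>
    have "0 \<le> b\<^sup>2 * a - 2 * a * b * b + a\<^sup>2 * c"
      using quad[of "-b" a] by (simp add: algebra_simps)
    also have "\<dots> = a * (a * c - b\<^sup>2)"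
      by (simp add: power2_eq_square algebra_simps)
    finally show ?thesis using \<open>a > 0\<close> by (simp add: zero_le_mult_iff)
  qed
  then show ?thesis by (simp add: a_b_c_def)
qed

lemma L2_mult_integrable:
  assumes "f \<in> L2_circle" "g \<in> L2_circle"
  shows "integrable circle (\<lambda>x. f x * g x)"
  using assms by (intro square_integrable_mult) (auto dest: L2_circleD)

lemma periodic1_const [simp]: "periodic1 (\<lambda>_. c)"
  by (simp add: periodic1_def)

lemma L2_const [simp]: "(\<lambda>_. c) \<in> L2_circle"
  by (simp add: L2_circle_iff)

lemma L2_integrable: "f \<in> L2_circle \<Longrightarrow> integrable circle f"
  using L2_mult_integrable[of f "\<lambda>_. 1"] by simp

lemma L2_add:
  assumes "f \<in> L2_circle" "g \<in> L2_circle"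
  shows "(\<lambda>x. f x + g x) \<in> L2_circle"
proof -
  have "integrable circle (\<lambda>x. (f x)\<^sup>2 + (g x)\<^sup>2 + 2 * (f x * g x))"
    using assms by (intro Bochner_Integration.integrable_add integrable_mult_right L2_mult_integrable) (auto dest: L2_circleD)
  then show ?thesis
    using assms by (auto simp: L2_circle_iff periodic1_def power2_sum algebra_simps)
qed

lemma L2_cmult: "f \<in> L2_circle \<Longrightarrow> (\<lambda>x. c * f x) \<in> L2_circle"
  by (auto simp: L2_circle_iff periodic1_def power_mult_distrib)

lemma L2_minus: "f \<in> L2_circle \<Longrightarrow> (\<lambda>x. - f x) \<in> L2_circle"
  by (auto simp: L2_circle_iff periodic1_def)

lemma L2_diff:
  assumes "f \<in> L2_circle" "g \<in> L2_circle"
  shows "(\<lambda>x. f x - g x) \<in> L2_circle"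
  using L2_add[OF assms(1) L2_minus[OF assms(2)]] by simp

lemma L2_divide: "f \<in> L2_circle \<Longrightarrow> (\<lambda>x. f x / c) \<in> L2_circle"
  using L2_cmult[of f "1 / c"] by simp

lemma continuous_imp_measurable:
  assumes "continuous_on UNIV (f :: real \<Rightarrow> real)"
  shows "f \<in> borel_measurable lebesgue"
  using assms borel_measurable_continuous_onI measurable_completion by (metis measurable_lborel2)

lemma L2_mult_continuous:
  assumes c: "continuous_on UNIV c" "periodic1 c" and f: "f \<in> L2_circle"
  shows "(\<lambda>x. c x * f x) \<in> L2_circle"
proof -
  have "compact (c ` {0..1})"
    using c by (intro compact_continuous_image) (auto intro: continuous_on_subset)
  then obtain B where B: "\<And>x. x \<in> {0..1} \<Longrightarrow> \<bar>c x\<bar> \<le> B"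
    using compact_imp_bounded bounded_iff by (metis imageI real_norm_def)
  have meas: "(\<lambda>x. c x * f x) \<in> borel_measurable lebesgue"
    using borel_measurable_times[OF continuous_imp_measurable[OF c(1)] L2_circleD(2)[OF f]] .
  have "integrable circle (\<lambda>x. (c x * f x)\<^sup>2)"
  proof (rule Bochner_Integration.integrable_bound)
    show "integrable circle (\<lambda>x. B\<^sup>2 * (f x)\<^sup>2)"
      using f by (intro integrable_mult_right) (auto dest: L2_circleD)
    show "(\<lambda>x. (c x * f x)\<^sup>2) \<in> borel_measurable circle"
      using measurable_circle[OF meas] by simp
    have "norm ((c x * f x)\<^sup>2) \<le> norm (B\<^sup>2 * (f x)\<^sup>2)" if "x \<in> {0..1}" for x
    proof -
      have "(c x)\<^sup>2 \<le> B\<^sup>2" using B[OF that] by (meson abs_le_square_iff abs_ge_self order_trans)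
      then show ?thesis by (simp add: power_mult_distrib mult_right_mono)
    qed
    then show "AE x in circle. norm ((c x * f x)\<^sup>2) \<le> norm (B\<^sup>2 * (f x)\<^sup>2)"
      by (intro AE_I2) simp
  qed
  then show ?thesis
    using c f meas by (auto simp: L2_circle_iff periodic1_def)
qed

lemma L2_continuous: "continuous_on UNIV f \<Longrightarrow> periodic1 f \<Longrightarrow> f \<in> L2_circle"
  using L2_mult_continuous[of f "\<lambda>_. 1"] by simp

lemma L2_Cauchy_Schwarz:
  assumes "f \<in> L2_circle" "g \<in> L2_circle"
  shows "\<bar>integral\<^sup>L circle (\<lambda>x. f x * g x)\<bar> \<le> L2_norm f * L2_norm g"
proof -
  have "(integral\<^sup>L circle (\<lambda>x. f x * g x))\<^sup>2 \<le> (L2_norm f * L2_norm g)\<^sup>2"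
    using assms Cauchy_Schwarz_integral[of f circle g] by (simp add: power_mult_distrib L2_norm_sq L2_circleD)
  then show ?thesis
    by (simp add: abs_le_square_iff[symmetric])
qed

lemma L2_norm_cmult: "L2_norm (\<lambda>x. c * f x) = \<bar>c\<bar> * L2_norm f"
  by (simp add: L2_norm_def circle_integral_eq power_mult_distrib real_sqrt_mult)

lemma L2_norm_minus: "L2_norm (\<lambda>x. - f x) = L2_norm f"
  by (simp add: L2_norm_def)

lemma L2_norm_triangle:
  assumes "f \<in> L2_circle" "g \<in> L2_circle"
  shows "L2_norm (\<lambda>x. f x + g x) \<le> L2_norm f + L2_norm g"
proof (rule power2_le_imp_le)
  have "(L2_norm (\<lambda>x. f x + g x))\<^sup>2
      = integral\<^sup>L circle (\<lambda>x. (f x)\<^sup>2 + (g x)\<^sup>2 + 2 * (f x * g x))"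
    by (simp add: L2_norm_sq power2_sum mult.assoc)
  also have "\<dots> = (L2_norm f)\<^sup>2 + (L2_norm g)\<^sup>2 + 2 * integral\<^sup>L circle (\<lambda>x. f x * g x)"
    using assms L2_mult_integrable[OF assms] by (simp add: L2_norm_sq L2_circleD)
  also have "\<dots> \<le> (L2_norm f + L2_norm g)\<^sup>2"
    using L2_Cauchy_Schwarz[OF assms] by (simp add: power2_sum)
  finally show "(L2_norm (\<lambda>x. f x + g x))\<^sup>2 \<le> (L2_norm f + L2_norm g)\<^sup>2" .
qed simp

lemma L2_norm_triangle_diff:
  assumes "f \<in> L2_circle" "g \<in> L2_circle"
  shows "\<bar>L2_norm f - L2_norm g\<bar> \<le> L2_norm (\<lambda>x. f x - g x)"
proof -
  have "L2_norm f \<le> L2_norm (\<lambda>x. f x - g x) + L2_norm g"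
    using L2_norm_triangle[OF L2_diff[OF assms] assms(2)] by simp
  moreover have "L2_norm g \<le> L2_norm (\<lambda>x. g x - f x) + L2_norm f"
    using L2_norm_triangle[OF L2_diff[OF assms(2,1)] assms(1)] by simp
  moreover have "L2_norm (\<lambda>x. g x - f x) = L2_norm (\<lambda>x. f x - g x)"
    using L2_norm_minus[of "\<lambda>x. f x - g x"] by simp
  ultimately show ?thesis by linarith
qed

lemma L2_norm_mono_AE:
  assumes "f \<in> L2_circle" "g \<in> L2_circle" "AE x in circle. \<bar>f x\<bar> \<le> \<bar>g x\<bar>"
  shows "L2_norm f \<le> L2_norm g"
proof -
  have "integral\<^sup>L circle (\<lambda>x. (f x)\<^sup>2) \<le> integral\<^sup>L circle (\<lambda>x. (g x)\<^sup>2)"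
    using assms by (intro integral_mono_AE) (auto simp: abs_le_square_iff L2_circleD elim!: eventually_mono)
  then show ?thesis by (simp add: L2_norm_def circle_integral_eq)
qed

lemma L2_norm_cong_AE:
  assumes "f \<in> L2_circle" "g \<in> L2_circle" "AE x in circle. f x = g x"
  shows "L2_norm f = L2_norm g"
  using assms by (intro antisym L2_norm_mono_AE) (auto elim: eventually_mono)

lemma L2_norm_0_AE:
  assumes "f \<in> L2_circle" "L2_norm f = 0"
  shows "AE x in circle. f x = 0"
proof -
  have "integral\<^sup>L circle (\<lambda>x. (f x)\<^sup>2) = 0"
    using assms(2) L2_norm_sq[of f] by simp
  then show ?thesis
    using assms(1) integral_nonneg_eq_0_iff_AE[of circle "\<lambda>x. (f x)\<^sup>2"] by (simp add: L2_circleD)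
qed

lemma L2_norm_bounded:
  assumes "f \<in> L2_circle" "\<And>x. x \<in> {0..1} \<Longrightarrow> \<bar>f x\<bar> \<le> B"
  shows "L2_norm f \<le> B"
proof -
  have "0 \<le> B" using assms(2)[of 0] by simp
  have "L2_norm f \<le> L2_norm (\<lambda>_. B)"
    using assms \<open>0 \<le> B\<close> by (intro L2_norm_mono_AE AE_I2) auto
  also have "\<dots> = B" using \<open>0 \<le> B\<close> by (simp add: L2_norm_def circle_integral_eq)
  finally show ?thesis .
qed

lemma continuous_circle_integrable: 
  "continuous_on UNIV f \<Longrightarrow> integrable circle (f :: real \<Rightarrow> real)"
  by (rule continuous_imp_integrable_real) (auto intro: continuous_on_subset)

lemma circle_integral_HK:
  "integrable circle f \<Longrightarrow> integral\<^sup>L circle f = integral {0..1} (f :: real \<Rightarrow> real)"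
  by (rule lebesgue_integral_eq_integral) simp_all

lemma L2_abs_integrable_01: "f \<in> L2_circle \<Longrightarrow> f absolutely_integrable_on {0..1}"
  using L2_integrable set_integrable_circle by blast

subsection \<open>Translations\<close>

lemma measurable_shift:
  assumes "f \<in> borel_measurable lebesgue"
  shows "(\<lambda>x::real. f (x + d)) \<in> borel_measurable lebesgue"
proof -
  have "(\<lambda>x::real. d + (\<Sum>j\<in>Basis. (1 * (x \<bullet> j)) *\<^sub>R j)) \<in> lebesgue \<rightarrow>\<^sub>M lebesgue"
    by (rule lebesgue_affine_measurable) auto
  then have "(\<lambda>x::real. x + d) \<in> lebesgue \<rightarrow>\<^sub>M lebesgue"
    by (simp add: add.commute)
  from measurable_compose[OF this assms] show ?thesis .
qed

lemma periodic1_of_nat: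
  assumes "periodic1 f"
  shows "f (x + real n) = f x"
proof (induction n)
  case (Suc n)
  have "f (x + real (Suc n)) = f ((x + real n) + 1)" by (simp add: algebra_simps)
  then show ?case using Suc assms unfolding periodic1_def by metis
qed simp

lemma periodic1_of_int:
  assumes "periodic1 f"
  shows "f (x + of_int n) = f x"
proof (cases "n \<ge> 0")
  case True
  then show ?thesis using periodic1_of_nat[OF assms, of x "nat n"] by simp
next
  case False
  then show ?thesis using periodic1_of_nat[OF assms, of "x + of_int n" "nat (-n)"] by simp
qed

lemma periodic1_integrable_on:
  fixes f :: "real \<Rightarrow> real"
  assumes "periodic1 f" "f integrable_on {0..1}"
  shows "f integrable_on {a..b}"
proof -
  have unit: "f integrable_on {of_int k..of_int k + 1}" for k :: int
    using integrable_shift_real_ivl[of f 0 1 "- of_int k"] assms periodic1_of_int[OF assms(1), of _ "-k"]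
    by (simp add: add.commute)
  have "f integrable_on {- real n..real n}" for n
  proof (induction n)
    case (Suc n)
    have e: "of_int (- int (Suc n)) = - real (Suc n)" "- real (Suc n) + 1 = - real n"
      "of_int (int n) = real n" "real n + 1 = real (Suc n)"
      by simp_all
    have "f integrable_on {- real (Suc n)..- real n}"
      using unit[of "- int (Suc n)"] unfolding e .
    then have "f integrable_on {- real (Suc n)..real n}"
      using Suc by (rule Henstock_Kurzweil_Integration.integrable_combine[rotated 2]) simp_all
    moreover have "f integrable_on {real n..real (Suc n)}"
      using unit[of "int n"] unfolding e .
    ultimately show ?case
      by (rule Henstock_Kurzweil_Integration.integrable_combine[rotated 2]) simp_all
  qed (use integrable_on_refl[of f 0] in simp)
  note int = this
  obtain n where "max \<bar>a\<bar> \<bar>b\<bar> \<le> real n" using real_arch_simple by blast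
  then have "{a..b} \<subseteq> {- real n..real n}" by auto
  with int show ?thesis by (rule integrable_on_subinterval)
qed

lemma L2_abs_integrable:
  assumes "f \<in> L2_circle"
  shows "f absolutely_integrable_on {a..b}"
proof -
  have "f integrable_on {0..1}" "(\<lambda>x. norm (f x)) integrable_on {0..1}"
    using L2_abs_integrable_01[OF assms] by (auto simp: absolutely_integrable_on_def)
  moreover have "periodic1 (\<lambda>x. norm (f x))" "periodic1 f"
    using assms by (auto simp: L2_circle_iff periodic1_def)
  ultimately show ?thesis
    by (auto simp: absolutely_integrable_on_def intro: periodic1_integrable_on)
qed

text \<open>The part of the shifted window that leaves \<open>[0,1]\<close> on the right is the translate of the part that
  is lost on the left.\<close>

lemma periodic1_integral_shift:
  fixes f :: "real \<Rightarrow> real"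
  assumes per: "periodic1 f" and int: "f integrable_on {0..1}" and "0 \<le> d"
  shows "integral {0..1} (\<lambda>x. f (x + d)) = integral {0..1} f"
proof -
  have fi: "f integrable_on {a..b}" for a b
    by (rule periodic1_integrable_on[OF per int])
  have "integral {0..1} (\<lambda>x. f (x + d)) = integral {d..1 + d} f"
    using integral_shift_real_ivl[of d d "1 + d" f] by simp
  moreover have "integral {0..d} f = integral {1..1 + d} f"
    using integral_shift_real_ivl[of 1 1 "1 + d" f] per by (simp add: periodic1_def)
  moreover have "integral {0..d} f + integral {d..1 + d} f = integral {0..1 + d} f"
    using \<open>0 \<le> d\<close> fi by (intro Henstock_Kurzweil_Integration.integral_combine) auto
  moreover have "integral {0..1} f + integral {1..1 + d} f = integral {0..1 + d} f"
    using \<open>0 \<le> d\<close> fi by (intro Henstock_Kurzweil_Integration.integral_combine) auto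
  ultimately show ?thesis by simp
qed

lemma L2_shift:
  assumes "f \<in> L2_circle"
  shows "(\<lambda>x. f (x + d)) \<in> L2_circle"
proof -
  have p: "periodic1 (\<lambda>x. (f x)\<^sup>2)" using assms by (simp add: L2_circle_iff periodic1_def)
  have "(\<lambda>x. (f x)\<^sup>2) integrable_on {d..1 + d}"
    by (rule periodic1_integrable_on[OF p integrable_on_lebesgue_on[OF L2_circleD(4)[OF assms]]]) simp
  then have "(\<lambda>x. (f (x + d))\<^sup>2) integrable_on {0..1}"
    using integrable_shift_real_ivl[of "\<lambda>x. (f x)\<^sup>2" d "1+d" d] by simp
  then have "integrable circle (\<lambda>x. (f (x + d))\<^sup>2)"
    by (intro absolutely_integrable_imp_integrable nonnegative_absolutely_integrable_1) auto
  moreover have "f (x + 1 + d) = f (x + d)" for x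
    using L2_circleD(1)[OF assms] unfolding periodic1_def by (metis add.assoc add.commute)
  ultimately show ?thesis
    using assms by (auto simp: L2_circle_iff periodic1_def intro: measurable_shift)
qed

lemma L2_norm_shift:
  assumes "f \<in> L2_circle" "0 \<le> d"
  shows "L2_norm (\<lambda>x. f (x + d)) = L2_norm f"
proof -
  have p: "periodic1 (\<lambda>x. (f x)\<^sup>2)" using assms by (simp add: L2_circle_iff periodic1_def)
  have "integral\<^sup>L circle (\<lambda>x. (f (x + d))\<^sup>2) = integral\<^sup>L circle (\<lambda>x. (f x)\<^sup>2)"
    using periodic1_integral_shift[OF p _ assms(2)] assms L2_circleD(4)[OF L2_shift[OF assms(1)]]
    by (simp add: circle_integral_HK L2_circleD integrable_on_lebesgue_on)
  then show ?thesis by (simp add: L2_norm_def circle_integral_eq)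
qed


section \<open>Primitives of locally integrable functions\<close>

text \<open>This is local absolute continuity with derivative \<open>g\<close>, in integrated form. Product rule, chain rule and
  integration by parts can be derived from the integral identity itself, where pointwise derivatives of
  \<open>f\<close>, which exist only almost everywhere, do not occur.\<close>

definition prim :: "(real \<Rightarrow> real) \<Rightarrow> (real \<Rightarrow> real) \<Rightarrow> bool" where
  "prim f g \<longleftrightarrow> (\<forall>a b. a \<le> b \<longrightarrow>
     g absolutely_integrable_on {a..b} \<and> (g has_integral f b - f a) {a..b})"

lemma primI:
  assumes "\<And>a b. a \<le> b \<Longrightarrow> g absolutely_integrable_on {a..b}"
    and "\<And>a b. a \<le> b \<Longrightarrow> (g has_integral f b - f a) {a..b}"
  shows "prim f g"
  using assms by (simp add: prim_def)

lemma primD: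
  assumes "prim f g" 
  shows "g absolutely_integrable_on {a..b}" "a \<le> b \<Longrightarrow> (g has_integral f b - f a) {a..b}"
    "a \<le> b \<Longrightarrow> integral {a..b} g = f b - f a" "g integrable_on {a..b}"
    "(\<lambda>x. \<bar>g x\<bar>) integrable_on {a..b}"
proof -
  show 1: "g absolutely_integrable_on {a..b}"
    using assms by (cases "a \<le> b") (auto simp: prim_def)
  show "a \<le> b \<Longrightarrow> (g has_integral f b - f a) {a..b}" "a \<le> b \<Longrightarrow> integral {a..b} g = f b - f a" 
    using assms by (auto simp: prim_def intro: integral_unique)
  show "g integrable_on {a..b}" "(\<lambda>x. \<bar>g x\<bar>) integrable_on {a..b}"
    using 1 by (auto simp: absolutely_integrable_on_def)
qed

lemma prim_add: "prim f g \<Longrightarrow> prim f' g' \<Longrightarrow> prim (\<lambda>x. f x + f' x) (\<lambda>x. g x + g' x)"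
proof (rule primI)
  fix a b :: real assume f: "prim f g" and f': "prim f' g'" and "a \<le> b"
  show "(\<lambda>x. g x + g' x) absolutely_integrable_on {a..b}"
    by (rule set_integral_add(1)[OF primD(1)[OF f] primD(1)[OF f']])
  show "((\<lambda>x. g x + g' x) has_integral f b + f' b - (f a + f' a)) {a..b}"
    using has_integral_add[OF primD(2)[OF f \<open>a \<le> b\<close>] primD(2)[OF f' \<open>a \<le> b\<close>]]
    by (simp add: algebra_simps)
qed

lemma prim_cmult:
  assumes "prim f g" shows "prim (\<lambda>x. c * f x) (\<lambda>x. c * g x)"
proof (rule primI)
  fix a b :: real assume "a \<le> b"
  show "(\<lambda>x. c * g x) absolutely_integrable_on {a..b}"
    using primD(1)[OF assms, of a b] by (intro set_integrable_mult_right) auto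
  show "((\<lambda>x. c * g x) has_integral c * f b - c * f a) {a..b}"
    using has_integral_mult_right[OF primD(2)[OF assms \<open>a \<le> b\<close>], of c] by (simp add: right_diff_distrib)
qed

lemma prim_diff: "prim f g \<Longrightarrow> prim f' g' \<Longrightarrow> prim (\<lambda>x. f x - f' x) (\<lambda>x. g x - g' x)"
  using prim_add[of f g "\<lambda>x. -1 * f' x" "\<lambda>x. -1 * g' x"] prim_cmult[of f' g' "-1"] by simp

lemma prim_shift:
  assumes "prim f g" shows "prim (\<lambda>x. f (x + d)) (\<lambda>x. g (x + d))"
proof (rule primI)
  fix a b :: real assume ab: "a \<le> b"
  have "g integrable_on {a + d..b + d}" "(\<lambda>x. norm (g x)) integrable_on {a + d..b + d}"
    using primD(1)[OF assms, of "a + d" "b + d"] by (auto simp: absolutely_integrable_on_def)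
  from integrable_shift_real_ivl[OF this(1), of d] integrable_shift_real_ivl[OF this(2), of d]
  show "(\<lambda>x. g (x + d)) absolutely_integrable_on {a..b}"
    by (simp add: absolutely_integrable_on_def)
  have "a + d \<le> b + d" using ab by simp
  from has_integral_shift_real_ivl[OF primD(2)[OF assms this], of d]
  show "((\<lambda>x. g (x + d)) has_integral f (b + d) - f (a + d)) {a..b}"
    by simp
qed

lemma prim_C1:
  assumes "\<And>x. (f has_real_derivative g x) (at x)" "continuous_on UNIV g"
  shows "prim f g"
proof (rule primI)
  fix a b :: real assume "a \<le> b"
  show "g absolutely_integrable_on {a..b}"
    by (rule absolutely_integrable_continuous_real) (rule continuous_on_subset[OF assms(2)], simp)
  show "(g has_integral f b - f a) {a..b}"
    using assms(1) by (intro fundamental_theorem_of_calculus \<open>a \<le> b\<close>)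
      (auto simp: has_real_derivative_iff_has_vector_derivative[symmetric] intro: DERIV_subset)
qed

lemma prim_const: "prim (\<lambda>_. c) (\<lambda>_. 0)"
  by (rule prim_C1) auto

lemma prim_continuous:
  assumes "prim f g" shows "continuous_on UNIV f"
proof -
  have "isCont f x" for x
  proof -
    have "continuous_on {x-1..x+1} (\<lambda>y. integral {x-1..y} g)"
      by (rule indefinite_integral_continuous_1[OF primD(4)[OF assms]])
    then have "continuous_on {x-1..x+1} (\<lambda>y. f (x-1) + (f y - f (x-1)))"
      using primD(3)[OF assms]
      by (intro continuous_on_add continuous_on_const) (auto elim!: continuous_on_cong[THEN iffD1, rotated 2])
    then have "continuous_on {x-1..x+1} f" by simp
    then have "continuous_on {x-1<..<x+1} f"
      by (rule continuous_on_subset) auto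
    then show ?thesis
      by (subst (asm) continuous_on_eq_continuous_at) auto
  qed
  then show ?thesis by (simp add: continuous_at_imp_continuous_on)
qed

lemma prim_has_derivative:
  assumes "prim f g" "continuous_on UNIV g"
  shows "(f has_real_derivative g x) (at x)"
proof -
  have "((\<lambda>y. integral {x-1..y} g) has_real_derivative g x) (at x within {x-1..x+1})"
    by (rule integral_has_real_derivative) (auto intro: continuous_on_subset[OF assms(2)])
  then have "((\<lambda>y. integral {x-1..y} g) has_real_derivative g x) (at x)"
    by (subst (asm) at_within_Icc_at) auto
  then have "((\<lambda>y. f y - f (x-1)) has_real_derivative g x) (at x)"
    by (rule DERIV_cong_ev[THEN iffD1, rotated 3])
       (auto simp: primD(3)[OF assms(1)] eventually_nhds intro!: exI[of _ "{x-1<..}"])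
  then have "((\<lambda>y. (f y - f (x-1)) + f (x-1)) has_real_derivative g x + 0) (at x)"
    by (rule DERIV_add) simp
  then show ?thesis by simp
qed

text \<open>Chain rule. On a short interval the mean value theorem and \<open>f y - f x = \<integral> g\<close> show that
  \<open>\<Phi> (f y) - \<Phi> (f x)\<close> differs from \<open>\<integral> \<Phi>' (f) g\<close> by at most \<open>e \<integral> \<bar>g\<bar>\<close>, where \<open>e\<close> is the
  oscillation of \<open>\<Phi>' \<circ> f\<close>. Both sides of this estimate are additive over intervals, so Bolzano's
  bisection argument extends it to long intervals with the same \<open>e\<close>, which is arbitrary.\<close>

lemma prim_compose:
  assumes fg: "prim f g" and der: "\<And>x. (\<Phi> has_real_derivative \<Phi>' x) (at x)" 
    and cont: "continuous_on UNIV \<Phi>'"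
  shows "prim (\<lambda>x. \<Phi> (f x)) (\<lambda>x. \<Phi>' (f x) * g x)"
proof (rule primI)
  have contf: "continuous_on UNIV f" by (rule prim_continuous[OF fg])
  have contP: "continuous_on UNIV (\<lambda>x. \<Phi>' (f x))"
    by (rule continuous_on_compose2[OF cont contf]) simp
  show absint: "(\<lambda>x. \<Phi>' (f x) * g x) absolutely_integrable_on {a..b}" for a b
  proof (rule absolutely_integrable_bounded_measurable_product_real)
    have c: "continuous_on {a..b} (\<lambda>x. \<Phi>' (f x))" using contP continuous_on_subset by blast
    then show "(\<lambda>x. \<Phi>' (f x)) \<in> borel_measurable (lebesgue_on {a..b})"
      by (rule continuous_imp_measurable_on_sets_lebesgue) simp
    show "bounded ((\<lambda>x. \<Phi>' (f x)) ` {a..b})"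
      by (rule compact_imp_bounded[OF compact_continuous_image[OF c]]) simp
    show "g absolutely_integrable_on {a..b}" by (rule primD(1)[OF fg])
  qed simp
  have int: "(\<lambda>x. \<Phi>' (f x) * g x) integrable_on {a..b}" for a b
    using absint by (simp add: absolutely_integrable_on_def)
  define err where "err a b = \<bar>\<Phi> (f b) - \<Phi> (f a) - integral {a..b} (\<lambda>x. \<Phi>' (f x) * g x)\<bar>" for a b
  define var where "var a b = integral {a..b} (\<lambda>x. \<bar>g x\<bar>)" for a b
  fix a b :: real assume "a \<le> b"
  have small: "err a b \<le> e * var a b" if "e > 0" for e
    using \<open>a \<le> b\<close>
  proof (induction rule: Bolzano)
    case (trans x y z)
    have "var x y + var y z = var x z"
      unfolding var_def using trans primD(5)[OF fg] by (intro Henstock_Kurzweil_Integration.integral_combine) auto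
    moreover have "integral {x..y} (\<lambda>x. \<Phi>' (f x) * g x) + integral {y..z} (\<lambda>x. \<Phi>' (f x) * g x)
        = integral {x..z} (\<lambda>x. \<Phi>' (f x) * g x)"
      using trans int by (intro Henstock_Kurzweil_Integration.integral_combine) auto
    then have "err x z \<le> err x y + err y z" unfolding err_def by linarith
    moreover have "e * var x z = e * var x y + e * var y z"
      using calculation(1) by (simp add: distrib_left[symmetric])
    ultimately show ?case using trans by linarith
  next
    case (local z)
    have "isCont (\<lambda>x. \<Phi>' (f x)) z" using contP by (simp add: continuous_on_eq_continuous_at)
    then obtain d where "d > 0" and d: "\<And>s. \<bar>s - z\<bar> < d \<Longrightarrow> \<bar>\<Phi>' (f s) - \<Phi>' (f z)\<bar> < e / 2"
      using \<open>e > 0\<close> unfolding continuous_at_eps_delta dist_real_def by (metis half_gt_zero)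
    have "err x y \<le> e * var x y" if xy: "x \<le> z" "z \<le> y" "y - x < d" for x y
    proof -
      have "x \<le> y" using xy by simp
      \<comment> \<open>The intermediate point of the mean value theorem lies between two values of \<open>f\<close>, so by continuity
        it is itself a value \<open>f s\<close>; this reduces everything to the continuity of \<open>\<Phi>' \<circ> f\<close>.\<close>
      obtain s where s: "s \<in> {x..y}" "\<Phi> (f y) - \<Phi> (f x) = \<Phi>' (f s) * (f y - f x)"
      proof (cases "f x = f y")
        case True
        then show ?thesis using that[of x] \<open>x \<le> y\<close> by simp
      next
        case False
        define l r where "l = min (f x) (f y)" "r = max (f x) (f y)"
        have "l < r" using False by (auto simp: l_r_def)
        from MVT2[OF this, of \<Phi> \<Phi>'] der obtain v where v: "l < v" "v < r" "\<Phi> r - \<Phi> l = (r - l) * \<Phi>' v"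
          by blast
        have "connected (f ` {x..y})"
          by (rule connected_continuous_image) (auto intro: continuous_on_subset[OF contf])
        moreover have "l \<in> f ` {x..y}" "r \<in> f ` {x..y}" using \<open>x \<le> y\<close> by (auto simp: l_r_def min_def max_def)
        ultimately have "v \<in> f ` {x..y}" using v by (meson connected_contains_Icc atLeastAtMost_iff less_imp_le subsetD)
        then obtain s where "s \<in> {x..y}" "v = f s" by auto
        moreover have "\<Phi> (f y) - \<Phi> (f x) = \<Phi>' v * (f y - f x)"
          using v(3) False by (cases "f x < f y") (auto simp: l_r_def min_def max_def algebra_simps split: if_splits)
        ultimately show ?thesis using that by simp
      qed
      have "integral {x..y} (\<lambda>t. (\<Phi>' (f s) - \<Phi>' (f t)) * g t)
          = integral {x..y} (\<lambda>t. \<Phi>' (f s) * g t) - integral {x..y} (\<lambda>t. \<Phi>' (f t) * g t)"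
        unfolding left_diff_distrib
        by (intro Henstock_Kurzweil_Integration.integral_diff integrable_on_mult_right primD(4)[OF fg] int)
      also have "integral {x..y} (\<lambda>t. \<Phi>' (f s) * g t) = \<Phi>' (f s) * (f y - f x)"
        using primD(3)[OF fg \<open>x \<le> y\<close>] by simp
      finally have *: "err x y = \<bar>integral {x..y} (\<lambda>t. (\<Phi>' (f s) - \<Phi>' (f t)) * g t)\<bar>"
        by (simp add: err_def s)
      have "\<dots> \<le> integral {x..y} (\<lambda>t. e * \<bar>g t\<bar>)"
        unfolding real_norm_def[symmetric]
      proof (rule integral_norm_bound_integral)
        show "(\<lambda>t. (\<Phi>' (f s) - \<Phi>' (f t)) * g t) integrable_on {x..y}"
          unfolding left_diff_distrib
          by (intro integrable_diff integrable_on_mult_right primD(4)[OF fg] int)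
        show "(\<lambda>t. e * norm (g t)) integrable_on {x..y}"
          using integrable_on_mult_right[OF primD(5)[OF fg]] by simp
        fix t assume "t \<in> {x..y}"
        then have "\<bar>s - z\<bar> < d" "\<bar>t - z\<bar> < d" using s xy by auto
        from d[OF this(1)] d[OF this(2)] have "\<bar>\<Phi>' (f s) - \<Phi>' (f t)\<bar> \<le> e" by linarith
        then show "norm ((\<Phi>' (f s) - \<Phi>' (f t)) * g t) \<le> e * norm (g t)"
          by (simp add: abs_mult mult_right_mono)
      qed
      then show ?thesis using * by (simp add: var_def)
    qed
    with \<open>d > 0\<close> show ?case by blast
  qed
  have "0 \<le> var a b" unfolding var_def by (rule Henstock_Kurzweil_Integration.integral_nonneg[OF primD(5)[OF fg]]) simp
  have "err a b \<le> 0"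
  proof (rule field_le_epsilon)
    fix e :: real assume "e > 0"
    have "err a b \<le> e / (var a b + 1) * var a b"
      using \<open>e > 0\<close> \<open>0 \<le> var a b\<close> by (intro small) simp
    also have "\<dots> \<le> e" using \<open>e > 0\<close> \<open>0 \<le> var a b\<close> by (simp add: field_simps)
    finally show "err a b \<le> 0 + e" by simp
  qed
  then have "integral {a..b} (\<lambda>x. \<Phi>' (f x) * g x) = \<Phi> (f b) - \<Phi> (f a)" by (simp add: err_def)
  then show "((\<lambda>x. \<Phi>' (f x) * g x) has_integral \<Phi> (f b) - \<Phi> (f a)) {a..b}"
    using int has_integral_integral by metis
qed

text \<open>Product rule, by polarization from the chain rule for the square.\<close>

lemma prim_mult:
  assumes "prim f g" "prim f' g'"
  shows "prim (\<lambda>x. f x * f' x) (\<lambda>x. g x * f' x + f x * g' x)"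
proof -
  have sq: "prim (\<lambda>x. (h x)\<^sup>2) (\<lambda>x. 2 * h x * k x)" if "prim h k" for h k
    by (rule prim_compose[OF that, of "\<lambda>x. x\<^sup>2" "\<lambda>x. 2 * x"])
       (auto intro!: derivative_eq_intros continuous_intros)
  have "prim (\<lambda>x. 1/4 * ((f x + f' x)\<^sup>2 - (f x - f' x)\<^sup>2))
      (\<lambda>x. 1/4 * (2 * (f x + f' x) * (g x + g' x) - 2 * (f x - f' x) * (g x - g' x)))"
    by (intro prim_cmult prim_diff sq prim_add assms)
  moreover have e: "1/4 * ((a + b)\<^sup>2 - (a - b)\<^sup>2) = a * b"
    "1/4 * (2 * (a + b) * (c + d) - 2 * (a - b) * (c - d)) = c * b + a * d" for a b c d :: real
    by (auto simp: power2_eq_square algebra_simps)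
  ultimately show ?thesis unfolding e by simp
qed


section \<open>Square-integrable derivatives on the circle\<close>

text \<open>The functions \<open>f\<close> that admit some \<open>g\<close> in this relation are the continuous representatives of the
  elements of \<open>H\<^sup>1\<close>, and \<open>g\<close> is a representative of the weak derivative. Working with the
  pair avoids having to choose a derivative.\<close>

definition L2_deriv :: "(real \<Rightarrow> real) \<Rightarrow> (real \<Rightarrow> real) \<Rightarrow> bool" where
  "L2_deriv f g \<longleftrightarrow> periodic1 f \<and> g \<in> L2_circle \<and> prim f g"

lemma L2_derivD:
  assumes "L2_deriv f g"
  shows "periodic1 f" "g \<in> L2_circle" "prim f g" "continuous_on UNIV f" "f \<in> L2_circle"
  using assms prim_continuous[of f g] L2_continuous[of f] by (auto simp: L2_deriv_def)

lemma L2_deriv_add: "L2_deriv f g \<Longrightarrow> L2_deriv f' g' \<Longrightarrow> L2_deriv (\<lambda>x. f x + f' x) (\<lambda>x. g x + g' x)"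
  by (auto simp: L2_deriv_def prim_add L2_add periodic1_def)

lemma L2_deriv_diff: "L2_deriv f g \<Longrightarrow> L2_deriv f' g' \<Longrightarrow> L2_deriv (\<lambda>x. f x - f' x) (\<lambda>x. g x - g' x)"
  by (auto simp: L2_deriv_def prim_diff L2_diff periodic1_def)

lemma L2_deriv_cmult: "L2_deriv f g \<Longrightarrow> L2_deriv (\<lambda>x. c * f x) (\<lambda>x. c * g x)"
  by (auto simp: L2_deriv_def prim_cmult L2_cmult periodic1_def)

lemma L2_deriv_const: "L2_deriv (\<lambda>_. c) (\<lambda>_. 0)"
  by (simp add: L2_deriv_def prim_const)

lemma L2_deriv_shift:
  assumes "L2_deriv f g" shows "L2_deriv (\<lambda>x. f (x + d)) (\<lambda>x. g (x + d))"
proof -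
  have "f (x + 1 + d) = f (x + d)" for x
    using L2_derivD(1)[OF assms] unfolding periodic1_def by (metis add.assoc add.commute)
  then show ?thesis
    using assms by (auto simp: L2_deriv_def prim_shift L2_shift periodic1_def)
qed

lemma L2_deriv_mult:
  assumes "L2_deriv f g" "L2_deriv f' g'"
  shows "L2_deriv (\<lambda>x. f x * f' x) (\<lambda>x. g x * f' x + f x * g' x)"
proof -
  have "(\<lambda>x. f' x * g x + f x * g' x) \<in> L2_circle"
    using assms by (intro L2_add L2_mult_continuous) (auto dest: L2_derivD)
  then show ?thesis
    using assms prim_mult[of f g f' g'] by (auto simp: L2_deriv_def periodic1_def mult.commute)
qed

lemma L2_deriv_compose:
  assumes "L2_deriv f g" "\<And>x. (\<Phi> has_real_derivative \<Phi>' x) (at x)" "continuous_on UNIV \<Phi>'"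
  shows "L2_deriv (\<lambda>x. \<Phi> (f x)) (\<lambda>x. \<Phi>' (f x) * g x)"
proof -
  have "continuous_on UNIV (\<lambda>x. \<Phi>' (f x))"
    by (rule continuous_on_compose2[OF assms(3) L2_derivD(4)[OF assms(1)]]) simp
  then have "(\<lambda>x. \<Phi>' (f x) * g x) \<in> L2_circle"
    using assms(1) by (intro L2_mult_continuous) (auto simp: L2_deriv_def periodic1_def)
  then show ?thesis
    using assms prim_compose[of f g \<Phi> \<Phi>'] by (auto simp: L2_deriv_def periodic1_def)
qed

lemma L2_deriv_C1:
  assumes "\<And>x. (f has_real_derivative g x) (at x)" "continuous_on UNIV g" "periodic1 f"
  shows "L2_deriv f g"
proof -
  have "g (x + 1) = g x" for x
  proof -
    have "((\<lambda>y. f (y + 1)) has_real_derivative g (x + 1)) (at x)"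
      using assms(1)[of "x + 1"] by (simp add: DERIV_shift)
    then have "(f has_real_derivative g (x + 1)) (at x)"
      using assms(3) by (simp add: periodic1_def)
    then show ?thesis using assms(1) DERIV_unique by blast
  qed
  then show ?thesis
    using assms by (auto simp: L2_deriv_def periodic1_def intro!: prim_C1 L2_continuous)
qed

text \<open>Periodicity: there are no boundary terms on the circle.\<close>

lemma L2_deriv_integral:
  assumes "L2_deriv f g"
  shows "integral\<^sup>L circle g = 0"
proof -
  have "integral\<^sup>L circle g = f 1 - f 0"
    using primD(3)[OF L2_derivD(3)[OF assms], of 0 1] L2_derivD(2)[OF assms]
    by (simp add: circle_integral_HK L2_integrable)
  also have "f 1 = f 0" using L2_derivD(1)[OF assms] unfolding periodic1_def by (metis add_0)
  finally show ?thesis by simp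
qed

lemma L2_deriv_by_parts:
  assumes "L2_deriv f g" "L2_deriv f' g'"
  shows "integral\<^sup>L circle (\<lambda>x. f x * g' x) = - integral\<^sup>L circle (\<lambda>x. g x * f' x)"
proof -
  have "integral\<^sup>L circle (\<lambda>x. g x * f' x + f x * g' x) = 0"
    by (rule L2_deriv_integral[OF L2_deriv_mult[OF assms]])
  then show ?thesis
    using assms by (subst (asm) Bochner_Integration.integral_add)
      (auto intro: L2_mult_integrable dest: L2_derivD)
qed

lemma prim_exists:
  assumes "\<And>a b. g absolutely_integrable_on {a..b :: real}"
  shows "\<exists>f. prim f (g :: real \<Rightarrow> real)"
proof -
  define f where "f x = (if x \<ge> 0 then integral {0..x} g else - integral {x..0} g)" for x
  have int: "g integrable_on {a..b}" for a b
    using assms by (simp add: absolutely_integrable_on_def)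
  have comb: "integral {a..b} g + integral {b..c} g = integral {a..c} g" if "a \<le> b" "b \<le> c" for a b c
    by (rule Henstock_Kurzweil_Integration.integral_combine[OF that int])
  have "(g has_integral f b - f a) {a..b}" if "a \<le> b" for a b
  proof -
    have "integral {a..b} g = f b - f a"
      using that comb[of 0 a b] comb[of a b 0] comb[of a 0 b] by (auto simp: f_def)
    then show ?thesis using int has_integral_integral by metis
  qed
  then show ?thesis using assms by (auto simp: prim_def)
qed

lemma antiderivative_exists:
  assumes "continuous_on UNIV (g :: real \<Rightarrow> real)"
  shows "\<exists>f. prim f g \<and> (\<forall>x. (f has_real_derivative g x) (at x))"
proof -
  have "\<exists>f. prim f g"
    by (rule prim_exists, rule absolutely_integrable_continuous_real) (rule continuous_on_subset[OF assms], simp)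
  then show ?thesis using prim_has_derivative[OF _ assms] by blast
qed

text \<open>The increment of the primitive over any period is the mean of \<open>g\<close>, so a vanishing mean is what makes
  the primitive periodic.\<close>

lemma mean_zero_antiderivative:
  assumes "g \<in> L2_circle" "integral\<^sup>L circle g = 0"
  shows "\<exists>f. L2_deriv f g"
proof -
  obtain f where f: "prim f g"
    using prim_exists[of g] L2_abs_integrable[OF assms(1)] by blast
  have "f (x + 1) = f x" for x
  proof -
    have "f (x + 1) - f x = f 1 - f 0"
    proof -
      have per: "periodic1 g" by (rule L2_circleD[OF assms(1)])
      have "integral {y..y + 1} g = integral {0..1} g" if "0 \<le> y" for y
        using periodic1_integral_shift[OF per primD(4)[OF f] that] integral_shift_real_ivl[of y y "y + 1" g]
        by (simp add: add.commute)
      note 1 = this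
      obtain n where n: "- x \<le> real n" using real_arch_simple by blast
      have "integral {x..x + 1} g = integral {x + real n..x + real n + 1} g"
        using integral_shift_real_ivl[of "x + real n" "real n" "x + real n + 1" g]
          periodic1_of_nat[OF per] by (simp add: algebra_simps)
      also have "\<dots> = integral {0..1} g" using n by (intro 1) simp
      finally show ?thesis using primD(3)[OF f, of x "x + 1"] primD(3)[OF f, of 0 1] by simp
    qed
    also have "f 1 - f 0 = integral\<^sup>L circle g"
      using primD(3)[OF f, of 0 1] assms(1) by (simp add: circle_integral_HK L2_integrable)
    finally show ?thesis using assms(2) by simp
  qed
  then show ?thesis using f assms by (auto simp: L2_deriv_def periodic1_def)
qed

subsection \<open>Difference quotients\<close>

text \<open>By the Cauchy--Schwarz inequality \<open>(f (x + d) - f x)\<^sup>2\<close> is at most \<open>d\<close> times the integral of \<open>g\<^sup>2\<close> over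
  \<open>[x, x + d]\<close>. The average over \<open>x\<close> of the latter is computed from a
  primitive \<open>P\<close> of \<open>g\<^sup>2\<close> and a primitive \<open>Q\<close> of \<open>P\<close>: the derivative in \<open>d\<close> of
  \<open>Q (1 + d) - Q d\<close> is \<open>P (1 + d) - P d\<close>, which is constant by periodicity.\<close>

lemma L2_norm_difference_le:
  assumes fg: "L2_deriv f g" and "0 < d"
  shows "L2_norm (\<lambda>x. f (x + d) - f x) \<le> d * L2_norm g"
proof -
  have g2: "periodic1 (\<lambda>x. (g x)\<^sup>2)" "(\<lambda>x. (g x)\<^sup>2) integrable_on {0..1}"
    using L2_derivD(2)[OF fg] L2_circleD[of g] integrable_on_lebesgue_on[of "{0..1}" "\<lambda>x. (g x)\<^sup>2"]
    by (auto simp: periodic1_def)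
  have abs: "(\<lambda>x. (g x)\<^sup>2) absolutely_integrable_on {a..b}" for a b
    by (rule nonnegative_absolutely_integrable_1[OF periodic1_integrable_on[OF g2]]) simp
  then obtain P where P: "prim P (\<lambda>x. (g x)\<^sup>2)" using prim_exists[of "\<lambda>x. (g x)\<^sup>2"] by blast
  obtain Q where Q: "prim Q P" "\<And>x. (Q has_real_derivative P x) (at x)"
    using antiderivative_exists[OF prim_continuous[OF P]] by blast
  have Pshift: "P (x + 1) - P x = (L2_norm g)\<^sup>2" if "0 \<le> x" for x
  proof -
    have "P (x + 1) - P x = integral {x..x + 1} (\<lambda>x. (g x)\<^sup>2)" by (simp add: primD(3)[OF P])
    also have "\<dots> = integral {0..1} (\<lambda>x. (g x)\<^sup>2)"
      using periodic1_integral_shift[OF g2 that] integral_shift_real_ivl[of x x "x + 1" "\<lambda>x. (g x)\<^sup>2"]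
      by (simp add: add.commute)
    also have "\<dots> = (L2_norm g)\<^sup>2"
      by (simp add: L2_norm_sq circle_integral_HK L2_circleD[OF L2_derivD(2)[OF fg]])
    finally show ?thesis .
  qed
  have pointwise: "(f (x + d) - f x)\<^sup>2 \<le> d * (P (x + d) - P x)" for x
  proof -
    let ?M = "lebesgue_on {x..x + d}"
    have gi: "integrable ?M g" "integrable ?M (\<lambda>x. (g x)\<^sup>2)"
      by (rule absolutely_integrable_imp_integrable, rule primD(1)[OF L2_derivD(3)[OF fg]], simp)
        (rule absolutely_integrable_imp_integrable[OF abs], simp)
    have "(integral\<^sup>L ?M (\<lambda>x. 1 * g x))\<^sup>2
        \<le> integral\<^sup>L ?M (\<lambda>x. 1\<^sup>2) * integral\<^sup>L ?M (\<lambda>x. (g x)\<^sup>2)"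
      using gi by (intro Cauchy_Schwarz_integral) auto
    moreover have "integral\<^sup>L ?M (\<lambda>x. 1 * g x) = f (x + d) - f x"
      using lebesgue_integral_eq_integral[OF gi(1)] primD(3)[OF L2_derivD(3)[OF fg], of x "x + d"] \<open>0 < d\<close> by simp
    moreover have "integral\<^sup>L ?M (\<lambda>x. (g x)\<^sup>2) = P (x + d) - P x"
      using lebesgue_integral_eq_integral[OF gi(2)] primD(3)[OF P, of x "x + d"] \<open>0 < d\<close> by simp
    moreover have "integral\<^sup>L ?M (\<lambda>x. 1\<^sup>2) = d"
      using \<open>0 < d\<close> by (simp add: measure_restrict_space)
    ultimately show ?thesis by simp
  qed
  have Pc: "continuous_on UNIV P" "continuous_on UNIV (\<lambda>x. P (x + d))"
    using prim_continuous[OF P] prim_continuous[OF prim_shift[OF P]] by auto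
  have "(L2_norm (\<lambda>x. f (x + d) - f x))\<^sup>2 \<le> integral\<^sup>L circle (\<lambda>x. d * (P (x + d) - P x))"
    unfolding L2_norm_sq
  proof (rule integral_mono)
    show "integrable circle (\<lambda>x. (f (x + d) - f x)\<^sup>2)"
      using fg by (intro L2_circleD(4) L2_diff L2_shift) (auto dest: L2_derivD)
    show "integrable circle (\<lambda>x. d * (P (x + d) - P x))"
      using Pc by (intro continuous_circle_integrable continuous_intros)
  qed (rule pointwise)
  also have "\<dots> = d * integral {0..1} (\<lambda>x. P (x + d) - P x)"
    using Pc by (subst circle_integral_HK) (auto intro!: continuous_circle_integrable continuous_intros)
  also have "integral {0..1} (\<lambda>x. P (x + d) - P x) = (Q (1 + d) - Q d) - (Q 1 - Q 0)"
    using primD(3)[OF prim_diff[OF prim_shift[OF Q(1), of d] Q(1)], of 0 1] by simp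
  also have "\<dots> = d * (L2_norm g)\<^sup>2"
  proof -
    have Q1: "((\<lambda>z. Q (1 + z)) has_real_derivative P (1 + x)) (at x)" for x
      using DERIV_shift[THEN iffD1, OF Q(2)[of "x + 1"]] by (simp add: add.commute)
    have "\<exists>z. z > 0 \<and> z < d \<and> (Q (1 + d) - Q d) - (Q (1 + 0) - Q 0) = (d - 0) * (P (1 + z) - P z)"
      by (rule MVT2[OF \<open>0 < d\<close> DERIV_diff[OF Q1 Q(2)]])
    then show ?thesis using Pshift by (auto simp: add.commute)
  qed
  also have "d * (d * (L2_norm g)\<^sup>2) = (d * L2_norm g)\<^sup>2"
    by (simp add: power2_eq_square)
  finally have "(L2_norm (\<lambda>x. f (x + d) - f x))\<^sup>2 \<le> (d * L2_norm g)\<^sup>2" .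
  then show ?thesis by (rule power2_le_imp_le) (use \<open>0 < d\<close> in simp)
qed

lemma bounded_on_circle:
  assumes "continuous_on UNIV (f :: real \<Rightarrow> real)"
  shows "\<exists>B. (\<forall>x\<in>{0..1}. \<bar>f x\<bar> \<le> B) \<and> 0 \<le> B"
proof -
  have "compact (f ` {0..1})"
    by (rule compact_continuous_image[OF continuous_on_subset[OF assms]]) auto
  then obtain B where "\<forall>x\<in>{0..1}. \<bar>f x\<bar> \<le> B"
    using compact_imp_bounded bounded_iff by (metis imageI real_norm_def)
  moreover from this have "0 \<le> B" by (metis abs_ge_zero atLeastAtMost_iff order_refl order_trans zero_le_one)
  ultimately show ?thesis by blast
qed

lemma L2_deriv_bounded:
  assumes "L2_deriv f g" shows "\<exists>B\<ge>0. \<forall>x. \<bar>f x\<bar> \<le> B"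
proof -
  obtain B where B: "\<forall>x\<in>{0..1}. \<bar>f x\<bar> \<le> B" "0 \<le> B"
    using bounded_on_circle[OF L2_derivD(4)[OF assms]] by blast
  have "\<bar>f x\<bar> \<le> B" for x
  proof -
    have "x - of_int \<lfloor>x\<rfloor> \<in> {0..1}" by simp linarith
    moreover have "f (x - of_int \<lfloor>x\<rfloor>) = f x"
      using periodic1_of_int[OF L2_derivD(1)[OF assms], of x "- \<lfloor>x\<rfloor>"] by simp
    ultimately show ?thesis using B(1) by metis
  qed
  then show ?thesis using B by blast
qed

text \<open>Dominated convergence on both sides. This closure property carries a duality estimate from smooth test
  functions to rough ones.\<close>

lemma functional_bound_limit:
  fixes g :: "real \<Rightarrow> real" and \<psi> :: "nat \<Rightarrow> real \<Rightarrow> real"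
  assumes g: "integrable circle g"
    and meas: "\<psi>' \<in> borel_measurable circle" "\<And>n. \<psi> n \<in> borel_measurable circle"
    and bound: "\<And>n x. x \<in> {0..1} \<Longrightarrow> \<bar>\<psi> n x\<bar> \<le> B"
    and lim: "AE x in circle. (\<lambda>n. \<psi> n x) \<longlonglongrightarrow> \<psi>' x"
    and le: "\<And>n. \<bar>integral\<^sup>L circle (\<lambda>x. g x * \<psi> n x)\<bar> \<le> A * sqrt (integral\<^sup>L circle (\<lambda>x. (\<psi> n x)\<^sup>2))"
  shows "\<bar>integral\<^sup>L circle (\<lambda>x. g x * \<psi>' x)\<bar> \<le> A * sqrt (integral\<^sup>L circle (\<lambda>x. (\<psi>' x)\<^sup>2))"
proof -
  have gm: "g \<in> borel_measurable circle" using g by auto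
  have "(\<lambda>n. integral\<^sup>L circle (\<lambda>x. g x * \<psi> n x)) \<longlonglongrightarrow> integral\<^sup>L circle (\<lambda>x. g x * \<psi>' x)"
  proof (rule integral_dominated_convergence[where w = "\<lambda>x. \<bar>g x\<bar> * B"])
    show "AE x in circle. (\<lambda>n. g x * \<psi> n x) \<longlonglongrightarrow> g x * \<psi>' x"
      using lim by (rule eventually_mono) (intro tendsto_intros)
    show "AE x in circle. norm (g x * \<psi> n x) \<le> \<bar>g x\<bar> * B" for n
      using bound by (intro AE_I2) (auto simp: abs_mult mult_left_mono)
  qed (use g gm meas in auto)
  moreover have "(\<lambda>n. integral\<^sup>L circle (\<lambda>x. (\<psi> n x)\<^sup>2)) \<longlonglongrightarrow> integral\<^sup>L circle (\<lambda>x. (\<psi>' x)\<^sup>2)"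
  proof (rule integral_dominated_convergence[where w = "\<lambda>x. B\<^sup>2"])
    show "AE x in circle. (\<lambda>n. (\<psi> n x)\<^sup>2) \<longlonglongrightarrow> (\<psi>' x)\<^sup>2"
      using lim by (rule eventually_mono) (intro tendsto_intros)
    show "AE x in circle. norm ((\<psi> n x)\<^sup>2) \<le> B\<^sup>2" for n
    proof (intro AE_I2)
      fix x assume "x \<in> space circle"
      then have "\<bar>\<psi> n x\<bar> \<le> \<bar>B\<bar>" using bound[of x n] by auto
      then show "norm ((\<psi> n x)\<^sup>2) \<le> B\<^sup>2" by (simp add: abs_le_square_iff)
    qed
  qed (use meas in auto)
  ultimately show ?thesis
    by (intro tendsto_le[OF sequentially_bot _ _ always_eventually[OF allI[OF le]]] tendsto_intros)
qed

text \<open>Duality: it suffices to test \<open>g\<close> against continuously differentiable functions. From polynomials the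
  estimate passes to continuous functions by Weierstrass' theorem, then to the truncations of \<open>g\<close>
  itself, because a measurable function is an almost everywhere limit of continuous ones. Testing \<open>g\<close>
  with its own truncation at height \<open>K\<close> bounds the norm of the truncation by \<open>A\<close>, and finally \<open>K\<close> tends
  to infinity.\<close>

lemma L2_norm_le_by_duality:
  assumes g: "g \<in> L2_circle" and "0 \<le> A"
    and le: "\<And>p p'. (\<And>x. (p has_real_derivative p' x) (at x)) \<Longrightarrow> continuous_on UNIV p' \<Longrightarrow>
      \<bar>integral\<^sup>L circle (\<lambda>x. g x * p x)\<bar> \<le> A * sqrt (integral\<^sup>L circle (\<lambda>x. (p x)\<^sup>2))"
  shows "L2_norm g \<le> A"
proof -
  let ?good = "\<lambda>\<psi>. \<bar>integral\<^sup>L circle (\<lambda>x. g x * \<psi> x)\<bar> \<le> A * sqrt (integral\<^sup>L circle (\<lambda>x. (\<psi> x)\<^sup>2))"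
  have gi: "integrable circle g" by (rule L2_integrable[OF g])
  have cont: "?good \<psi>" if c: "continuous_on UNIV \<psi>" for \<psi> :: "real \<Rightarrow> real"
  proof -
    have "\<exists>p. real_polynomial_function p \<and> (\<forall>x\<in>{0..1}. \<bar>\<psi> x - p x\<bar> < 1 / real (Suc n))" for n
      by (rule Stone_Weierstrass_real_polynomial_function[of "{0..1}" \<psi> "1 / real (Suc n)"])
         (auto intro: continuous_on_subset[OF c])
    then obtain p where p: "\<And>n. real_polynomial_function (p n)"
      "\<And>n x. x \<in> {0..1} \<Longrightarrow> \<bar>\<psi> x - p n x\<bar> < 1 / real (Suc n)" by metis
    have pc: "continuous_on UNIV (p n)" for n
      using p(1)[of n] by (simp add: real_polynomial_function_eq continuous_on_polymonial_function)
    obtain B where "\<forall>x\<in>{0..1}. \<bar>\<psi> x\<bar> \<le> B" "0 \<le> B" using bounded_on_circle[OF c] by blast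
    note B = this(1)[rule_format] this(2)
    show ?thesis
    proof (rule functional_bound_limit[OF gi])
      show "\<psi> \<in> borel_measurable circle" "\<And>n. p n \<in> borel_measurable circle"
        using c pc by (auto intro: measurable_circle continuous_imp_measurable)
      show "\<bar>p n x\<bar> \<le> B + 1" if "x \<in> {0..1}" for n x
      proof -
        have "1 / real (Suc n) \<le> 1" by simp
        then show ?thesis using B(1)[OF that] p(2)[OF that, of n] by linarith
      qed
      have "(\<lambda>n. p n x) \<longlonglongrightarrow> \<psi> x" if "x \<in> {0..1}" for x
      proof (rule LIM_zero_cancel, rule Lim_null_comparison)
        show "\<forall>\<^sub>F n in sequentially. norm (p n x - \<psi> x) \<le> 1 / real (Suc n)"
          using p(2)[OF that] by (auto simp: abs_minus_commute less_imp_le)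
        show "(\<lambda>n. 1 / real (Suc n)) \<longlonglongrightarrow> 0" by (rule LIMSEQ_Suc[OF lim_1_over_n])
      qed
      then show "AE x in circle. (\<lambda>n. p n x) \<longlonglongrightarrow> \<psi> x" by (intro AE_I2) simp
      show "?good (p n)" for n
      proof -
        obtain p' where p': "real_polynomial_function p'" "\<And>x. (p n has_real_derivative p' x) (at x)"
          using has_real_derivative_polynomial_function[OF p(1)] by blast
        show ?thesis
          using p' by (intro le[of "p n" p']) (auto simp: real_polynomial_function_eq continuous_on_polymonial_function)
      qed
    qed
  qed
  define cut where "cut K y = max (- real K) (min (real K) y)" for K :: nat and y :: real
  have cut_meas: "(\<lambda>x. cut K (h x)) \<in> borel_measurable M" if "h \<in> borel_measurable M" for K and h :: "real \<Rightarrow> real" and M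
    using that unfolding cut_def by auto
  have cut_le: "\<bar>cut K y\<bar> \<le> real K" "\<bar>cut K y\<bar> \<le> \<bar>y\<bar>" "(cut K y)\<^sup>2 \<le> y * cut K y" for K y
  proof -
    show "\<bar>cut K y\<bar> \<le> real K" "\<bar>cut K y\<bar> \<le> \<bar>y\<bar>" by (auto simp: cut_def)
    show "(cut K y)\<^sup>2 \<le> y * cut K y"
      unfolding power2_eq_square cut_def
      by (cases "y \<ge> 0") (auto simp: max_def min_def mult_right_mono mult_right_mono_neg)
  qed
  have trunc: "integral\<^sup>L circle (\<lambda>x. (cut K (g x))\<^sup>2) \<le> A\<^sup>2" for K
  proof -
    obtain N \<psi> where N: "negligible N" and \<psi>: "\<And>n. continuous_on UNIV (\<psi> n)"
      "\<And>x. x \<notin> N \<Longrightarrow> (\<lambda>n. \<psi> n x) \<longlonglongrightarrow> g x"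
      using lebesgue_measurable_imp_measurable_on[OF L2_circleD(2)[OF g], of UNIV]
      unfolding measurable_on_def by auto
    have "?good (\<lambda>x. cut K (g x))"
    proof (rule functional_bound_limit[OF gi])
      show "(\<lambda>x. cut K (g x)) \<in> borel_measurable circle"
        using L2_circleD(3)[OF g] by (rule cut_meas)
      show "(\<lambda>x. cut K (\<psi> n x)) \<in> borel_measurable circle" for n
        using \<psi>(1) by (intro cut_meas measurable_circle continuous_imp_measurable)
      show "\<bar>cut K (\<psi> n x)\<bar> \<le> real K" for n x by (rule cut_le)
      have "AE x in lebesgue. x \<notin> N" using N by (simp add: AE_not_in negligible_iff_null_sets)
      then have "AE x in circle. x \<notin> N" by (subst AE_restrict_space_iff) auto
      then show "AE x in circle. (\<lambda>n. cut K (\<psi> n x)) \<longlonglongrightarrow> cut K (g x)"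
        unfolding cut_def by (rule eventually_mono) (intro tendsto_max tendsto_min tendsto_const \<psi>(2))
      show "?good (\<lambda>x. cut K (\<psi> n x))" for n
        unfolding cut_def by (rule cont) (intro continuous_intros \<psi>(1))
    qed
    moreover have "integral\<^sup>L circle (\<lambda>x. (cut K (g x))\<^sup>2) \<le> integral\<^sup>L circle (\<lambda>x. g x * cut K (g x))"
    proof (rule integral_mono)
      show "integrable circle (\<lambda>x. (cut K (g x))\<^sup>2)"
      proof (rule Bochner_Integration.integrable_bound[OF L2_circleD(4)[OF g]])
        show "AE x in circle. norm ((cut K (g x))\<^sup>2) \<le> norm ((g x)\<^sup>2)"
          using cut_le(2) by (auto simp: abs_le_square_iff)
      qed (use L2_circleD(3)[OF g] cut_meas in auto)
      show "integrable circle (\<lambda>x. g x * cut K (g x))"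
      proof (rule Bochner_Integration.integrable_bound[OF L2_circleD(4)[OF g]])
        show "AE x in circle. norm (g x * cut K (g x)) \<le> norm ((g x)\<^sup>2)"
        proof (intro AE_I2)
          fix x
          have "\<bar>g x\<bar> * \<bar>cut K (g x)\<bar> \<le> \<bar>g x\<bar> * \<bar>g x\<bar>" by (intro mult_left_mono cut_le) simp
          then show "norm (g x * cut K (g x)) \<le> norm ((g x)\<^sup>2)"
            by (simp add: abs_mult power2_eq_square)
        qed
      qed (use L2_circleD(3)[OF g] cut_meas in auto)
    qed (rule cut_le)
    ultimately have S: "integral\<^sup>L circle (\<lambda>x. (cut K (g x))\<^sup>2) \<le> A * sqrt (integral\<^sup>L circle (\<lambda>x. (cut K (g x))\<^sup>2))"
      by linarith
    define s where "s = sqrt (integral\<^sup>L circle (\<lambda>x. (cut K (g x))\<^sup>2))"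
    have s: "integral\<^sup>L circle (\<lambda>x. (cut K (g x))\<^sup>2) = s\<^sup>2" "0 \<le> s" by (auto simp: s_def)
    have "s * s \<le> A * s" using S unfolding s by (simp add: power2_eq_square s)
    then have "s \<le> A" using \<open>0 \<le> A\<close> s(2) by (cases "s = 0") auto
    then show ?thesis unfolding s using s(2) by (simp add: power_mono)
  qed
  have "(\<lambda>K. integral\<^sup>L circle (\<lambda>x. (cut K (g x))\<^sup>2)) \<longlonglongrightarrow> integral\<^sup>L circle (\<lambda>x. (g x)\<^sup>2)"
  proof (rule integral_dominated_convergence[where w = "\<lambda>x. (g x)\<^sup>2"])
    have "(\<lambda>K. cut K y) \<longlonglongrightarrow> y" for y
    proof (rule tendsto_eventually)
      obtain n where "\<bar>y\<bar> \<le> real n" using real_arch_simple by blast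
      then show "\<forall>\<^sub>F K in sequentially. cut K y = y"
        by (intro eventually_sequentiallyI[of n]) (auto simp: cut_def)
    qed
    then show "AE x in circle. (\<lambda>K. (cut K (g x))\<^sup>2) \<longlonglongrightarrow> (g x)\<^sup>2"
      by (intro AE_I2 tendsto_power)
    show "AE x in circle. norm ((cut K (g x))\<^sup>2) \<le> (g x)\<^sup>2" for K
      using cut_le(2) by (auto simp: abs_le_square_iff)
  qed (use L2_circleD[OF g] cut_meas in auto)
  then have "(L2_norm g)\<^sup>2 \<le> A\<^sup>2"
    unfolding L2_norm_sq by (rule LIMSEQ_le_const2) (use trunc in auto)
  then show ?thesis using \<open>0 \<le> A\<close> by (rule power2_le_imp_le)
qed

text \<open>A difference quotient of \<open>f\<close> is the derivative of the running average of \<open>f\<close> over a window of length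
  \<open>d\<close>. Integrating by parts moves the derivative to a smooth test function, and the running averages
  converge boundedly to \<open>f\<close>; so the quotients converge weakly to \<open>g\<close>, and norms do not increase under
  weak limits.\<close>

lemma L2_norm_le_difference_quotients:
  assumes fg: "L2_deriv f g"
    and le: "\<And>d. 0 < d \<Longrightarrow> L2_norm (\<lambda>x. f (x + d) - f x) \<le> d * A"
  shows "L2_norm g \<le> A"
proof (rule L2_norm_le_by_duality)
  show gL: "g \<in> L2_circle" by (rule L2_derivD[OF fg])
  show "0 \<le> A" using order_trans[OF L2_norm_nonneg le[of 1]] by simp
  have fc: "continuous_on UNIV f" by (rule L2_derivD[OF fg])
  obtain F where F: "prim F f" "\<And>x. (F has_real_derivative f x) (at x)"
    using antiderivative_exists[OF fc] by blast
  obtain B where B: "0 \<le> B" and Ball: "\<And>x. \<bar>f x\<bar> \<le> B" using L2_deriv_bounded[OF fg] by blast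
  fix p p' :: "real \<Rightarrow> real"
  assume p: "\<And>x. (p has_real_derivative p' x) (at x)" and p'c: "continuous_on UNIV p'"
  have prim_p: "prim p p'" by (rule prim_C1[OF p p'c])
  have pc: "continuous_on UNIV p" by (rule prim_continuous[OF prim_p])
  obtain C where "\<forall>x\<in>{0..1}. \<bar>p' x\<bar> \<le> C" "0 \<le> C" using bounded_on_circle[OF p'c] by blast
  note C = this(1)[rule_format] this(2)
  define d where "d n = 1 / real (Suc n)" for n
  have d: "d n > 0" "d \<longlonglongrightarrow> 0" for n
    unfolding d_def using LIMSEQ_Suc[OF lim_1_over_n] by auto
  define avg where "avg n x = 1 / d n * (F (x + d n) - F x)" for n x
  define q where "q n x = 1 / d n * (f (x + d n) - f x)" for n x
  have avg_q: "prim (avg n) (q n)" for n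
  proof (rule prim_C1)
    show "(avg n has_real_derivative q n x) (at x)" for x
      unfolding avg_def[abs_def] q_def using d(1)[of n]
      by (auto intro!: derivative_eq_intros F(2) DERIV_chain'[where g = F])
    show "continuous_on UNIV (q n)"
      unfolding q_def[abs_def] by (intro continuous_intros continuous_on_compose2[OF fc]) auto
  qed
  have avg_lim: "(\<lambda>n. avg n x) \<longlonglongrightarrow> f x" for x
  proof -
    have "((\<lambda>h. (F (x + h) - F x) / h) \<longlongrightarrow> f x) (at 0)" using F(2) by (simp add: DERIV_def)
    moreover have "filterlim d (at 0) sequentially"
      using d by (auto simp: filterlim_at less_imp_neq[symmetric])
    ultimately show ?thesis unfolding avg_def by (auto dest: filterlim_compose)
  qed
  have avg_bound: "\<bar>avg n x\<bar> \<le> B" for n x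
  proof -
    have "\<exists>z>x. z < x + d n \<and> F (x + d n) - F x = (x + d n - x) * f z"
      using d(1)[of n] F(2) by (intro MVT2) auto
    then obtain z where "F (x + d n) - F x = d n * f z" by auto
    then have "avg n x = f z" using d(1)[of n] by (simp add: avg_def)
    then show ?thesis using Ball by simp
  qed
  have avgc: "continuous_on UNIV (avg n)" "continuous_on UNIV (q n)" for n
    using prim_continuous[OF avg_q] d(1)[of n] unfolding q_def[abs_def]
    by (auto intro!: continuous_intros continuous_on_compose2[OF fc])
  have parts: "integral\<^sup>L circle (\<lambda>x. q n x * p x)
      = avg n 1 * p 1 - avg n 0 * p 0 - integral\<^sup>L circle (\<lambda>x. avg n x * p' x)" for n
  proof -
    have i: "integrable circle (\<lambda>x. q n x * p x)" "integrable circle (\<lambda>x. avg n x * p' x)"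
      using avgc pc p'c by (auto intro!: continuous_circle_integrable continuous_intros)
    have "integral\<^sup>L circle (\<lambda>x. q n x * p x + avg n x * p' x) = avg n 1 * p 1 - avg n 0 * p 0"
      using primD(3)[OF prim_mult[OF avg_q[of n] prim_p], of 0 1] i by (subst circle_integral_HK) auto
    then show ?thesis using i by simp
  qed
  have gp: "integral\<^sup>L circle (\<lambda>x. g x * p x) = f 1 * p 1 - f 0 * p 0 - integral\<^sup>L circle (\<lambda>x. f x * p' x)"
  proof -
    have "integrable circle (\<lambda>x. g x * p x + f x * p' x)"
      by (rule absolutely_integrable_imp_integrable[OF primD(1)[OF prim_mult[OF L2_derivD(3)[OF fg] prim_p]]]) simp
    moreover have i: "integrable circle (\<lambda>x. f x * p' x)"
      using fc p'c by (intro continuous_circle_integrable continuous_intros)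
    ultimately have "integrable circle (\<lambda>x. (g x * p x + f x * p' x) - f x * p' x)"
      by (rule Bochner_Integration.integrable_diff)
    then have i': "integrable circle (\<lambda>x. g x * p x)" by simp
    have "integral\<^sup>L circle (\<lambda>x. g x * p x + f x * p' x) = f 1 * p 1 - f 0 * p 0"
      using primD(3)[OF prim_mult[OF L2_derivD(3)[OF fg] prim_p], of 0 1] i i' by (subst circle_integral_HK) auto
    then show ?thesis using i i' by simp
  qed
  have "(\<lambda>n. integral\<^sup>L circle (\<lambda>x. avg n x * p' x)) \<longlonglongrightarrow> integral\<^sup>L circle (\<lambda>x. f x * p' x)"
  proof (rule integral_dominated_convergence[where w = "\<lambda>_. B * C"])
    show "(\<lambda>x. f x * p' x) \<in> borel_measurable circle" "\<And>n. (\<lambda>x. avg n x * p' x) \<in> borel_measurable circle"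
      using fc p'c avgc by (auto intro!: measurable_circle continuous_imp_measurable continuous_intros)
    show "AE x in circle. (\<lambda>n. avg n x * p' x) \<longlonglongrightarrow> f x * p' x"
      by (intro AE_I2 tendsto_intros avg_lim)
    show "AE x in circle. norm (avg n x * p' x) \<le> B * C" for n
      using avg_bound C B by (intro AE_I2) (auto simp: abs_mult intro!: mult_mono)
  qed simp
  then have "(\<lambda>n. integral\<^sup>L circle (\<lambda>x. q n x * p x)) \<longlonglongrightarrow> integral\<^sup>L circle (\<lambda>x. g x * p x)"
    unfolding parts gp by (intro tendsto_intros avg_lim)
  moreover have "\<bar>integral\<^sup>L circle (\<lambda>x. q n x * p x)\<bar> \<le> A * sqrt (integral\<^sup>L circle (\<lambda>x. (p x)\<^sup>2))" for n
  proof -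
    have m: "q n \<in> borel_measurable circle" "p \<in> borel_measurable circle"
      "integrable circle (\<lambda>x. (q n x)\<^sup>2)" "integrable circle (\<lambda>x. (p x)\<^sup>2)"
      using avgc pc by (auto intro!: measurable_circle continuous_imp_measurable continuous_circle_integrable continuous_intros)
    have "L2_norm (q n) = 1 / d n * L2_norm (\<lambda>x. f (x + d n) - f x)"
      unfolding q_def[abs_def] L2_norm_cmult using d(1)[of n] by simp
    then have "L2_norm (q n) \<le> A"
      using le[OF d(1)[of n]] d(1)[of n] by (simp add: pos_divide_le_eq mult.commute)
    moreover have "\<bar>integral\<^sup>L circle (\<lambda>x. q n x * p x)\<bar>
        \<le> sqrt (integral\<^sup>L circle (\<lambda>x. (q n x)\<^sup>2) * integral\<^sup>L circle (\<lambda>x. (p x)\<^sup>2))"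
      using real_sqrt_le_mono[OF Cauchy_Schwarz_integral[OF m]] by (simp only: real_sqrt_abs)
    moreover have "\<dots> = L2_norm (q n) * sqrt (integral\<^sup>L circle (\<lambda>x. (p x)\<^sup>2))"
      by (simp add: real_sqrt_mult L2_norm_def circle_integral_eq)
    moreover have "L2_norm (q n) * sqrt (integral\<^sup>L circle (\<lambda>x. (p x)\<^sup>2)) \<le> A * sqrt (integral\<^sup>L circle (\<lambda>x. (p x)\<^sup>2))"
      using calculation(1) by (rule mult_right_mono) simp
    ultimately show ?thesis by linarith
  qed
  ultimately show "\<bar>integral\<^sup>L circle (\<lambda>x. g x * p x)\<bar> \<le> A * sqrt (integral\<^sup>L circle (\<lambda>x. (p x)\<^sup>2))"
    by (intro LIMSEQ_le_const2[OF tendsto_rabs]) auto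
qed

text \<open>Two derivatives differ by a derivative of the zero function, all of whose difference quotients vanish.\<close>

lemma L2_deriv_unique:
  assumes "L2_deriv f g" "L2_deriv f g'"
  shows "AE x in circle. g x = g' x"
proof -
  have "L2_deriv (\<lambda>x. f x - f x) (\<lambda>x. g x - g' x)" by (rule L2_deriv_diff[OF assms])
  then have "L2_norm (\<lambda>x. g x - g' x) \<le> 0"
    by (rule L2_norm_le_difference_quotients) (simp add: L2_norm_def circle_integral_eq)
  then have "L2_norm (\<lambda>x. g x - g' x) = 0" by (simp add: antisym)
  then have "AE x in circle. g x - g' x = 0"
    using assms by (intro L2_norm_0_AE L2_diff) (auto dest: L2_derivD)
  then show ?thesis by simp
qed


section \<open>Weak derivatives and Sobolev functions\<close>

subsection \<open>Trigonometric polynomials as test functions\<close>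

text \<open>Trigonometric polynomials are encoded as real polynomial functions of \<open>cis (2 \<pi> x)\<close>; this class is
  closed under differentiation since the derivative of a real linear form in \<open>cis\<close> is another one.\<close>

lemma trig_poly_has_derivative:
  assumes "real_polynomial_function (p :: complex \<Rightarrow> real)"
  shows "\<exists>q. real_polynomial_function q \<and>
    (\<forall>x. ((\<lambda>x. p (cis (2 * pi * x))) has_real_derivative q (cis (2 * pi * x))) (at x))"
  using assms
proof (induction p rule: real_polynomial_function.induct)
  case (linear p)
  interpret p: bounded_linear p by fact
  have "((\<lambda>x. cis (2 * pi * x)) has_vector_derivative (2 * pi) *\<^sub>R (\<i> * cis (2 * pi * x))) (at x)" for x
  proof -
    have "((\<lambda>z. exp (\<i> * (2 * of_real pi * z))) has_field_derivative 2 * of_real pi * (\<i> * cis (2 * pi * x))) (at (of_real x))"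
      by (auto intro!: derivative_eq_intros simp: cis_conv_exp)
    from has_vector_derivative_real_field[OF this]
    show ?thesis by (simp add: cis_conv_exp scaleR_conv_of_real)
  qed
  then have "((\<lambda>x. p (cis (2 * pi * x))) has_vector_derivative p ((2 * pi) *\<^sub>R (\<i> * cis (2 * pi * x)))) (at x)" for x
    by (rule p.has_vector_derivative)
  moreover have "bounded_linear (\<lambda>z. p ((2 * pi) *\<^sub>R (\<i> * z)))"
    by (intro bounded_linear_compose[OF linear] bounded_linear_compose[OF bounded_linear_scaleR_right] bounded_linear_mult_right)
  ultimately show ?case
    by (intro exI[of _ "\<lambda>z. p ((2 * pi) *\<^sub>R (\<i> * z))"])
       (auto simp: has_real_derivative_iff_has_vector_derivative)
next
  case (const c)
  show ?case by (intro exI[of _ "\<lambda>_. 0"]) auto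
next
  case (add p q)
  then obtain p' q' where "real_polynomial_function p'" "real_polynomial_function q'"
    "\<And>x. ((\<lambda>x. p (cis (2 * pi * x))) has_real_derivative p' (cis (2 * pi * x))) (at x)"
    "\<And>x. ((\<lambda>x. q (cis (2 * pi * x))) has_real_derivative q' (cis (2 * pi * x))) (at x)" by blast
  then show ?case
    by (intro exI[of _ "\<lambda>z. p' z + q' z"]) (auto intro: DERIV_add)
next
  case (mult p q)
  then obtain p' q' where "real_polynomial_function p'" "real_polynomial_function q'"
    "\<And>x. ((\<lambda>x. p (cis (2 * pi * x))) has_real_derivative p' (cis (2 * pi * x))) (at x)"
    "\<And>x. ((\<lambda>x. q (cis (2 * pi * x))) has_real_derivative q' (cis (2 * pi * x))) (at x)" by blast
  with mult show ?case
    by (intro exI[of _ "\<lambda>z. p' z * q z + q' z * p z"]) (auto intro: DERIV_mult)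
qed

lemma test_function_trig_poly:
  assumes "real_polynomial_function (p :: complex \<Rightarrow> real)"
  shows "test_function (\<lambda>x. p (cis (2 * pi * x)))"
proof -
  have "\<exists>q. real_polynomial_function q \<and> (deriv ^^ k) (\<lambda>x. p (cis (2 * pi * x))) = (\<lambda>x. q (cis (2 * pi * x)))" for k
  proof (induction k)
    case (Suc k)
    then obtain q where q: "real_polynomial_function q"
      "(deriv ^^ k) (\<lambda>x. p (cis (2 * pi * x))) = (\<lambda>x. q (cis (2 * pi * x)))" by blast
    obtain r where r: "real_polynomial_function r"
      "\<And>x. ((\<lambda>x. q (cis (2 * pi * x))) has_real_derivative r (cis (2 * pi * x))) (at x)"
      using trig_poly_has_derivative[OF q(1)] by blast
    then have "deriv (\<lambda>x. q (cis (2 * pi * x))) = (\<lambda>x. r (cis (2 * pi * x)))"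
      using DERIV_imp_deriv by blast
    then show ?case using q r by auto
  qed (use assms in auto)
  then have "(deriv ^^ k) (\<lambda>x. p (cis (2 * pi * x))) differentiable at x" for k x
    using trig_poly_has_derivative real_differentiable_def by metis
  moreover have "cis (2 * pi * (x + 1)) = cis (2 * pi * x)" for x
    by (simp add: distrib_left cis_mult[symmetric])
  ultimately show ?thesis
    by (auto simp: test_function_def periodic1_def)
qed

lemma cis_eqD:
  assumes "cis a = cis b"
  shows "\<exists>n::int. a = b + 2 * pi * of_int n"
proof -
  have "exp (\<i> * complex_of_real a) = exp (\<i> * complex_of_real b)" using assms by (simp add: cis_conv_exp)
  then obtain n :: int where "\<i> * complex_of_real a = \<i> * complex_of_real b + (of_int (2 * n) * pi) * \<i>"
    unfolding exp_eq by blast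
  from arg_cong[OF this, of Im] have "a = b + 2 * pi * of_int n" by simp
  then show ?thesis by blast
qed

lemma cis_Arg2pi:
  assumes "z \<noteq> 0" shows "cis (Arg2pi z) = sgn z"
proof -
  have "z = complex_of_real (norm z) * cis (Arg2pi z)"
    using Arg2pi[of z] by (simp add: is_Arg_def cis_conv_exp)
  then show ?thesis using assms by (simp add: sgn_eq field_simps)
qed

text \<open>A continuous function on the circle becomes, through the argument, a continuous function on the unit
  circle of the complex plane, where the Stone--Weierstrass theorem applies. Each of the two branches of
  the argument jumps somewhere, but by periodicity of \<open>\<psi>\<close> both give the same function, and every point
  other than zero is a continuity point of one of them.\<close>

lemma test_functions_dense:
  assumes cont: "continuous_on UNIV \<psi>" and per: "periodic1 \<psi>" and "0 < e"
  obtains \<phi> where "test_function \<phi>" "\<And>x. \<bar>\<psi> x - \<phi> x\<bar> < e"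
proof -
  define F where "F z = \<psi> (Arg z / (2 * pi))" for z
  have F2: "F z = \<psi> (Arg2pi z / (2 * pi))" for z
  proof -
    have "\<exists>n::int. Arg z / (2 * pi) = Arg2pi z / (2 * pi) + of_int n"
    proof (cases "z = 0")
      case True
      then show ?thesis by (intro exI[of _ 0]) (simp add: Arg_zero)
    next
      case False
      have "cis (Arg z) = cis (Arg2pi z)"
        using False by (simp add: cis_Arg cis_Arg2pi)
      then have "\<exists>n::int. Arg z = Arg2pi z + 2 * pi * of_int n"
        by (rule cis_eqD)
      then show ?thesis by (auto simp: field_simps)
    qed
    then show ?thesis using periodic1_of_int[OF per] unfolding F_def by metis
  qed
  have psi: "isCont \<psi> y" for y using cont by (simp add: continuous_on_eq_continuous_at)
  have "isCont F z" if "z \<noteq> 0" for z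
  proof (cases "z \<in> \<real>\<^sub>\<le>\<^sub>0")
    case False
    then have "isCont (\<lambda>z. Arg z / (2 * pi)) z"
      by (intro continuous_intros continuous_at_Arg) auto
    then show ?thesis unfolding F_def by (rule isCont_o2[OF _ psi])
  next
    case True
    then have "z \<notin> \<real>\<^sub>\<ge>\<^sub>0" using that by (auto simp: complex_nonpos_Reals_iff complex_nonneg_Reals_iff complex_eq_iff)
    then have "isCont (\<lambda>z. Arg2pi z / (2 * pi)) z"
      by (intro continuous_intros continuous_at_Arg2pi) auto
    then show ?thesis unfolding F2 by (rule isCont_o2[OF _ psi])
  qed
  then have "continuous_on (sphere 0 1) F"
    by (intro continuous_at_imp_continuous_on ballI) (metis dist_0_norm mem_sphere norm_zero zero_neq_one)
  then obtain p where p: "real_polynomial_function p" "\<And>z. z \<in> sphere 0 1 \<Longrightarrow> \<bar>F z - p z\<bar> < e"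
    using Stone_Weierstrass_real_polynomial_function[OF compact_sphere _ \<open>0 < e\<close>] by metis
  show ?thesis
  proof (rule that[OF test_function_trig_poly[OF p(1)]])
    fix x
    have "cis (Arg (cis (2 * pi * x))) = cis (2 * pi * x)"
      by (simp add: cis_Arg)
    then have "\<exists>n::int. Arg (cis (2 * pi * x)) = 2 * pi * x + 2 * pi * of_int n"
      by (rule cis_eqD)
    then obtain n :: int where n: "Arg (cis (2 * pi * x)) / (2 * pi) = x + of_int n"
      by (auto simp: field_simps)
    have "F (cis (2 * pi * x)) = \<psi> x"
      unfolding F_def n by (rule periodic1_of_int[OF per])
    then show "\<bar>\<psi> x - p (cis (2 * pi * x))\<bar> < e" using p(2)[of "cis (2 * pi * x)"] by simp
  qed
qed

lemma test_functionD:
  assumes "test_function \<phi>"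
  shows "periodic1 \<phi>" "(\<phi> has_real_derivative deriv \<phi> x) (at x)" "continuous_on UNIV \<phi>"
    "continuous_on UNIV (deriv \<phi>)" "L2_deriv \<phi> (deriv \<phi>)" "test_function (deriv \<phi>)" "\<phi> \<in> L2_circle"
proof -
  have d: "(deriv ^^ k) \<phi> differentiable at x" for k x using assms by (simp add: test_function_def)
  show p: "periodic1 \<phi>" using assms by (simp add: test_function_def)
  show 1: "(\<phi> has_real_derivative deriv \<phi> x) (at x)" for x
    using d[of 0 x] by (simp add: DERIV_deriv_iff_real_differentiable)
  show c0: "continuous_on UNIV \<phi>"
    using 1 DERIV_continuous_on by (meson DERIV_subset subset_UNIV)
  show c: "continuous_on UNIV (deriv \<phi>)"
    using d[of 1] by (intro continuous_at_imp_continuous_on ballI differentiable_imp_continuous_within) simp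
  show L: "L2_deriv \<phi> (deriv \<phi>)" by (rule L2_deriv_C1[OF 1 c p])
  have "(deriv ^^ k) (deriv \<phi>) differentiable at x" for k x
    using d[of "Suc k" x] by (simp add: funpow_Suc_right del: funpow.simps)
  then show "test_function (deriv \<phi>)" using L2_circleD(1)[OF L2_derivD(2)[OF L]] by (simp add: test_function_def)
  show "\<phi> \<in> L2_circle" by (rule L2_continuous[OF c0 p])
qed

lemma test_function_const [simp]: "test_function (\<lambda>_. c)"
proof -
  have "(deriv ^^ k) (\<lambda>_::real. c) differentiable at x" for k x
  proof -
    have "(deriv ^^ k) (\<lambda>_::real. c) = (\<lambda>_. if k = 0 then c else 0)" by (induction k) auto
    then show ?thesis by simp
  qed
  then show ?thesis by (simp add: test_function_def)
qed

lemma test_function_antiderivative: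
  assumes \<phi>: "test_function \<phi>" 
  defines "c \<equiv> integral\<^sup>L circle \<phi>"
  obtains \<Phi> where "test_function \<Phi>" "deriv \<Phi> = (\<lambda>x. \<phi> x - c)"
proof -
  have cont: "continuous_on UNIV (\<lambda>x. \<phi> x - c)"
    using test_functionD(3)[OF \<phi>] by (intro continuous_intros)
  have L: "(\<lambda>x. \<phi> x - c) \<in> L2_circle"
    using test_functionD[OF \<phi>] by (intro L2_diff) auto
  moreover have "integral\<^sup>L circle (\<lambda>x. \<phi> x - c) = 0"
    using test_functionD(7)[OF \<phi>] by (simp add: c_def L2_integrable)
  ultimately obtain \<Phi> where \<Phi>: "L2_deriv \<Phi> (\<lambda>x. \<phi> x - c)" using mean_zero_antiderivative by blast
  have der: "(\<Phi> has_real_derivative (\<phi> x - c)) (at x)" for x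
    by (rule prim_has_derivative[OF L2_derivD(3)[OF \<Phi>] cont])
  then have D: "deriv \<Phi> = (\<lambda>x. \<phi> x - c)" using DERIV_imp_deriv by blast
  have D2: "deriv (\<lambda>x. \<phi> x - c) = deriv \<phi>"
    by (intro ext DERIV_imp_deriv) (auto intro!: derivative_eq_intros test_functionD(2)[OF \<phi>])
  have "(deriv ^^ k) \<Phi> differentiable at x" for k x
  proof -
    consider "k = 0" | "k = 1" | j where "k = Suc (Suc j)" by (metis One_nat_def not0_implies_Suc)
    then show ?thesis
    proof cases
      case 1 then show ?thesis using der real_differentiable_def by auto
    next
      case 2 
      then show ?thesis using test_functionD(2)[OF \<phi>, of x] D
        by (auto simp: real_differentiable_def intro!: exI derivative_eq_intros)
    next
      case 3
      have "(deriv ^^ k) \<Phi> = (deriv ^^ j) (deriv \<phi>)"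
        by (simp add: 3 funpow_Suc_right D D2 del: funpow.simps)
      then show ?thesis using test_functionD(6)[OF \<phi>] by (simp add: test_function_def)
    qed
  qed
  then have "test_function \<Phi>" using L2_derivD(1)[OF \<Phi>] by (simp add: test_function_def)
  then show ?thesis using D that by blast
qed

subsection \<open>The fundamental lemma and the lemma of du Bois-Reymond\<close>

text \<open>The fundamental lemma of the calculus of variations. By density \<open>k\<close> is orthogonal to every continuous
  periodic function, in particular to a primitive \<open>W\<close> of \<open>K - m\<close>, where \<open>K\<close> is a primitive of \<open>k\<close> and
  \<open>m\<close> its mean. Integration by parts turns this into \<open>\<integral> (K - m)\<^sup>2 = 0\<close>, so \<open>K\<close> has no difference quotients
  and its derivative \<open>k\<close> vanishes.\<close>

lemma orthogonal_to_test_functions: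
  assumes k: "k \<in> L2_circle" and orth: "\<And>\<phi>. test_function \<phi> \<Longrightarrow> integral\<^sup>L circle (\<lambda>x. k x * \<phi> x) = 0"
  shows "AE x in circle. k x = 0"
proof -
  have ki: "integrable circle k" by (rule L2_integrable[OF k])
  have orth': "integral\<^sup>L circle (\<lambda>x. k x * \<psi> x) = 0" if c: "continuous_on UNIV \<psi>" "periodic1 \<psi>" for \<psi>
  proof -
    have \<psi>: "\<psi> \<in> L2_circle" by (rule L2_continuous[OF c])
    define C where "C = integral\<^sup>L circle (\<lambda>x. \<bar>k x\<bar>)"
    have "C \<ge> 0" by (simp add: C_def)
    have "\<bar>integral\<^sup>L circle (\<lambda>x. k x * \<psi> x)\<bar> \<le> 0"
    proof (rule field_le_epsilon)
      fix e :: real assume "e > 0"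
      then have "e / (C + 1) > 0" using \<open>C \<ge> 0\<close> by simp
      from test_functions_dense[OF c this] obtain \<phi>
        where \<phi>: "test_function \<phi>" "\<And>x. \<bar>\<psi> x - \<phi> x\<bar> < e / (C + 1)" by blast
      note i = L2_mult_integrable[OF k \<psi>] L2_mult_integrable[OF k test_functionD(7)[OF \<phi>(1)]]
      have "integral\<^sup>L circle (\<lambda>x. k x * \<psi> x) = integral\<^sup>L circle (\<lambda>x. k x * \<psi> x - k x * \<phi> x)"
        using i orth[OF \<phi>(1)] by simp
      also have "\<bar>\<dots>\<bar> \<le> integral\<^sup>L circle (\<lambda>x. \<bar>k x\<bar> * (e / (C + 1)))"
      proof (rule order_trans[OF integral_abs_bound], rule integral_mono)
        show "integrable circle (\<lambda>x. \<bar>k x * \<psi> x - k x * \<phi> x\<bar>)" using i by auto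
        show "integrable circle (\<lambda>x. \<bar>k x\<bar> * (e / (C + 1)))" using ki by auto
        fix x
        have "\<bar>k x * \<psi> x - k x * \<phi> x\<bar> = \<bar>k x\<bar> * \<bar>\<psi> x - \<phi> x\<bar>"
          by (simp add: abs_mult[symmetric] right_diff_distrib)
        also have "\<dots> \<le> \<bar>k x\<bar> * (e / (C + 1))" using \<phi>(2)[of x] by (intro mult_left_mono) auto
        finally show "\<bar>k x * \<psi> x - k x * \<phi> x\<bar> \<le> \<bar>k x\<bar> * (e / (C + 1))" .
      qed
      also have "\<dots> = C * (e / (C + 1))" by (simp add: C_def)
      also have "\<dots> \<le> e" using \<open>C \<ge> 0\<close> \<open>e > 0\<close> by (simp add: field_simps)
      finally show "\<bar>integral\<^sup>L circle (\<lambda>x. k x * \<psi> x)\<bar> \<le> 0 + e" by simp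
    qed
    then show ?thesis by simp
  qed
  have "integral\<^sup>L circle k = 0" using orth'[of "\<lambda>_. 1"] by simp
  then obtain K where K: "L2_deriv K k" using mean_zero_antiderivative[OF k] by blast
  define m where "m = integral\<^sup>L circle K"
  have Km: "L2_deriv (\<lambda>x. K x - m) k" using L2_deriv_diff[OF K L2_deriv_const[of m]] by simp
  have "integral\<^sup>L circle (\<lambda>x. K x - m) = 0"
    using L2_derivD(5)[OF K] by (simp add: m_def L2_integrable)
  then obtain W where W: "L2_deriv W (\<lambda>x. K x - m)"
    using mean_zero_antiderivative[OF L2_derivD(5)[OF Km]] by blast
  have "integral\<^sup>L circle (\<lambda>x. (K x - m) * (K x - m)) = - integral\<^sup>L circle (\<lambda>x. k x * W x)"
    by (rule L2_deriv_by_parts[OF Km W])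
  also have "\<dots> = 0" using orth'[OF L2_derivD(4)[OF W] L2_derivD(1)[OF W]] by simp
  finally have n0: "L2_norm (\<lambda>x. K x - m) = 0"
    by (simp add: L2_norm_def circle_integral_eq power2_eq_square)
  have "L2_norm k \<le> 0"
  proof (rule L2_norm_le_difference_quotients[OF Km])
    fix d :: real assume "0 < d"
    have "L2_norm (\<lambda>x. (K (x + d) - m) - (K x - m)) \<le> L2_norm (\<lambda>x. K (x + d) - m) + L2_norm (\<lambda>x. - (K x - m))"
      using L2_norm_triangle[OF L2_shift[OF L2_derivD(5)[OF Km], of d] L2_minus[OF L2_derivD(5)[OF Km]]] by simp
    also have "\<dots> = 0"
      using L2_norm_shift[OF L2_derivD(5)[OF Km], of d] \<open>0 < d\<close> n0 by (simp only: L2_norm_minus)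
    finally show "L2_norm (\<lambda>x. K (x + d) - m - (K x - m)) \<le> d * 0" by simp
  qed
  then have "L2_norm k = 0" by (simp add: antisym)
  then show ?thesis by (rule L2_norm_0_AE[OF k])
qed

text \<open>The primitive \<open>F\<close> of \<open>g\<close> with the same mean as \<open>f\<close> has the same weak derivative. Hence \<open>f - F\<close> is orthogonal
  to all derivatives of test functions and to the constants, and these span all test functions.\<close>

lemma du_Bois_Reymond:
  assumes f: "f \<in> L2_circle" and g: "g \<in> L2_circle" and weak: "has_weak_deriv 1 f g"
  obtains F where "L2_deriv F g" "AE x in circle. f x = F x"
proof -
  have w: "integral\<^sup>L circle (\<lambda>x. f x * deriv \<phi> x) = - integral\<^sup>L circle (\<lambda>x. g x * \<phi> x)" if "test_function \<phi>" for \<phi>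
    using weak that by (simp add: has_weak_deriv_def circle_integral_eq)
  have "integral\<^sup>L circle g = 0" using w[of "\<lambda>_. 1"] by simp
  then obtain G where G: "L2_deriv G g" using mean_zero_antiderivative[OF g] by blast
  define m where "m = integral\<^sup>L circle (\<lambda>x. f x - G x)"
  define F where "F x = G x + m" for x
  have F: "L2_deriv F g" using L2_deriv_add[OF G L2_deriv_const[of m]] by (simp add: F_def[abs_def])
  have k: "(\<lambda>x. f x - F x) \<in> L2_circle" by (rule L2_diff[OF f L2_derivD(5)[OF F]])
  have k0: "integral\<^sup>L circle (\<lambda>x. f x - F x) = 0"
  proof -
    have "integral\<^sup>L circle (\<lambda>x. (f x - G x) - m) = 0"
      using L2_diff[OF f L2_derivD(5)[OF G]] by (simp add: m_def L2_integrable)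
    then show ?thesis by (simp add: F_def algebra_simps)
  qed
  have "AE x in circle. f x - F x = 0"
  proof (rule orthogonal_to_test_functions[OF k])
    fix \<phi> assume \<phi>: "test_function \<phi>"
    define c where "c = integral\<^sup>L circle \<phi>"
    obtain \<Phi> where \<Phi>: "test_function \<Phi>" "deriv \<Phi> = (\<lambda>x. \<phi> x - c)"
      using test_function_antiderivative[OF \<phi>] unfolding c_def by blast
    have dL: "deriv \<Phi> \<in> L2_circle" by (rule L2_derivD(2)[OF test_functionD(5)[OF \<Phi>(1)]])
    have "integral\<^sup>L circle (\<lambda>x. (f x - F x) * deriv \<Phi> x)
        = integral\<^sup>L circle (\<lambda>x. f x * deriv \<Phi> x) - integral\<^sup>L circle (\<lambda>x. F x * deriv \<Phi> x)"
      using L2_mult_integrable[OF f dL] L2_mult_integrable[OF L2_derivD(5)[OF F] dL]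
      by (simp add: left_diff_distrib)
    also have "\<dots> = 0"
      using w[OF \<Phi>(1)] L2_deriv_by_parts[OF F test_functionD(5)[OF \<Phi>(1)]] by simp
    finally have 1: "integral\<^sup>L circle (\<lambda>x. (f x - F x) * (\<phi> x - c)) = 0" by (simp add: \<Phi>)
    have "(\<lambda>x. (f x - F x) * \<phi> x) = (\<lambda>x. (f x - F x) * (\<phi> x - c) + c * (f x - F x))"
      by (auto simp: algebra_simps)
    moreover have "integrable circle (\<lambda>x. (f x - F x) * (\<phi> x - c))"
      using L2_mult_integrable[OF k dL] by (simp add: \<Phi>)
    ultimately show "integral\<^sup>L circle (\<lambda>x. (f x - F x) * \<phi> x) = 0"
      using 1 k0 L2_integrable[OF k] by simp
  qed
  then show ?thesis using F that by simp
qed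

subsection \<open>Weak derivatives\<close>

lemma has_weak_deriv_unique:
  assumes "g \<in> L2_circle" "g' \<in> L2_circle" "has_weak_deriv j f g" "has_weak_deriv j f g'"
  shows "AE x in circle. g x = g' x"
proof -
  have "AE x in circle. g x - g' x = 0"
  proof (rule orthogonal_to_test_functions[OF L2_diff[OF assms(1,2)]])
    fix \<phi> assume \<phi>: "test_function \<phi>"
    have "(-1) ^ j * integral\<^sup>L circle (\<lambda>x. g x * \<phi> x) = (-1) ^ j * integral\<^sup>L circle (\<lambda>x. g' x * \<phi> x)"
      using assms(3,4) \<phi> by (simp add: has_weak_deriv_def circle_integral_eq)
    then have "integral\<^sup>L circle (\<lambda>x. g x * \<phi> x) = integral\<^sup>L circle (\<lambda>x. g' x * \<phi> x)" by simp
    then show "integral\<^sup>L circle (\<lambda>x. (g x - g' x) * \<phi> x) = 0"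
      using L2_mult_integrable[OF assms(1) test_functionD(7)[OF \<phi>]]
        L2_mult_integrable[OF assms(2) test_functionD(7)[OF \<phi>]] by (simp add: left_diff_distrib)
  qed
  then show ?thesis by simp
qed

lemma weak_deriv_works:
  assumes "g \<in> L2_circle" "has_weak_deriv j f g"
  shows "weak_deriv j f \<in> L2_circle" "has_weak_deriv j f (weak_deriv j f)"
    "AE x in circle. weak_deriv j f x = g x" "L2_norm (weak_deriv j f) = L2_norm g"
proof -
  show 1: "weak_deriv j f \<in> L2_circle" "has_weak_deriv j f (weak_deriv j f)"
    using someI[of "\<lambda>g. g \<in> L2_circle \<and> has_weak_deriv j f g" g] assms by (auto simp: weak_deriv_def)
  show 2: "AE x in circle. weak_deriv j f x = g x"
    by (rule has_weak_deriv_unique[OF 1(1) assms(1) 1(2) assms(2)])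
  show "L2_norm (weak_deriv j f) = L2_norm g" by (rule L2_norm_cong_AE[OF 1(1) assms(1) 2])
qed

lemma has_weak_deriv_0: "has_weak_deriv 0 f f"
  by (simp add: has_weak_deriv_def)

lemma has_weak_deriv_1: "L2_deriv f g \<Longrightarrow> has_weak_deriv 1 f g"
  using L2_deriv_by_parts[of f g] by (auto simp: has_weak_deriv_def circle_integral_eq dest: test_functionD(5))

lemma has_weak_deriv_2:
  assumes "L2_deriv f g" "L2_deriv g k"
  shows "has_weak_deriv 2 f k"
  using has_weak_deriv_1[OF assms(1)] has_weak_deriv_1[OF assms(2)]
  by (auto simp: has_weak_deriv_def numeral_2_eq_2 dest: test_functionD(6))

lemma sobolev_norm_0: "f \<in> L2_circle \<Longrightarrow> sobolev_norm 0 f = L2_norm f"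
  using weak_deriv_works(4)[OF _ has_weak_deriv_0] by (simp add: sobolev_norm_def)

lemma sobolev_norm_1:
  assumes "L2_deriv f g"
  shows "(sobolev_norm 1 f)\<^sup>2 = (L2_norm f)\<^sup>2 + (L2_norm g)\<^sup>2"
  using weak_deriv_works(4)[OF L2_derivD(5)[OF assms] has_weak_deriv_0]
    weak_deriv_works(4)[OF L2_derivD(2)[OF assms] has_weak_deriv_1[OF assms]]
  by (simp add: sobolev_norm_def)

lemma sobolev_norm_2:
  assumes "L2_deriv f g" "L2_deriv g k"
  shows "(sobolev_norm 2 f)\<^sup>2 = (L2_norm f)\<^sup>2 + (L2_norm g)\<^sup>2 + (L2_norm k)\<^sup>2"
  using weak_deriv_works(4)[OF L2_derivD(5)[OF assms(1)] has_weak_deriv_0]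
    weak_deriv_works(4)[OF L2_derivD(2)[OF assms(1)] has_weak_deriv_1[OF assms(1)]]
    weak_deriv_works(4)[OF L2_derivD(2)[OF assms(2)] has_weak_deriv_2[OF assms]]
  by (simp add: sobolev_norm_def numeral_2_eq_2 add_nonneg_nonneg)

lemma continuous_AE_eq:
  fixes f g :: "real \<Rightarrow> real"
  assumes "continuous_on UNIV f" "continuous_on UNIV g" "periodic1 f" "periodic1 g" "AE x in circle. f x = g x"
  shows "f = g"
proof -
  have c: "continuous_on {0..1} (\<lambda>x. (f x - g x)\<^sup>2)"
    using assms by (intro continuous_intros) (auto intro: continuous_on_subset)
  have "integral\<^sup>L circle (\<lambda>x. (f x - g x)\<^sup>2) = 0"
    by (rule integral_eq_zero_AE) (use assms(5) in \<open>auto elim: eventually_mono\<close>)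
  then have eq: "f x = g x" if "x \<in> {0..1}" for x
    using integralL_eq_0_iff[OF c] that by simp
  show ?thesis
  proof
    fix x :: real
    have "x - of_int \<lfloor>x\<rfloor> \<in> {0..1}" by simp linarith
    then show "f x = g x"
      using eq periodic1_of_int[OF assms(3), of x "- \<lfloor>x\<rfloor>"] periodic1_of_int[OF assms(4), of x "- \<lfloor>x\<rfloor>"] by simp
  qed
qed

lemma sobolev_0: "sobolev 0 = L2_circle"
  using has_weak_deriv_0 by (auto simp: sobolev_def)

lemma sobolev_1D:
  assumes "f \<in> sobolev 1"
  shows "L2_deriv f (weak_deriv 1 f)"
proof -
  have f: "f \<in> L2_circle" "continuous_on UNIV f" using assms by (auto simp: sobolev_def)
  from assms obtain g where "g \<in> L2_circle" "has_weak_deriv 1 f g" by (auto simp: sobolev_def)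
  from weak_deriv_works[OF this] have g: "weak_deriv 1 f \<in> L2_circle" "has_weak_deriv 1 f (weak_deriv 1 f)" by auto
  from du_Bois_Reymond[OF f(1) g] obtain F where F: "L2_deriv F (weak_deriv 1 f)" "AE x in circle. f x = F x" .
  have "f = F"
    by (rule continuous_AE_eq[OF f(2) L2_derivD(4)[OF F(1)] L2_circleD(1)[OF f(1)] L2_derivD(1)[OF F(1)] F(2)])
  then show ?thesis using F by simp
qed

lemma L2_deriv_cong_AE:
  assumes "L2_deriv f g" "g' \<in> L2_circle" "AE x in circle. g x = g' x"
  shows "L2_deriv f g'"
proof -
  have "has_weak_deriv 1 f g'"
    unfolding has_weak_deriv_def
  proof (intro allI impI)
    fix \<phi> assume \<phi>: "test_function \<phi>"
    have "integral\<^sup>L circle (\<lambda>x. g' x * \<phi> x) = integral\<^sup>L circle (\<lambda>x. g x * \<phi> x)"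
      using assms \<phi> by (intro integral_cong_AE borel_measurable_times)
        (auto dest!: L2_derivD(2) test_functionD(7) L2_circleD(3) elim: eventually_mono)
    then show "circle_integral (\<lambda>x. f x * (deriv ^^ 1) \<phi> x) = (- 1) ^ 1 * circle_integral (\<lambda>x. g' x * \<phi> x)"
      using has_weak_deriv_1[OF assms(1)] \<phi> by (simp add: has_weak_deriv_def circle_integral_eq)
  qed
  from du_Bois_Reymond[OF L2_derivD(5)[OF assms(1)] assms(2) this]
  obtain F where F: "L2_deriv F g'" "AE x in circle. f x = F x" .
  have "f = F"
    by (rule continuous_AE_eq[OF L2_derivD(4)[OF assms(1)] L2_derivD(4)[OF F(1)] L2_derivD(1)[OF assms(1)] L2_derivD(1)[OF F(1)] F(2)])
  then show ?thesis using F by simp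
qed

text \<open>The weak derivative of first order has the weak derivative of second order as its own derivative, so it
  agrees almost everywhere with a continuous \<open>G\<close>. Then \<open>f\<close> is a primitive of a continuous function,
  hence continuously differentiable with derivative \<open>G\<close>.\<close>

lemma sobolev_2D:
  assumes "f \<in> sobolev 2"
  shows "L2_deriv f (deriv f)" "L2_deriv (deriv f) (weak_deriv 2 f)"
proof -
  have f1: "f \<in> sobolev 1" using assms by (auto simp: sobolev_def)
  let ?g = "weak_deriv 1 f" and ?k = "weak_deriv 2 f"
  have fg: "L2_deriv f ?g" by (rule sobolev_1D[OF f1])
  from assms obtain k where "k \<in> L2_circle" "has_weak_deriv 2 f k" by (auto simp: sobolev_def)
  from weak_deriv_works[OF this] have k: "?k \<in> L2_circle" "has_weak_deriv 2 f ?k" by auto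
  have "has_weak_deriv 1 ?g ?k"
    unfolding has_weak_deriv_def
  proof (intro allI impI)
    fix \<phi> assume \<phi>: "test_function \<phi>"
    have "circle_integral (\<lambda>x. f x * deriv (deriv \<phi>) x) = - circle_integral (\<lambda>x. ?g x * deriv \<phi> x)"
      using has_weak_deriv_1[OF fg] test_functionD(6)[OF \<phi>] by (auto simp: has_weak_deriv_def)
    moreover have "circle_integral (\<lambda>x. f x * deriv (deriv \<phi>) x) = circle_integral (\<lambda>x. ?k x * \<phi> x)"
      using k(2) \<phi> by (auto simp: has_weak_deriv_def numeral_2_eq_2)
    ultimately show "circle_integral (\<lambda>x. ?g x * (deriv ^^ 1) \<phi> x) = (- 1) ^ 1 * circle_integral (\<lambda>x. ?k x * \<phi> x)"
      by simp
  qed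
  from du_Bois_Reymond[OF L2_derivD(2)[OF fg] k(1) this]
  obtain G where G: "L2_deriv G ?k" "AE x in circle. ?g x = G x" .
  have fG: "L2_deriv f G" by (rule L2_deriv_cong_AE[OF fg L2_derivD(5)[OF G(1)] G(2)])
  have "deriv f = G"
    using prim_has_derivative[OF L2_derivD(3)[OF fG] L2_derivD(4)[OF G(1)]] DERIV_imp_deriv by blast
  then show "L2_deriv f (deriv f)" "L2_deriv (deriv f) (weak_deriv 2 f)" using fG G by auto
qed


section \<open>Energy estimates for transport equations\<close>

subsection \<open>Curves that are differentiable in mean square\<close>

definition L2_differentiable :: "real set \<Rightarrow> (real \<Rightarrow> real \<Rightarrow> real) \<Rightarrow> (real \<Rightarrow> real \<Rightarrow> real) \<Rightarrow> bool" where
  "L2_differentiable I f f' \<longleftrightarrow> (\<forall>t\<in>I. f t \<in> L2_circle \<and> f' t \<in> L2_circle \<and>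
     ((\<lambda>s. L2_norm (\<lambda>x. (f s x - f t x) / (s - t) - f' t x)) \<longlongrightarrow> 0) (at t within I))"

lemma L2_differentiableD:
  assumes "L2_differentiable I f f'" "t \<in> I"
  shows "f t \<in> L2_circle" "f' t \<in> L2_circle"
    "((\<lambda>s. L2_norm (\<lambda>x. (f s x - f t x) / (s - t) - f' t x)) \<longlongrightarrow> 0) (at t within I)"
  using assms by (auto simp: L2_differentiable_def)

lemma L2_difference_quotient:
  assumes "L2_differentiable I f f'" "t \<in> I" "s \<in> I"
  shows "(\<lambda>x. (f s x - f t x) / (s - t) - f' t x) \<in> L2_circle"
  using assms by (intro L2_diff L2_divide) (auto dest: L2_differentiableD)

lemma eventually_within: "\<forall>\<^sub>F s in at t within I. s \<in> I"
  by (simp add: eventually_at_filter)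

lemma L2_differentiable_diff:
  assumes f: "L2_differentiable I f f'" and g: "L2_differentiable I g g'"
  shows "L2_differentiable I (\<lambda>t x. f t x - g t x) (\<lambda>t x. f' t x - g' t x)"
  unfolding L2_differentiable_def
proof (intro ballI conjI)
  fix t assume t: "t \<in> I"
  show "(\<lambda>x. f t x - g t x) \<in> L2_circle" "(\<lambda>x. f' t x - g' t x) \<in> L2_circle"
    using L2_differentiableD[OF f t] L2_differentiableD[OF g t] by (auto intro: L2_diff)
  let ?F = "\<lambda>s x. (f s x - f t x) / (s - t) - f' t x" and ?G = "\<lambda>s x. (g s x - g t x) / (s - t) - g' t x"
  have "((\<lambda>s. L2_norm (?F s) + L2_norm (?G s)) \<longlongrightarrow> 0) (at t within I)"
    using tendsto_add[OF L2_differentiableD(3)[OF f t] L2_differentiableD(3)[OF g t]] by simp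
  then show "((\<lambda>s. L2_norm (\<lambda>x. (f s x - g s x - (f t x - g t x)) / (s - t) - (f' t x - g' t x))) \<longlongrightarrow> 0) (at t within I)"
  proof (rule Lim_null_comparison[rotated])
    show "\<forall>\<^sub>F s in at t within I. norm (L2_norm (\<lambda>x. (f s x - g s x - (f t x - g t x)) / (s - t) - (f' t x - g' t x)))
        \<le> L2_norm (?F s) + L2_norm (?G s)"
      using eventually_within
    proof eventually_elim
      case (elim s)
      have "(\<lambda>x. (f s x - g s x - (f t x - g t x)) / (s - t) - (f' t x - g' t x)) = (\<lambda>x. ?F s x + - ?G s x)"
        by (auto simp: diff_divide_distrib add_divide_distrib algebra_simps)
      moreover have "L2_norm (\<lambda>x. ?F s x + - ?G s x) \<le> L2_norm (?F s) + L2_norm (\<lambda>x. - ?G s x)"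
        by (intro L2_norm_triangle L2_minus L2_difference_quotient[OF f t elim] L2_difference_quotient[OF g t elim])
      ultimately show ?case by (simp only: L2_norm_minus real_norm_def abs_of_nonneg L2_norm_nonneg)
    qed
  qed
qed

lemma L2_differentiable_shift:
  assumes f: "L2_differentiable I f f'" and "0 \<le> d"
  shows "L2_differentiable I (\<lambda>t x. f t (x + d)) (\<lambda>t x. f' t (x + d))"
  unfolding L2_differentiable_def
proof (intro ballI conjI)
  fix t assume t: "t \<in> I"
  show "(\<lambda>x. f t (x + d)) \<in> L2_circle" "(\<lambda>x. f' t (x + d)) \<in> L2_circle"
    using L2_differentiableD[OF f t] by (auto intro: L2_shift)
  show "((\<lambda>s. L2_norm (\<lambda>x. (f s (x + d) - f t (x + d)) / (s - t) - f' t (x + d))) \<longlongrightarrow> 0) (at t within I)"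
  proof (rule Lim_transform_eventually[OF L2_differentiableD(3)[OF f t]])
    show "\<forall>\<^sub>F s in at t within I. L2_norm (\<lambda>x. (f s x - f t x) / (s - t) - f' t x)
        = L2_norm (\<lambda>x. (f s (x + d) - f t (x + d)) / (s - t) - f' t (x + d))"
      using eventually_within
      by eventually_elim (rule L2_norm_shift[OF L2_difference_quotient[OF f t] \<open>0 \<le> d\<close>, symmetric])
  qed
qed

lemma L2_differentiable_space_independent:
  assumes "\<And>t. t \<in> I \<Longrightarrow> (c has_real_derivative c' t) (at t within I)"
  shows "L2_differentiable I (\<lambda>t x. c t) (\<lambda>t x. c' t)"
  unfolding L2_differentiable_def
proof (intro ballI conjI)
  fix t assume "t \<in> I"
  have "((\<lambda>s. (c s - c t) / (s - t)) \<longlongrightarrow> c' t) (at t within I)"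
    using assms[OF \<open>t \<in> I\<close>] by (simp add: has_field_derivative_iff)
  then have "((\<lambda>s. \<bar>(c s - c t) / (s - t) - c' t\<bar>) \<longlongrightarrow> 0) (at t within I)"
    by (intro tendsto_rabs_zero LIM_zero)
  then show "((\<lambda>s. L2_norm (\<lambda>x. (c s - c t) / (s - t) - c' t)) \<longlongrightarrow> 0) (at t within I)"
    by (simp add: L2_norm_def circle_integral_eq)
qed simp_all

subsection \<open>Energies\<close>

text \<open>The densities for which \<open>\<integral> \<Phi> (w)\<close> is differentiable along every \<open>L\<^sup>2\<close>-differentiable curve: the remainder of
  first order is quadratic, which is the regularity \<open>C\<^sup>1\<^sup>,\<^sup>1\<close>. The square gives energy estimates and the
  square of the positive part gives the maximum principle.\<close>

definition energy_density :: "(real \<Rightarrow> real) \<Rightarrow> (real \<Rightarrow> real) \<Rightarrow> bool" where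
  "energy_density \<Phi> \<Phi>' \<longleftrightarrow>
     (\<forall>r. (\<Phi> has_real_derivative \<Phi>' r) (at r)) \<and> continuous_on UNIV \<Phi>' \<and>
     (\<forall>r. \<bar>\<Phi> r\<bar> \<le> r\<^sup>2) \<and> (\<forall>r. \<bar>\<Phi>' r\<bar> \<le> 2 * \<bar>r\<bar>) \<and>
     (\<forall>r s. \<bar>\<Phi> s - \<Phi> r - \<Phi>' r * (s - r)\<bar> \<le> (s - r)\<^sup>2)"

lemma square_divide_abs: "a\<^sup>2 / \<bar>a\<bar> = \<bar>a :: real\<bar>"
  by (cases "a = 0"; cases "a > 0") (auto simp: power2_eq_square)

lemma energy_density_square: "energy_density (\<lambda>r. r\<^sup>2) (\<lambda>r. 2 * r)"
proof -
  have "s\<^sup>2 - r\<^sup>2 - 2 * r * (s - r) = (s - r)\<^sup>2" for r s :: real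
    by (simp add: power2_eq_square algebra_simps)
  then show ?thesis
    by (auto simp: energy_density_def intro!: derivative_eq_intros continuous_intros)
qed

lemma energy_density_positive_part: "energy_density (\<lambda>r. (max 0 r)\<^sup>2) (\<lambda>r. 2 * max 0 r)"
proof -
  have quad: "\<bar>(max 0 s)\<^sup>2 - (max 0 r)\<^sup>2 - 2 * max 0 r * (s - r)\<bar> \<le> (s - r)\<^sup>2" for r s :: real
  proof -
    consider "r \<ge> 0" "s \<ge> 0" | "r \<ge> 0" "s < 0" | "r < 0" "s \<ge> 0" | "r < 0" "s < 0" by linarith
    then show ?thesis
    proof cases
      case 1
      have "s\<^sup>2 - r\<^sup>2 - 2 * r * (s - r) = (s - r)\<^sup>2" by (simp add: power2_eq_square algebra_simps)
      with 1 show ?thesis by simp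
    next
      case 2
      have "r * s \<le> 0" using 2 by (simp add: mult_nonneg_nonpos)
      moreover have "(max 0 s)\<^sup>2 - (max 0 r)\<^sup>2 - 2 * max 0 r * (s - r) = r\<^sup>2 - 2 * (r * s)"
        using 2 by (simp add: max_def power2_eq_square algebra_simps)
      moreover have "(s - r)\<^sup>2 = s\<^sup>2 - 2 * (r * s) + r\<^sup>2"
        by (simp add: power2_eq_square algebra_simps)
      ultimately show ?thesis using zero_le_power2[of r] zero_le_power2[of s] by linarith
    next
      case 3
      then have "\<bar>s\<bar> \<le> \<bar>s - r\<bar>" by simp
      then show ?thesis using 3 by (simp add: max_def abs_le_square_iff)
    qed simp
  qed
  have "((\<lambda>r. (max 0 r)\<^sup>2) has_real_derivative 2 * max 0 r) (at r)" for r :: real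
    unfolding has_field_derivative_iff
  proof (rule LIM_zero_cancel, rule Lim_null_comparison)
    show "((\<lambda>s. \<bar>s - r\<bar>) \<longlongrightarrow> 0) (at r)" by (intro tendsto_rabs_zero LIM_zero tendsto_ident_at)
    show "\<forall>\<^sub>F s in at r. norm (((max 0 s)\<^sup>2 - (max 0 r)\<^sup>2) / (s - r) - 2 * max 0 r) \<le> \<bar>s - r\<bar>"
    proof (intro eventually_at_filter[THEN iffD2] always_eventually allI impI)
      fix s assume "s \<noteq> r"
      then have "((max 0 s)\<^sup>2 - (max 0 r)\<^sup>2) / (s - r) - 2 * max 0 r
          = ((max 0 s)\<^sup>2 - (max 0 r)\<^sup>2 - 2 * max 0 r * (s - r)) / (s - r)" 
        by (simp add: diff_divide_distrib)
      then have "norm (((max 0 s)\<^sup>2 - (max 0 r)\<^sup>2) / (s - r) - 2 * max 0 r)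
          = \<bar>(max 0 s)\<^sup>2 - (max 0 r)\<^sup>2 - 2 * max 0 r * (s - r)\<bar> / \<bar>s - r\<bar>"
        by (simp add: abs_divide)
      also have "\<dots> \<le> (s - r)\<^sup>2 / \<bar>s - r\<bar>" by (intro divide_right_mono quad) simp
      also have "\<dots> = \<bar>s - r\<bar>"
        using square_divide_abs[of "s - r"] by simp
      finally show "norm (((max 0 s)\<^sup>2 - (max 0 r)\<^sup>2) / (s - r) - 2 * max 0 r) \<le> \<bar>s - r\<bar>" .
    qed
  qed
  moreover have "(max 0 r)\<^sup>2 \<le> r\<^sup>2" for r :: real
    by (simp add: max_def)
  ultimately show ?thesis using quad
    by (auto simp: energy_density_def intro!: continuous_intros)
qed

lemma energy_integrable:
  assumes e: "energy_density \<Phi> \<Phi>'" and w: "w \<in> L2_circle"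
  shows "integrable circle (\<lambda>x. \<Phi> (w x))" "(\<lambda>x. \<Phi>' (w x)) \<in> L2_circle"
    "L2_norm (\<lambda>x. \<Phi>' (w x)) \<le> 2 * L2_norm w"
proof -
  have "isCont \<Phi> r" for r using e DERIV_isCont by (auto simp: energy_density_def)
  then have "continuous_on UNIV \<Phi>" by (simp add: continuous_at_imp_continuous_on)
  then have m: "\<Phi> \<in> borel_measurable borel" "\<Phi>' \<in> borel_measurable borel"
    using e by (auto simp: energy_density_def intro: borel_measurable_continuous_onI)
  have m1: "(\<lambda>x. \<Phi> (w x)) \<in> borel_measurable circle" 
    by (rule measurable_compose[OF L2_circleD(3)[OF w] m(1)])
  have m2: "(\<lambda>x. \<Phi>' (w x)) \<in> borel_measurable lebesgue" 
    by (rule measurable_compose[OF L2_circleD(2)[OF w] m(2)])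
  show "integrable circle (\<lambda>x. \<Phi> (w x))"
    by (rule Bochner_Integration.integrable_bound[OF L2_circleD(4)[OF w] m1])
       (use e in \<open>auto simp: energy_density_def\<close>)
  have "integrable circle (\<lambda>x. (\<Phi>' (w x))\<^sup>2)"
  proof (rule Bochner_Integration.integrable_bound)
    show "integrable circle (\<lambda>x. (2 * w x)\<^sup>2)" by (rule L2_circleD(4)[OF L2_cmult[OF w]])
    show "(\<lambda>x. (\<Phi>' (w x))\<^sup>2) \<in> borel_measurable circle" using measurable_circle[OF m2] by simp
    have "\<bar>\<Phi>' (w x)\<bar> \<le> \<bar>2 * w x\<bar>" for x using e by (simp add: energy_density_def abs_mult)
    then have "(\<Phi>' (w x))\<^sup>2 \<le> (2 * w x)\<^sup>2" for x unfolding abs_le_square_iff[symmetric] .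
    then show "AE x in circle. norm ((\<Phi>' (w x))\<^sup>2) \<le> norm ((2 * w x)\<^sup>2)" by (intro AE_I2) simp
  qed
  then show L: "(\<lambda>x. \<Phi>' (w x)) \<in> L2_circle"
    using m2 L2_circleD(1)[OF w] by (auto simp: L2_circle_iff periodic1_def)
  have "L2_norm (\<lambda>x. \<Phi>' (w x)) \<le> L2_norm (\<lambda>x. 2 * w x)"
    using L w e by (intro L2_norm_mono_AE L2_cmult) (auto simp: energy_density_def abs_mult)
  then show "L2_norm (\<lambda>x. \<Phi>' (w x)) \<le> 2 * L2_norm w" by (simp add: L2_norm_cmult)
qed

text \<open>The quadratic remainder contributes \<open>\<parallel>w s - w t\<parallel>\<^sup>2 / \<bar>s - t\<bar>\<close>, which is \<open>\<bar>s - t\<bar>\<close> times the square of a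
  bounded difference quotient; the linear part converges by the Cauchy--Schwarz inequality.\<close>

lemma energy_has_derivative:
  assumes w: "L2_differentiable I w w'" and e: "energy_density \<Phi> \<Phi>'" and t: "t \<in> I"
  shows "((\<lambda>t. integral\<^sup>L circle (\<lambda>x. \<Phi> (w t x))) has_real_derivative
           integral\<^sup>L circle (\<lambda>x. \<Phi>' (w t x) * w' t x)) (at t within I)"
  unfolding has_field_derivative_iff
proof (rule LIM_zero_cancel, rule Lim_null_comparison)
  let ?E = "\<lambda>t. integral\<^sup>L circle (\<lambda>x. \<Phi> (w t x))"
  define N where "N s = L2_norm (\<lambda>x. (w s x - w t x) / (s - t) - w' t x)" for s
  let ?bound = "\<lambda>s. \<bar>s - t\<bar> * (N s + L2_norm (w' t))\<^sup>2 + 2 * L2_norm (w t) * N s"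
  have "(N \<longlongrightarrow> 0) (at t within I)" using L2_differentiableD(3)[OF w t] by (simp add: N_def[abs_def])
  moreover have "((\<lambda>s. \<bar>s - t\<bar>) \<longlongrightarrow> 0) (at t within I)" by (intro tendsto_rabs_zero LIM_zero tendsto_ident_at)
  ultimately have "(?bound \<longlongrightarrow> 0 * (0 + L2_norm (w' t))\<^sup>2 + 2 * L2_norm (w t) * 0) (at t within I)"
    by (intro tendsto_intros)
  then show "(?bound \<longlongrightarrow> 0) (at t within I)" by simp
  show "\<forall>\<^sub>F s in at t within I. norm ((?E s - ?E t) / (s - t) - integral\<^sup>L circle (\<lambda>x. \<Phi>' (w t x) * w' t x)) \<le> ?bound s"
    unfolding eventually_at_filter
  proof (intro always_eventually allI impI)
    fix s assume "s \<noteq> t" and s: "s \<in> I"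
    note wL = L2_differentiableD(1)[OF w t] L2_differentiableD(1)[OF w s] L2_differentiableD(2)[OF w t]
    define k where "k x = (w s x - w t x) / (s - t)" for x
    have kL: "k \<in> L2_circle" unfolding k_def[abs_def] by (intro L2_divide L2_diff wL)
    have ws: "w s x - w t x = (s - t) * k x" for x using \<open>s \<noteq> t\<close> by (simp add: k_def)
    define rem where "rem x = \<Phi> (w s x) - \<Phi> (w t x) - \<Phi>' (w t x) * (w s x - w t x)" for x
    note PL = energy_integrable(2)[OF e wL(1)]
    note ints = energy_integrable(1)[OF e wL(1)] energy_integrable(1)[OF e wL(2)]
      L2_mult_integrable[OF PL kL] L2_mult_integrable[OF PL wL(3)]
    have remi: "integrable circle rem"
      unfolding rem_def[abs_def] ws using ints by (auto simp: mult.left_commute)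
    have "integral\<^sup>L circle rem = ?E s - ?E t - (s - t) * integral\<^sup>L circle (\<lambda>x. \<Phi>' (w t x) * k x)"
      unfolding rem_def[abs_def] ws using ints by (simp add: mult.left_commute)
    then have "(?E s - ?E t) / (s - t) = integral\<^sup>L circle rem / (s - t) + integral\<^sup>L circle (\<lambda>x. \<Phi>' (w t x) * k x)"
      using \<open>s \<noteq> t\<close> by (simp add: field_simps)
    then have eq: "(?E s - ?E t) / (s - t) - integral\<^sup>L circle (\<lambda>x. \<Phi>' (w t x) * w' t x)
        = integral\<^sup>L circle rem / (s - t) + integral\<^sup>L circle (\<lambda>x. \<Phi>' (w t x) * (k x - w' t x))"
      using ints by (simp add: right_diff_distrib)
    have "\<bar>integral\<^sup>L circle rem\<bar> \<le> integral\<^sup>L circle (\<lambda>x. (s - t)\<^sup>2 * (k x)\<^sup>2)"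
    proof (rule order_trans[OF integral_abs_bound], rule integral_mono)
      show "integrable circle (\<lambda>x. \<bar>rem x\<bar>)" using remi by auto
      show "integrable circle (\<lambda>x. (s - t)\<^sup>2 * (k x)\<^sup>2)" using L2_circleD(4)[OF kL] by auto
      show "\<bar>rem x\<bar> \<le> (s - t)\<^sup>2 * (k x)\<^sup>2" for x
        using e unfolding rem_def energy_density_def power_mult_distrib[symmetric] ws[symmetric] by blast
    qed
    also have "\<dots> = (s - t)\<^sup>2 * (L2_norm k)\<^sup>2" by (simp add: L2_norm_sq)
    finally have "\<bar>integral\<^sup>L circle rem / (s - t)\<bar> \<le> (s - t)\<^sup>2 * (L2_norm k)\<^sup>2 / \<bar>s - t\<bar>"
      by (simp add: abs_divide divide_right_mono)
    also have "(s - t)\<^sup>2 * (L2_norm k)\<^sup>2 / \<bar>s - t\<bar> = \<bar>s - t\<bar> * (L2_norm k)\<^sup>2"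
      using square_divide_abs[of "s - t"] by (metis times_divide_eq_left)
    also have "\<dots> \<le> \<bar>s - t\<bar> * (N s + L2_norm (w' t))\<^sup>2"
    proof (intro mult_left_mono power_mono)
      have "L2_norm (\<lambda>x. (k x - w' t x) + w' t x) \<le> L2_norm (\<lambda>x. k x - w' t x) + L2_norm (w' t)"
        by (intro L2_norm_triangle L2_diff kL wL)
      then show "L2_norm k \<le> N s + L2_norm (w' t)" by (simp add: N_def k_def[abs_def])
    qed auto
    finally have 1: "\<bar>integral\<^sup>L circle rem / (s - t)\<bar> \<le> \<bar>s - t\<bar> * (N s + L2_norm (w' t))\<^sup>2" .
    have "\<bar>integral\<^sup>L circle (\<lambda>x. \<Phi>' (w t x) * (k x - w' t x))\<bar>
        \<le> L2_norm (\<lambda>x. \<Phi>' (w t x)) * L2_norm (\<lambda>x. k x - w' t x)"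
      by (intro L2_Cauchy_Schwarz PL L2_diff kL wL)
    also have "\<dots> \<le> 2 * L2_norm (w t) * N s"
      unfolding N_def k_def by (intro mult_right_mono energy_integrable(3)[OF e wL(1)]) simp
    finally show "norm ((?E s - ?E t) / (s - t) - integral\<^sup>L circle (\<lambda>x. \<Phi>' (w t x) * w' t x)) \<le> ?bound s"
      unfolding eq real_norm_def using 1 by linarith
  qed
qed

text \<open>In \<open>\<integral> \<Phi>' (w) w\<^sub>t\<close> the transport term is \<open>- \<integral> u (\<Phi> (w))\<^sub>x\<close>, and integration by parts moves the
  derivative from \<open>w\<close>, where it exists only in mean square, to the velocity \<open>u\<close>.\<close>

lemma transport_energy:
  assumes w: "L2_differentiable I w w'" and t: "t \<in> I" and wx: "L2_deriv (w t) wx" and uv: "L2_deriv u v"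
    and r: "r \<in> L2_circle" and eq: "AE x in circle. w' t x + u x * wx x = r x"
    and e: "energy_density \<Phi> \<Phi>'"
  shows "((\<lambda>t. integral\<^sup>L circle (\<lambda>x. \<Phi> (w t x))) has_real_derivative
           integral\<^sup>L circle (\<lambda>x. v x * \<Phi> (w t x)) + integral\<^sup>L circle (\<lambda>x. \<Phi>' (w t x) * r x)) (at t within I)"
proof -
  note PL = energy_integrable(2)[OF e L2_differentiableD(1)[OF w t]]
  have comp: "L2_deriv (\<lambda>x. \<Phi> (w t x)) (\<lambda>x. \<Phi>' (w t x) * wx x)"
    using e by (intro L2_deriv_compose[OF wx]) (auto simp: energy_density_def)
  have i1: "integrable circle (\<lambda>x. u x * (\<Phi>' (w t x) * wx x))"
    by (rule L2_mult_integrable[OF L2_derivD(5)[OF uv] L2_derivD(2)[OF comp]])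
  have i2: "integrable circle (\<lambda>x. \<Phi>' (w t x) * r x)" by (rule L2_mult_integrable[OF PL r])
  have "integral\<^sup>L circle (\<lambda>x. \<Phi>' (w t x) * w' t x)
      = integral\<^sup>L circle (\<lambda>x. \<Phi>' (w t x) * r x - u x * (\<Phi>' (w t x) * wx x))"
  proof (rule integral_cong_AE)
    show "AE x in circle. \<Phi>' (w t x) * w' t x = \<Phi>' (w t x) * r x - u x * (\<Phi>' (w t x) * wx x)"
      using eq by (rule eventually_mono) (simp add: algebra_simps flip: eq_diff_eq)
    show "(\<lambda>x. \<Phi>' (w t x) * w' t x) \<in> borel_measurable circle"
      using L2_mult_integrable[OF PL L2_differentiableD(2)[OF w t]] by auto
    show "(\<lambda>x. \<Phi>' (w t x) * r x - u x * (\<Phi>' (w t x) * wx x)) \<in> borel_measurable circle"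
      using i1 i2 by auto
  qed
  also have "\<dots> = integral\<^sup>L circle (\<lambda>x. \<Phi>' (w t x) * r x) - integral\<^sup>L circle (\<lambda>x. u x * (\<Phi>' (w t x) * wx x))"
    using i1 i2 by simp
  also have "\<dots> = integral\<^sup>L circle (\<lambda>x. v x * \<Phi> (w t x)) + integral\<^sup>L circle (\<lambda>x. \<Phi>' (w t x) * r x)"
    using L2_deriv_by_parts[OF uv comp] by simp
  finally show ?thesis using energy_has_derivative[OF w e t] by simp
qed

subsection \<open>Gronwall's inequality\<close>

lemma nonincreasing_within:
  fixes y y' :: "real \<Rightarrow> real"
  assumes "0 \<le> t1" and der: "\<And>t. t \<in> {0..t1} \<Longrightarrow> (y has_real_derivative y' t) (at t within {0..t1})"
    and le: "\<And>t. t \<in> {0..t1} \<Longrightarrow> y' t \<le> 0"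
  shows "y t1 \<le> y 0"
proof (rule DERIV_nonpos_imp_decreasing_open[OF \<open>0 \<le> t1\<close>])
  show "continuous_on {0..t1} y" by (rule DERIV_continuous_on[OF der])
  fix t assume t: "0 < t" "t < t1"
  then have "(y has_real_derivative y' t) (at t)"
    using der[of t] at_within_Icc_at[of 0 t t1] by simp
  then show "\<exists>z. (y has_real_derivative z) (at t) \<and> z \<le> 0" using le[of t] t by auto
qed

lemma Gronwall:
  fixes y y' :: "real \<Rightarrow> real"
  assumes "0 \<le> t1" and der: "\<And>t. t \<in> {0..t1} \<Longrightarrow> (y has_real_derivative y' t) (at t within {0..t1})"
    and le: "\<And>t. t \<in> {0..t1} \<Longrightarrow> y' t \<le> C * y t + B" and "C > 0" "B \<ge> 0"
  shows "y t1 \<le> (y 0 + B / C) * exp (C * t1)"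
proof -
  have "(y t1 + B / C) * exp (- C * t1) \<le> (y 0 + B / C) * exp (- C * 0)"
  proof (rule nonincreasing_within[where y' = "\<lambda>t. (y' t - C * y t - B) * exp (- C * t)"])
    fix t assume t: "t \<in> {0..t1}"
    show "((\<lambda>t. (y t + B / C) * exp (- C * t)) has_real_derivative (y' t - C * y t - B) * exp (- C * t)) (at t within {0..t1})"
      using \<open>C > 0\<close> by (auto intro!: derivative_eq_intros der[OF t] simp: algebra_simps)
    show "(y' t - C * y t - B) * exp (- C * t) \<le> 0"
      using le[OF t] by (simp add: mult_nonpos_nonneg)
  qed fact
  then have "(y t1 + B / C) * exp (- C * t1) * exp (C * t1) \<le> (y 0 + B / C) * exp (C * t1)"
    by (simp add: mult_right_mono)
  then have "y t1 + B / C \<le> (y 0 + B / C) * exp (C * t1)"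
    by (simp add: mult.assoc flip: exp_add)
  moreover have "0 \<le> B / C" using \<open>C > 0\<close> \<open>B \<ge> 0\<close> by simp
  ultimately show ?thesis by linarith
qed


section \<open>Transport equations on the circle\<close>

lemma AE_shift:
  assumes k: "k \<in> L2_circle" and "AE x in circle. k x = 0" and "0 \<le> d"
  shows "AE x in circle. k (x + d) = 0"
proof (rule L2_norm_0_AE[OF L2_shift[OF k]])
  have "L2_norm k = L2_norm (\<lambda>_. 0)" using assms by (intro L2_norm_cong_AE) auto
  then show "L2_norm (\<lambda>x. k (x + d)) = 0"
    using L2_norm_shift[OF k \<open>0 \<le> d\<close>] by (simp add: L2_norm_def circle_integral_eq)
qed

text \<open>The energy of the positive part of \<open>f - c\<close> satisfies a linear differential inequality and vanishes initially, so it vanishes by Gronwall's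
  inequality. This replaces the argument along characteristics, for which the spatial derivative of
  \<open>f\<close> would have to be continuous.\<close>

lemma transport_max_principle:
  assumes f: "L2_differentiable I f f'" and I: "{0..t1} \<subseteq> I" "0 \<le> t1"
    and fx: "\<And>t. t \<in> I \<Longrightarrow> L2_deriv (f t) (fx t)" and uv: "\<And>t. t \<in> I \<Longrightarrow> L2_deriv (u t) (v t)"
    and g: "\<And>t. t \<in> I \<Longrightarrow> g t \<in> L2_circle"
    and eq: "\<And>t. t \<in> I \<Longrightarrow> AE x in circle. f' t x + u t x * fx t x = g t x"
    and c: "\<And>t. t \<in> I \<Longrightarrow> (c has_real_derivative c' t) (at t within I)"
    and vK: "\<And>t x. t \<in> {0..t1} \<Longrightarrow> v t x \<le> K" and "0 \<le> K" "0 \<le> L"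
    and gL: "\<And>t x. t \<in> {0..t1} \<Longrightarrow> c t < f t x \<Longrightarrow> g t x - c' t \<le> L * (f t x - c t)"
    and init: "\<And>x. f 0 x \<le> c 0"
  shows "f t1 x \<le> c t1"
proof -
  define w where "w t x = f t x - c t" for t x
  define y where "y t = integral\<^sup>L circle (\<lambda>x. (max 0 (w t x))\<^sup>2)" for t
  define y' where "y' t = integral\<^sup>L circle (\<lambda>x. v t x * (max 0 (w t x))\<^sup>2)
    + integral\<^sup>L circle (\<lambda>x. 2 * max 0 (w t x) * (g t x - c' t))" for t
  note e = energy_density_positive_part
  have w_diff: "L2_differentiable I w (\<lambda>t x. f' t x - c' t)"
    unfolding w_def[abs_def] by (rule L2_differentiable_diff[OF f L2_differentiable_space_independent[OF c]])
  have wx: "L2_deriv (w t) (fx t)" if "t \<in> I" for t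
    unfolding w_def using L2_deriv_diff[OF fx[OF that] L2_deriv_const[of "c t"]] by simp
  have gc: "(\<lambda>x. g t x - c' t) \<in> L2_circle" if "t \<in> I" for t by (rule L2_diff[OF g[OF that] L2_const])
  have der: "(y has_real_derivative y' t) (at t within {0..t1})" if "t \<in> {0..t1}" for t
  proof -
    have tI: "t \<in> I" using that I by auto
    have "AE x in circle. f' t x - c' t + u t x * fx t x = g t x - c' t"
      using eq[OF tI] by (rule eventually_mono) simp
    then have "(y has_real_derivative y' t) (at t within I)"
      unfolding y_def[abs_def] y'_def by (rule transport_energy[OF w_diff tI wx[OF tI] uv[OF tI] gc[OF tI] _ e])
    then show ?thesis by (rule DERIV_subset[OF _ I(1)])
  qed
  have le: "y' t \<le> (K + 2 * L + 1) * y t + 0" if "t \<in> {0..t1}" for t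
  proof -
    have tI: "t \<in> I" using that I by auto
    have wL: "w t \<in> L2_circle" by (rule L2_derivD(5)[OF wx[OF tI]])
    note i0 = energy_integrable(1)[OF e wL]
    have "L2_deriv (\<lambda>x. (max 0 (w t x))\<^sup>2) (\<lambda>x. 2 * max 0 (w t x) * fx t x)"
      using e by (intro L2_deriv_compose[OF wx[OF tI], of "\<lambda>r. (max 0 r)\<^sup>2" "\<lambda>r. 2 * max 0 r"])
        (auto simp: energy_density_def)
    then have i1: "integrable circle (\<lambda>x. v t x * (max 0 (w t x))\<^sup>2)"
      by (rule L2_mult_integrable[OF L2_derivD(2)[OF uv[OF tI]] L2_derivD(5)])
    have i2: "integrable circle (\<lambda>x. 2 * max 0 (w t x) * (g t x - c' t))"
      by (rule L2_mult_integrable[OF energy_integrable(2)[OF e wL] gc[OF tI]])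
    have "integral\<^sup>L circle (\<lambda>x. v t x * (max 0 (w t x))\<^sup>2) \<le> integral\<^sup>L circle (\<lambda>x. K * (max 0 (w t x))\<^sup>2)"
      using i0 i1 vK[OF that] by (intro integral_mono) (auto intro: mult_right_mono)
    moreover have "integral\<^sup>L circle (\<lambda>x. 2 * max 0 (w t x) * (g t x - c' t))
        \<le> integral\<^sup>L circle (\<lambda>x. 2 * L * (max 0 (w t x))\<^sup>2)"
    proof (intro integral_mono)
      fix x
      show "2 * max 0 (w t x) * (g t x - c' t) \<le> 2 * L * (max 0 (w t x))\<^sup>2"
      proof (cases "w t x > 0")
        case True
        then have "g t x - c' t \<le> L * w t x" using gL[OF that, of x] by (simp add: w_def)
        then have "2 * w t x * (g t x - c' t) \<le> 2 * w t x * (L * w t x)"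
          using True by (intro mult_left_mono) auto
        then show ?thesis using True by (simp add: power2_eq_square algebra_simps)
      qed simp
    qed (use i0 i2 in auto)
    moreover have "0 \<le> y t" by (simp add: y_def)
    moreover have "(K + 2 * L + 1) * y t = K * y t + 2 * L * y t + y t" by (simp add: algebra_simps)
    moreover have "integral\<^sup>L circle (\<lambda>x. K * (max 0 (w t x))\<^sup>2) = K * y t"
      "integral\<^sup>L circle (\<lambda>x. 2 * L * (max 0 (w t x))\<^sup>2) = 2 * L * y t"
      by (simp_all add: y_def)
    ultimately show ?thesis unfolding y'_def by linarith
  qed
  have "K + 2 * L + 1 > 0" using \<open>0 \<le> K\<close> \<open>0 \<le> L\<close> by simp
  from Gronwall[OF I(2) der le this order_refl]
  have "y t1 \<le> y 0 * exp ((K + 2 * L + 1) * t1)" by simp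
  also have "y 0 = 0"
  proof -
    have "max 0 (w 0 x) = 0" for x using init[of x] by (simp add: w_def)
    then show ?thesis by (simp add: y_def)
  qed
  finally have "y t1 = 0" by (simp add: antisym y_def)
  have t1: "t1 \<in> I" using I by auto
  have pL: "continuous_on UNIV (\<lambda>x. max 0 (w t1 x))" "periodic1 (\<lambda>x. max 0 (w t1 x))"
    using L2_derivD(1,4)[OF wx[OF t1]] by (auto intro!: continuous_intros simp: periodic1_def)
  have "L2_norm (\<lambda>x. max 0 (w t1 x)) = 0" using \<open>y t1 = 0\<close> by (simp add: y_def L2_norm_def circle_integral_eq)
  then have "AE x in circle. max 0 (w t1 x) = 0" by (rule L2_norm_0_AE[OF L2_continuous[OF pL]])
  then have "(\<lambda>x. max 0 (w t1 x)) = (\<lambda>_. 0)"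
    by (intro continuous_AE_eq pL continuous_on_const periodic1_const)
  from fun_cong[OF this, of x] show ?thesis by (simp add: w_def max_def split: if_splits)
qed

text \<open>The estimate that one gets formally by differentiating the equation in space and integrating against
  \<open>f\<^sub>x\<close>. Second derivatives of \<open>f\<close> do not exist, but the difference \<open>w\<close> of \<open>f\<close> and its translate solves a
  transport equation with velocity \<open>u\<close>, whose right-hand side contains the commutator
  \<open>(u (x + d) - u x) f\<^sub>x (x + d)\<close>. As \<open>u\<close> is Lipschitz with constant \<open>K\<close>, the commutator is of size \<open>d\<close>, like
  \<open>w\<close> itself.\<close>

lemma transport_difference_energy:
  assumes f: "L2_differentiable I f f'" and t: "t \<in> I" and fx: "L2_deriv (f t) fx"
    and uv: "L2_deriv u v" and vc: "continuous_on UNIV v" and vK: "\<And>x. \<bar>v x\<bar> \<le> K"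
    and gx: "L2_deriv g gx" and eq: "AE x in circle. f' t x + u x * fx x = g x" and "0 < d"
  shows "\<exists>D. ((\<lambda>t. (L2_norm (\<lambda>x. f t (x + d) - f t x))\<^sup>2) has_real_derivative D) (at t within I) \<and>
    D \<le> d\<^sup>2 * (3 * K * (L2_norm fx)\<^sup>2 + 2 * L2_norm fx * L2_norm gx)"
proof -
  have K0: "0 \<le> K" using vK[of 0] by linarith
  define w where "w t x = f t (x + d) - f t x" for t x
  define r where "r x = (g (x + d) - g x) - (u (x + d) - u x) * fx (x + d)" for x
  note fxL = L2_derivD(2)[OF fx]
  have w_diff: "L2_differentiable I w (\<lambda>t x. f' t (x + d) - f' t x)"
    unfolding w_def[abs_def] using \<open>0 < d\<close> by (intro L2_differentiable_diff L2_differentiable_shift f) simp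
  have wx: "L2_deriv (w t) (\<lambda>x. fx (x + d) - fx x)"
    unfolding w_def by (intro L2_deriv_diff L2_deriv_shift fx)
  have wL: "w t \<in> L2_circle" by (rule L2_derivD(5)[OF wx])
  have ud: "L2_deriv (\<lambda>x. u (x + d) - u x) (\<lambda>x. v (x + d) - v x)" by (intro L2_deriv_diff L2_deriv_shift uv)
  have gd: "L2_deriv (\<lambda>x. g (x + d) - g x) (\<lambda>x. gx (x + d) - gx x)" by (intro L2_deriv_diff L2_deriv_shift gx)
  have prodL: "(\<lambda>x. (u (x + d) - u x) * fx (x + d)) \<in> L2_circle"
    by (rule L2_mult_continuous[OF L2_derivD(4)[OF ud] L2_derivD(1)[OF ud] L2_shift[OF fxL]])
  have rL: "r \<in> L2_circle" unfolding r_def[abs_def] by (rule L2_diff[OF L2_derivD(5)[OF gd] prodL])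
  have AEr: "AE x in circle. f' t (x + d) - f' t x + u x * (fx (x + d) - fx x) = r x"
  proof -
    have kL: "(\<lambda>x. f' t x + u x * fx x - g x) \<in> L2_circle"
      by (intro L2_diff L2_add L2_differentiableD(2)[OF f t] L2_mult_continuous L2_derivD(4)[OF uv] L2_derivD(1)[OF uv] fxL L2_derivD(5)[OF gx])
    have k0: "AE x in circle. f' t x + u x * fx x - g x = 0" using eq by (rule eventually_mono) simp
    have "AE x in circle. f' t (x + d) + u (x + d) * fx (x + d) - g (x + d) = 0"
      using AE_shift[OF kL k0] \<open>0 < d\<close> by simp
    with k0 show ?thesis
    proof eventually_elim
      case (elim x)
      then show ?case unfolding r_def left_diff_distrib right_diff_distrib by linarith
    qed
  qed
  have wn: "L2_norm (w t) \<le> d * L2_norm fx"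
    unfolding w_def by (rule L2_norm_difference_le[OF fx \<open>0 < d\<close>])
  have rn: "L2_norm r \<le> d * L2_norm gx + d * K * L2_norm fx"
  proof -
    have "L2_norm (\<lambda>x. (g (x + d) - g x) + - ((u (x + d) - u x) * fx (x + d)))
        \<le> L2_norm (\<lambda>x. g (x + d) - g x) + L2_norm (\<lambda>x. - ((u (x + d) - u x) * fx (x + d)))"
      by (intro L2_norm_triangle L2_minus prodL L2_derivD(5)[OF gd])
    then have "L2_norm r \<le> L2_norm (\<lambda>x. g (x + d) - g x) + L2_norm (\<lambda>x. (u (x + d) - u x) * fx (x + d))"
      by (simp only: L2_norm_minus) (simp add: r_def[abs_def])
    moreover have "L2_norm (\<lambda>x. g (x + d) - g x) \<le> d * L2_norm gx"
      by (rule L2_norm_difference_le[OF gx \<open>0 < d\<close>])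
    moreover have "L2_norm (\<lambda>x. (u (x + d) - u x) * fx (x + d)) \<le> L2_norm (\<lambda>x. (d * K) * fx (x + d))"
    proof (intro L2_norm_mono_AE prodL L2_cmult L2_shift fxL AE_I2)
      fix x
      have "\<exists>z>x. z < x + d \<and> u (x + d) - u x = (x + d - x) * v z"
        using \<open>0 < d\<close> prim_has_derivative[OF L2_derivD(3)[OF uv] vc] by (intro MVT2) auto
      then obtain z where "u (x + d) - u x = d * v z" by auto
      then have "\<bar>u (x + d) - u x\<bar> \<le> \<bar>d * K\<bar>"
        using vK[of z] \<open>0 < d\<close> K0 by (simp add: abs_mult)
      then show "\<bar>(u (x + d) - u x) * fx (x + d)\<bar> \<le> \<bar>d * K * fx (x + d)\<bar>"
        unfolding abs_mult[of _ "fx (x + d)"] by (rule mult_right_mono) simp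
    qed
    moreover have "L2_norm (\<lambda>x. (d * K) * fx (x + d)) = d * K * L2_norm fx"
      using \<open>0 < d\<close> K0 L2_norm_shift[OF fxL, of d] by (simp only: L2_norm_cmult) simp
    ultimately show ?thesis by linarith
  qed
  define D where "D = integral\<^sup>L circle (\<lambda>x. v x * (w t x)\<^sup>2) + integral\<^sup>L circle (\<lambda>x. 2 * w t x * r x)"
  have der: "((\<lambda>t. (L2_norm (w t))\<^sup>2) has_real_derivative D) (at t within I)"
    unfolding L2_norm_sq D_def by (rule transport_energy[OF w_diff t wx uv rL AEr energy_density_square])
  have sq: "L2_norm (w t) * L2_norm (w t) \<le> (d * L2_norm fx) * (d * L2_norm fx)"
    using wn \<open>0 < d\<close> by (intro mult_mono) auto
  have "integral\<^sup>L circle (\<lambda>x. v x * (w t x)\<^sup>2) \<le> integral\<^sup>L circle (\<lambda>x. K * (w t x)\<^sup>2)"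
  proof (rule integral_mono)
    have "(\<lambda>x. v x * w t x) \<in> L2_circle"
      by (rule L2_mult_continuous[OF vc L2_circleD(1)[OF L2_derivD(2)[OF uv]] wL])
    from L2_mult_integrable[OF this wL] show "integrable circle (\<lambda>x. v x * (w t x)\<^sup>2)"
      by (simp add: power2_eq_square mult.assoc)
    show "integrable circle (\<lambda>x. K * (w t x)\<^sup>2)" using L2_circleD(4)[OF wL] by simp
    show "v x * (w t x)\<^sup>2 \<le> K * (w t x)\<^sup>2" for x using vK[of x] by (intro mult_right_mono) auto
  qed
  also have "\<dots> = K * (L2_norm (w t) * L2_norm (w t))" by (simp add: L2_norm_sq flip: power2_eq_square)
  also have "\<dots> \<le> K * ((d * L2_norm fx) * (d * L2_norm fx))" by (rule mult_left_mono[OF sq K0])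
  finally have 1: "integral\<^sup>L circle (\<lambda>x. v x * (w t x)\<^sup>2) \<le> K * ((d * L2_norm fx) * (d * L2_norm fx))" .
  have "integral\<^sup>L circle (\<lambda>x. 2 * w t x * r x) \<le> L2_norm (\<lambda>x. 2 * w t x) * L2_norm r"
    using L2_Cauchy_Schwarz[OF L2_cmult[OF wL] rL, of 2] by linarith
  also have "\<dots> = 2 * (L2_norm (w t) * L2_norm r)" by (simp add: L2_norm_cmult)
  also have "\<dots> \<le> 2 * ((d * L2_norm fx) * (d * L2_norm gx + d * K * L2_norm fx))"
    using wn rn \<open>0 < d\<close> by (intro mult_left_mono mult_mono) auto
  finally have "D \<le> K * ((d * L2_norm fx) * (d * L2_norm fx)) + 2 * ((d * L2_norm fx) * (d * L2_norm gx + d * K * L2_norm fx))"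
    unfolding D_def using 1 by linarith
  also have "\<dots> = d\<^sup>2 * (3 * K * (L2_norm fx)\<^sup>2 + 2 * L2_norm fx * L2_norm gx)"
    by (simp add: power2_eq_square algebra_simps)
  finally show ?thesis using der by (auto simp: w_def[abs_def])
qed

text \<open>A function of mean zero is the average of its own differences \<open>v x - v y\<close>, each of which is at most the
  \<open>L\<^sup>1\<close>-norm of the derivative.\<close>

lemma L2_deriv_sup_bound:
  assumes vw: "L2_deriv v w" and "integral\<^sup>L circle v = 0"
  shows "\<bar>v x\<bar> \<le> L2_norm w"
proof -
  have wL: "w \<in> L2_circle" by (rule L2_derivD(2)[OF vw])
  have absL: "(\<lambda>x. \<bar>w x\<bar>) \<in> L2_circle" using wL by (auto simp: L2_circle_iff periodic1_def)
  have osc: "\<bar>v b - v a\<bar> \<le> L2_norm w" if "a \<in> {0..1}" "b \<in> {0..1}" "a \<le> b" for a b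
  proof -
    have "\<bar>v b - v a\<bar> = \<bar>integral {a..b} w\<bar>" using primD(3)[OF L2_derivD(3)[OF vw] that(3)] by simp
    also have "\<dots> \<le> integral {a..b} (\<lambda>x. \<bar>w x\<bar>)"
      using primD(4,5)[OF L2_derivD(3)[OF vw], of a b]
      unfolding real_norm_def[symmetric] by (intro integral_norm_bound_integral) auto
    also have "\<dots> \<le> integral {0..1} (\<lambda>x. \<bar>w x\<bar>)"
      using that primD(5)[OF L2_derivD(3)[OF vw]] by (intro integral_subset_le) auto
    also have "\<dots> = integral\<^sup>L circle (\<lambda>x. \<bar>w x\<bar> * 1)"
      using L2_integrable[OF absL] by (simp add: circle_integral_HK)
    also have "\<dots> \<le> L2_norm (\<lambda>x. \<bar>w x\<bar>) * L2_norm (\<lambda>_. 1)"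
      using L2_Cauchy_Schwarz[OF absL L2_const[of 1]] by linarith
    also have "\<dots> = L2_norm w" by (simp add: L2_norm_def circle_integral_eq)
    finally show ?thesis .
  qed
  have main: "\<bar>v x\<bar> \<le> L2_norm w" if x: "x \<in> {0..1}" for x
  proof -
    have vi: "integrable circle v" by (rule L2_integrable[OF L2_derivD(5)[OF vw]])
    have "v x = integral\<^sup>L circle (\<lambda>y. v x - v y)" using vi assms(2) by simp
    also have "\<bar>\<dots>\<bar> \<le> integral\<^sup>L circle (\<lambda>y. L2_norm w)"
    proof (rule order_trans[OF integral_abs_bound], rule integral_mono)
      show "integrable circle (\<lambda>y. \<bar>v x - v y\<bar>)" using vi by auto
      fix y assume "y \<in> space circle"
      then show "\<bar>v x - v y\<bar> \<le> L2_norm w"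
        using osc[of x y] osc[of y x] x by (cases "x \<le> y") (auto simp: abs_minus_commute)
    qed simp
    finally show ?thesis by simp
  qed
  have "x - of_int \<lfloor>x\<rfloor> \<in> {0..1}" by simp linarith
  from main[OF this] show ?thesis
    using periodic1_of_int[OF L2_derivD(1)[OF vw], of x "- \<lfloor>x\<rfloor>"] by simp
qed


section \<open>The two-component Hunter--Saxton flow\<close>

lemma antideriv0_has_derivative:
  assumes "continuous_on UNIV k"
  shows "(antideriv0 k has_real_derivative k x) (at x)" "antideriv0 k 0 = 0"
proof -
  obtain P where P: "\<And>x. (P has_real_derivative k x) (at x)"
    using antiderivative_exists[OF assms] by blast
  have eq: "antideriv0 k = (\<lambda>x. P x - P 0)"
  proof
    fix x
    have "interval_lebesgue_integral lborel (ereal 0) (ereal x) k = P x - P 0"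
    proof (rule interval_integral_FTC_finite)
      show "continuous_on {min 0 x..max 0 x} k" by (rule continuous_on_subset[OF assms]) simp
      show "(P has_vector_derivative k y) (at y within {min 0 x..max 0 x})" for y
        using P[of y] by (simp add: has_real_derivative_iff_has_vector_derivative has_vector_derivative_at_within)
    qed
    then show "antideriv0 k x = P x - P 0" by (simp add: antideriv0_def zero_ereal_def)
  qed
  show "(antideriv0 k has_real_derivative k x) (at x)" "antideriv0 k 0 = 0"
    unfolding eq by (auto intro!: derivative_eq_intros P)
qed

text \<open>The solution in the form in which the estimates use it, with \<open>\<alpha> = - 1\<close>: here \<open>v = u\<^sub>x\<close>, \<open>w = u\<^sub>x\<^sub>x\<close> and
  \<open>r = \<rho>\<^sub>x\<close>. Differentiating the integrated equation once in space gives an equation for \<open>v\<close>, so that \<open>v\<close> and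
  \<open>\<rho>\<close> are transported by the same velocity \<open>u\<close>, with right-hand sides that involve only \<open>v\<close>, \<open>\<rho>\<close> and
  the nonpositive function of time \<open>a\<close>.\<close>

locale hunter_saxton_flow =
  fixes \<kappa> T :: real and h a :: "real \<Rightarrow> real"
    and u v w ut vt \<rho> r \<rho>t :: "real \<Rightarrow> real \<Rightarrow> real"
  assumes kappa: "0 < \<kappa>" and T: "0 < T" and h: "continuous_on {0..} h"
    and ux: "\<And>t. t \<in> {0..<T} \<Longrightarrow> L2_deriv (u t) (v t)"
    and vx: "\<And>t. t \<in> {0..<T} \<Longrightarrow> L2_deriv (v t) (w t)"
    and \<rho>x: "\<And>t. t \<in> {0..<T} \<Longrightarrow> L2_deriv (\<rho> t) (r t)"
    and u_differentiable: "L2_differentiable {0..<T} u ut" and v_differentiable: "L2_differentiable {0..<T} v vt" and \<rho>_differentiable: "L2_differentiable {0..<T} \<rho> \<rho>t"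
    and w_cont: "\<And>t. t \<in> {0..<T} \<Longrightarrow> ((\<lambda>s. L2_norm (\<lambda>x. w s x - w t x)) \<longlongrightarrow> 0) (at t within {0..<T})"
    and r_cont: "\<And>t. t \<in> {0..<T} \<Longrightarrow> ((\<lambda>s. L2_norm (\<lambda>x. r s x - r t x)) \<longlongrightarrow> 0) (at t within {0..<T})"
    and a_def: "\<And>t. a t = - (\<kappa> / 2) * (L2_norm (\<rho> t))\<^sup>2 - 1 / 2 * (L2_norm (v t))\<^sup>2"
    and u_eq: "\<And>t x. t \<in> {0..<T} \<Longrightarrow> ut t x + u t x * v t x
      = antideriv0 (\<lambda>y. \<kappa> / 2 * (\<rho> t y)\<^sup>2 + 1 / 2 * (v t y)\<^sup>2 + a t) x + h t"
    and v_eq: "\<And>t. t \<in> {0..<T} \<Longrightarrow> AE x in circle. vt t x + u t x * w t x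
      = \<kappa> / 2 * (\<rho> t x)\<^sup>2 - 1 / 2 * (v t x)\<^sup>2 + a t"
    and \<rho>_eq: "\<And>t. t \<in> {0..<T} \<Longrightarrow> AE x in circle. \<rho>t t x + u t x * r t x = - (v t x * \<rho> t x)"
begin

abbreviation "I \<equiv> {0..<T}"

lemma a_nonpos: "a t \<le> 0"
proof -
  have "0 \<le> \<kappa> / 2 * (L2_norm (\<rho> t))\<^sup>2" using kappa by simp
  moreover have "0 \<le> (L2_norm (v t))\<^sup>2" by simp
  ultimately show ?thesis unfolding a_def by linarith
qed

lemma v_le_w_norm: "t \<in> I \<Longrightarrow> \<bar>v t x\<bar> \<le> L2_norm (w t)"
  by (rule L2_deriv_sup_bound[OF vx L2_deriv_integral[OF ux]])

lemma norm_continuous: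
  assumes "\<And>t. t \<in> I \<Longrightarrow> f t \<in> L2_circle"
    and "\<And>t. t \<in> I \<Longrightarrow> ((\<lambda>s. L2_norm (\<lambda>x. f s x - f t x)) \<longlongrightarrow> 0) (at t within I)"
  shows "continuous_on I (\<lambda>t. L2_norm (f t))"
  unfolding continuous_on_def
proof
  fix t assume t: "t \<in> I"
  show "((\<lambda>t. L2_norm (f t)) \<longlongrightarrow> L2_norm (f t)) (at t within I)"
  proof (rule LIM_zero_cancel, rule Lim_null_comparison[OF _ assms(2)[OF t]])
    show "\<forall>\<^sub>F s in at t within I. norm (L2_norm (f s) - L2_norm (f t)) \<le> L2_norm (\<lambda>x. f s x - f t x)"
      using eventually_within
      by eventually_elim (simp add: L2_norm_triangle_diff assms(1) t del: atLeastLessThan_iff)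
  qed
qed

lemma w_norm_continuous: "continuous_on I (\<lambda>t. L2_norm (w t))"
  by (rule norm_continuous[OF L2_derivD(2)[OF vx] w_cont])

lemma r_norm_continuous: "continuous_on I (\<lambda>t. L2_norm (r t))"
  by (rule norm_continuous[OF L2_derivD(2)[OF \<rho>x] r_cont])

text \<open>Continuity in time with values in \<open>H\<^sup>2\<close> gives, on compact time intervals, the bound on \<open>u\<^sub>x\<close> that the maximum
  principle presupposes. The bound may deteriorate as \<open>t\<^sub>1\<close> tends to \<open>T\<close>.\<close>

lemma v_bounded_before:
  assumes "t1 \<in> I"
  shows "\<exists>K\<ge>0. \<forall>t\<in>{0..t1}. \<forall>x. \<bar>v t x\<bar> \<le> K"
proof -
  have sub: "{0..t1} \<subseteq> I" using assms by auto
  have "compact ((\<lambda>t. L2_norm (w t)) ` {0..t1})"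
    by (rule compact_continuous_image[OF continuous_on_subset[OF w_norm_continuous sub]]) simp
  then obtain K where K: "\<forall>t\<in>{0..t1}. \<bar>L2_norm (w t)\<bar> \<le> K"
    using compact_imp_bounded bounded_iff by (metis imageI real_norm_def)
  have "\<bar>v t x\<bar> \<le> K" if "t \<in> {0..t1}" for t x
    using v_le_w_norm[of t x] K that sub by fastforce
  moreover have "0 \<le> K"
  proof -
    have "0 \<in> {0..t1}" using assms by simp
    with K have "\<bar>L2_norm (w 0)\<bar> \<le> K" by blast
    then show ?thesis by linarith
  qed
  ultimately show ?thesis by blast
qed

context
  fixes M :: real
  assumes lower: "\<And>t x. t \<in> I \<Longrightarrow> - M \<le> v t x" and "0 \<le> M"
begin

text \<open>Where \<open>\<rho>\<close> is positive, \<open>- v \<rho> \<le> M \<rho>\<close>: the density is compressed at a rate of at most \<open>M\<close>. So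
  \<open>\<parallel>\<rho> 0\<parallel>\<^sub>\<infinity> exp (M t)\<close> is a supersolution for \<open>\<rho>\<close> and for \<open>- \<rho>\<close>.\<close>

lemma \<rho>_bounded: "\<exists>R\<ge>0. \<forall>t\<in>I. \<forall>x. \<bar>\<rho> t x\<bar> \<le> R"
proof -
  have 0: "0 \<in> I" using T by simp
  obtain k where k: "0 \<le> k" "\<And>x. \<bar>\<rho> 0 x\<bar> \<le> k" using L2_deriv_bounded[OF \<rho>x[OF 0]] by blast
  define c where "c t = k * exp (M * t)" for t
  have c: "(c has_real_derivative M * c t) (at t within I)" for t
    unfolding c_def[abs_def] by (auto intro!: derivative_eq_intros)
  have c0: "0 \<le> c t" for t using k by (simp add: c_def)
  have gL: "(\<lambda>x. v t x * \<rho> t x) \<in> L2_circle" if "t \<in> I" for t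
    by (rule L2_mult_continuous[OF L2_derivD(4,1)[OF vx[OF that]] L2_derivD(5)[OF \<rho>x[OF that]]])
  have "\<bar>\<rho> t x\<bar> \<le> c t" if t: "t \<in> I" for t x
  proof -
    obtain K where K: "0 \<le> K" "\<And>s x. s \<in> {0..t} \<Longrightarrow> \<bar>v s x\<bar> \<le> K"
      using v_bounded_before[OF t] by blast
    have vK: "v s x \<le> K" if "s \<in> {0..t}" for s x using K(2)[OF that, of x] by linarith
    have sub: "{0..t} \<subseteq> I" "0 \<le> t" using t by auto
    have "\<rho> t x \<le> c t"
    proof (rule transport_max_principle[OF \<rho>_differentiable sub \<rho>x ux _ \<rho>_eq c vK K(1) \<open>0 \<le> M\<close>])
      show "(\<lambda>x. - (v s x * \<rho> s x)) \<in> L2_circle" if "s \<in> I" for s by (rule L2_minus[OF gL[OF that]])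
      show "- (v s x * \<rho> s x) - M * c s \<le> M * (\<rho> s x - c s)" if "s \<in> {0..t}" "c s < \<rho> s x" for s x
      proof -
        have "- M * \<rho> s x \<le> v s x * \<rho> s x"
          using lower[of s x] sub(1) that c0[of s] by (intro mult_right_mono) auto
        then show ?thesis by (simp add: algebra_simps)
      qed
      show "\<rho> 0 x \<le> c 0" for x using k(2)[of x] by (simp add: c_def)
    qed auto
    moreover have "0 - \<rho> t x \<le> c t"
    proof (rule transport_max_principle[where f = "\<lambda>t x. 0 - \<rho> t x" and f' = "\<lambda>t x. 0 - \<rho>t t x"
          and fx = "\<lambda>t x. 0 - r t x" and g = "\<lambda>t x. v t x * \<rho> t x", OF _ sub _ ux gL _ c vK K(1) \<open>0 \<le> M\<close>])
      show "L2_differentiable I (\<lambda>t x. 0 - \<rho> t x) (\<lambda>t x. 0 - \<rho>t t x)"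
        by (rule L2_differentiable_diff[OF L2_differentiable_space_independent \<rho>_differentiable]) auto
      show "L2_deriv (\<lambda>x. 0 - \<rho> s x) (\<lambda>x. 0 - r s x)" if "s \<in> I" for s
        by (rule L2_deriv_diff[OF L2_deriv_const \<rho>x[OF that]])
      show "AE x in circle. 0 - \<rho>t s x + u s x * (0 - r s x) = v s x * \<rho> s x" if "s \<in> I" for s
        using \<rho>_eq[OF that] by (rule eventually_mono) (simp add: algebra_simps)
      show "v s x * \<rho> s x - M * c s \<le> M * (0 - \<rho> s x - c s)" if "s \<in> {0..t}" "c s < 0 - \<rho> s x" for s x
      proof -
        have "v s x * \<rho> s x \<le> - M * \<rho> s x"
          using lower[of s x] sub(1) that c0[of s] by (intro mult_right_mono_neg) auto
        then show ?thesis by (simp add: algebra_simps)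
      qed
      show "0 - \<rho> 0 x \<le> c 0" for x using k(2)[of x] by (simp add: c_def)
    qed auto
    ultimately show ?thesis by linarith
  qed
  moreover have "c t \<le> c T" if "t \<in> I" for t
    using that k \<open>0 \<le> M\<close> by (auto simp: c_def intro!: mult_left_mono)
  ultimately show ?thesis using c0[of T] by (meson order_trans)
qed

text \<open>The only positive term in the equation for \<open>v\<close> is \<open>\<kappa> \<rho>\<^sup>2 / 2\<close>, which is bounded; the quadratic term and
  \<open>a\<close> have the good sign. So \<open>v\<close> grows at most linearly in time.\<close>

lemma v_bounded: "\<exists>K\<ge>0. \<forall>t\<in>I. \<forall>x. \<bar>v t x\<bar> \<le> K"
proof -
  obtain R where R: "0 \<le> R" "\<And>t x. t \<in> I \<Longrightarrow> \<bar>\<rho> t x\<bar> \<le> R" using \<rho>_bounded by blast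
  have 0: "0 \<in> I" using T by simp
  obtain k where k: "0 \<le> k" "\<And>x. \<bar>v 0 x\<bar> \<le> k" using L2_deriv_bounded[OF vx[OF 0]] by blast
  define B where "B = \<kappa> / 2 * R\<^sup>2"
  have "0 \<le> B" using kappa by (simp add: B_def)
  define c where "c t = k + B * t" for t
  have c: "(c has_real_derivative B) (at t within I)" for t
    unfolding c_def[abs_def] by (auto intro!: derivative_eq_intros)
  have upper: "v t x \<le> c t" if t: "t \<in> I" for t x
  proof -
    obtain K where K: "0 \<le> K" "\<And>s x. s \<in> {0..t} \<Longrightarrow> \<bar>v s x\<bar> \<le> K"
      using v_bounded_before[OF t] by blast
    have vK: "v s x \<le> K" if "s \<in> {0..t}" for s x using K(2)[OF that, of x] by linarith
    have sub: "{0..t} \<subseteq> I" "0 \<le> t" using t by auto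
    show ?thesis
    proof (rule transport_max_principle[OF v_differentiable sub vx ux _ v_eq c vK K(1) order_refl])
      show "(\<lambda>x. \<kappa> / 2 * (\<rho> s x)\<^sup>2 - 1 / 2 * (v s x)\<^sup>2 + a s) \<in> L2_circle" if "s \<in> I" for s
        using L2_derivD(1,4)[OF \<rho>x[OF that]] L2_derivD(1,4)[OF vx[OF that]]
        by (intro L2_continuous continuous_intros) (auto simp: periodic1_def)
      show "\<kappa> / 2 * (\<rho> s x)\<^sup>2 - 1 / 2 * (v s x)\<^sup>2 + a s - B \<le> 0 * (v s x - c s)" if "s \<in> {0..t}" for s x
      proof -
        have "(\<rho> s x)\<^sup>2 \<le> R\<^sup>2" using R(2)[of s x] R(1) that sub by (auto simp flip: abs_le_square_iff)
        then have "\<kappa> / 2 * (\<rho> s x)\<^sup>2 \<le> B" unfolding B_def using kappa by (intro mult_left_mono) auto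
        moreover have "0 \<le> (v s x)\<^sup>2" by simp
        ultimately have "\<kappa> / 2 * (\<rho> s x)\<^sup>2 - 1 / 2 * (v s x)\<^sup>2 + a s - B \<le> 0" using a_nonpos[of s] by linarith
        then show ?thesis by simp
      qed
      show "v 0 x \<le> c 0" for x using k(2)[of x] by (simp add: c_def)
    qed auto
  qed
  have "\<bar>v t x\<bar> \<le> M + c T" if t: "t \<in> I" for t x
  proof -
    have "c t \<le> c T" using t \<open>0 \<le> B\<close> by (auto simp: c_def intro!: mult_left_mono)
    moreover have "0 \<le> c T" using k T \<open>0 \<le> B\<close> by (simp add: c_def)
    ultimately show ?thesis using upper[OF t, of x] lower[OF t, of x] \<open>0 \<le> M\<close> by linarith
  qed
  moreover have "0 \<le> M + c T" using k T \<open>0 \<le> B\<close> \<open>0 \<le> M\<close> by (simp add: c_def)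
  ultimately show ?thesis by blast
qed

text \<open>The difference energies \<open>E d\<close> of \<open>v\<close> and \<open>\<rho>\<close> grow at a rate of at most \<open>d\<^sup>2 C F\<close>, where \<open>F\<close> is the squared
  norm of the gradients. Division by \<open>d\<^sup>2\<close> and the comparison of gradients with difference quotients
  turn this into \<open>F t \<le> 2 (F 0 + C \<integral> F)\<close>, and Gronwall's inequality applies. The factor 2 arises
  because each gradient is estimated separately by the common difference energy.\<close>

lemma gradient_bounded: "\<exists>B. \<forall>t\<in>I. (L2_norm (w t))\<^sup>2 + (L2_norm (r t))\<^sup>2 \<le> B"
proof -
  obtain R where R: "0 \<le> R" "\<And>t x. t \<in> I \<Longrightarrow> \<bar>\<rho> t x\<bar> \<le> R" using \<rho>_bounded by blast
  obtain K where K: "0 \<le> K" "\<And>t x. t \<in> I \<Longrightarrow> \<bar>v t x\<bar> \<le> K" using v_bounded by blast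
  define F where "F t = (L2_norm (w t))\<^sup>2 + (L2_norm (r t))\<^sup>2" for t
  \<comment> \<open>The 1 only serves to make \<open>C\<close> positive.\<close>
  define C where "C = 5 * K + \<kappa> * R + R + 1"
  have C: "0 < C" using K(1) R(1) kappa by (simp add: C_def add_nonneg_pos)
  define E where "E d t = (L2_norm (\<lambda>x. v t (x + d) - v t x))\<^sup>2 + (L2_norm (\<lambda>x. \<rho> t (x + d) - \<rho> t x))\<^sup>2" for d t
  have E_der: "\<exists>D. (E d has_real_derivative D) (at t within I) \<and> D \<le> d\<^sup>2 * (C * F t)"
    if t: "t \<in> I" and d: "0 < d" for t d
  proof -
    note wL = L2_derivD(2)[OF vx[OF t]] and rL = L2_derivD(2)[OF \<rho>x[OF t]]
    define gv where "gv x = \<kappa> * (\<rho> t x * r t x) + - (v t x * w t x)" for x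
    define gr where "gr x = - (w t x * \<rho> t x) + - (v t x * r t x)" for x
    have sq: "L2_deriv (\<lambda>x. (f x)\<^sup>2) (\<lambda>x. 2 * f x * f' x)" if "L2_deriv f f'" for f f'
      by (rule L2_deriv_compose[OF that]) (auto intro!: derivative_eq_intros continuous_intros)
    \<comment> \<open>The right-hand sides of both transport equations have square-integrable derivatives.\<close>
    have "L2_deriv (\<lambda>x. \<kappa> / 2 * (\<rho> t x)\<^sup>2 - 1 / 2 * (v t x)\<^sup>2 + a t)
      (\<lambda>x. \<kappa> / 2 * (2 * \<rho> t x * r t x) - 1 / 2 * (2 * v t x * w t x) + 0)"
      by (intro L2_deriv_add L2_deriv_diff L2_deriv_cmult L2_deriv_const sq vx \<rho>x t)
    then have gv: "L2_deriv (\<lambda>x. \<kappa> / 2 * (\<rho> t x)\<^sup>2 - 1 / 2 * (v t x)\<^sup>2 + a t) gv"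
      by (simp add: gv_def[abs_def] algebra_simps)
    have "L2_deriv (\<lambda>x. - 1 * (v t x * \<rho> t x)) (\<lambda>x. - 1 * (w t x * \<rho> t x + v t x * r t x))"
      by (intro L2_deriv_cmult L2_deriv_mult vx \<rho>x t)
    then have gr: "L2_deriv (\<lambda>x. - (v t x * \<rho> t x)) gr"
      by (simp add: gr_def[abs_def] algebra_simps)
    have prod_bound: "L2_norm (\<lambda>x. f x * k x) \<le> A * L2_norm k" "(\<lambda>x. f x * k x) \<in> L2_circle"
      if f: "L2_deriv f f'" and A: "\<And>x. \<bar>f x\<bar> \<le> A" and k: "k \<in> L2_circle" for f f' k A
    proof -
      show L: "(\<lambda>x. f x * k x) \<in> L2_circle" by (rule L2_mult_continuous[OF L2_derivD(4,1)[OF f] k])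
      have "0 \<le> A" using A[of 0] by linarith
      then have "L2_norm (\<lambda>x. f x * k x) \<le> L2_norm (\<lambda>x. A * k x)"
        using A by (intro L2_norm_mono_AE L L2_cmult k AE_I2) (auto simp: abs_mult intro!: mult_right_mono)
      then show "L2_norm (\<lambda>x. f x * k x) \<le> A * L2_norm k" using \<open>0 \<le> A\<close> by (simp add: L2_norm_cmult)
    qed
    note vw = prod_bound[OF vx[OF t] K(2)[OF t] wL] and vr = prod_bound[OF vx[OF t] K(2)[OF t] rL]
      and \<rho>w = prod_bound[OF \<rho>x[OF t] R(2)[OF t] wL] and \<rho>r = prod_bound[OF \<rho>x[OF t] R(2)[OF t] rL]
    have gv_le: "L2_norm gv \<le> \<kappa> * (R * L2_norm (r t)) + K * L2_norm (w t)"
    proof -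
      have "L2_norm gv \<le> L2_norm (\<lambda>x. \<kappa> * (\<rho> t x * r t x)) + L2_norm (\<lambda>x. - (v t x * w t x))"
        unfolding gv_def[abs_def] by (intro L2_norm_triangle L2_cmult L2_minus vw \<rho>r)
      also have "\<dots> = \<kappa> * L2_norm (\<lambda>x. \<rho> t x * r t x) + L2_norm (\<lambda>x. v t x * w t x)"
        using kappa by (simp add: L2_norm_minus L2_norm_cmult)
      also have "\<dots> \<le> \<kappa> * (R * L2_norm (r t)) + K * L2_norm (w t)"
        using vw(1) \<rho>r(1) kappa by (intro add_mono mult_left_mono) auto
      finally show ?thesis .
    qed
    have gr_le: "L2_norm gr \<le> R * L2_norm (w t) + K * L2_norm (r t)"
    proof -
      have "L2_norm gr \<le> L2_norm (\<lambda>x. - (\<rho> t x * w t x)) + L2_norm (\<lambda>x. - (v t x * r t x))"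
        using L2_norm_triangle[OF L2_minus[OF \<rho>w(2)] L2_minus[OF vr(2)]]
        by (simp add: gr_def[abs_def] mult.commute)
      then show ?thesis using vr(1) \<rho>w(1) unfolding L2_norm_minus by linarith
    qed
    from transport_difference_energy[OF v_differentiable t vx[OF t] ux[OF t] L2_derivD(4)[OF vx[OF t]] K(2)[OF t] gv v_eq[OF t] d]
    obtain D1 where D1: "((\<lambda>t. (L2_norm (\<lambda>x. v t (x + d) - v t x))\<^sup>2) has_real_derivative D1) (at t within I)"
      "D1 \<le> d\<^sup>2 * (3 * K * (L2_norm (w t))\<^sup>2 + 2 * L2_norm (w t) * L2_norm gv)" by blast
    from transport_difference_energy[OF \<rho>_differentiable t \<rho>x[OF t] ux[OF t] L2_derivD(4)[OF vx[OF t]] K(2)[OF t] gr \<rho>_eq[OF t] d]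
    obtain D2 where D2: "((\<lambda>t. (L2_norm (\<lambda>x. \<rho> t (x + d) - \<rho> t x))\<^sup>2) has_real_derivative D2) (at t within I)"
      "D2 \<le> d\<^sup>2 * (3 * K * (L2_norm (r t))\<^sup>2 + 2 * L2_norm (r t) * L2_norm gr)" by blast
    define p q where "p = L2_norm (w t)" "q = L2_norm (r t)"
    have pq: "0 \<le> p" "0 \<le> q" by (auto simp: p_q_def)
    have 1: "2 * p * L2_norm gv \<le> 2 * p * (\<kappa> * (R * q) + K * p)"
      using gv_le pq by (intro mult_left_mono) (auto simp: p_q_def)
    have 2: "2 * q * L2_norm gr \<le> 2 * q * (R * p + K * q)"
      using gr_le pq by (intro mult_left_mono) (auto simp: p_q_def)
    have pq2: "2 * (p * q) \<le> p\<^sup>2 + q\<^sup>2"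
      using zero_le_power2[of "p - q"] unfolding power2_diff by linarith
    have "3 * K * p\<^sup>2 + 2 * p * L2_norm gv + (3 * K * q\<^sup>2 + 2 * q * L2_norm gr)
        \<le> 3 * K * p\<^sup>2 + 2 * p * (\<kappa> * (R * q) + K * p) + (3 * K * q\<^sup>2 + 2 * q * (R * p + K * q))"
      using 1 2 by linarith
    also have "\<dots> = 5 * K * (p\<^sup>2 + q\<^sup>2) + (\<kappa> * R + R) * (2 * (p * q))"
      by (simp add: power2_eq_square algebra_simps)
    also have "\<dots> \<le> 5 * K * (p\<^sup>2 + q\<^sup>2) + (\<kappa> * R + R) * (p\<^sup>2 + q\<^sup>2)"
      using pq2 R(1) kappa by (intro add_left_mono mult_left_mono) auto
    also have "\<dots> \<le> C * (p\<^sup>2 + q\<^sup>2)" by (simp add: C_def algebra_simps)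
    finally have "d\<^sup>2 * (3 * K * p\<^sup>2 + 2 * p * L2_norm gv + (3 * K * q\<^sup>2 + 2 * q * L2_norm gr)) \<le> d\<^sup>2 * (C * F t)"
      unfolding F_def p_q_def by (rule mult_left_mono) simp
    then have "D1 + D2 \<le> d\<^sup>2 * (C * F t)"
      using D1(2) D2(2) unfolding p_q_def distrib_left by linarith
    moreover have "(E d has_real_derivative D1 + D2) (at t within I)"
      unfolding E_def[abs_def] by (rule DERIV_add[OF D1(1) D2(1)])
    ultimately show ?thesis by blast
  qed
  have Fc: "continuous_on I F"
    unfolding F_def[abs_def] by (intro continuous_intros w_norm_continuous r_norm_continuous)
  have F0: "0 \<le> F t" for t by (simp add: F_def)
  define G where "G t = integral {0..t} F" for t
  have Gder: "(G has_real_derivative F t) (at t within {0..t1})" if "t1 \<in> I" "t \<in> {0..t1}" for t t1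
    unfolding G_def[abs_def]
  proof (rule integral_has_real_derivative)
    show "continuous_on {0..t1} F" by (rule continuous_on_subset[OF Fc]) (use that in auto)
  qed (use that in auto)
  have G0: "0 \<le> G t" if "t \<in> I" for t
    unfolding G_def
  proof (rule Henstock_Kurzweil_Integration.integral_nonneg)
    show "F integrable_on {0..t}"
      by (rule integrable_continuous_real, rule continuous_on_subset[OF Fc]) (use that in auto)
  qed (use F0 in auto)
  have E_le: "E d t \<le> d\<^sup>2 * (F 0 + C * G t)" if t: "t \<in> I" and d: "0 < d" for t d
  proof -
    obtain D where D: "\<And>s. s \<in> I \<Longrightarrow> (E d has_real_derivative D s) (at s within I)"
      "\<And>s. s \<in> I \<Longrightarrow> D s \<le> d\<^sup>2 * (C * F s)" using E_der[OF _ d] by metis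
    have sub: "{0..t} \<subseteq> I" "0 \<le> t" "0 \<in> I" using t by auto
    have "E d t - d\<^sup>2 * C * G t \<le> E d 0 - d\<^sup>2 * C * G 0"
    proof (rule nonincreasing_within[OF sub(2)])
      fix s assume s: "s \<in> {0..t}"
      show "((\<lambda>t. E d t - d\<^sup>2 * C * G t) has_real_derivative D s - d\<^sup>2 * C * F s) (at s within {0..t})"
        using s sub by (intro DERIV_diff DERIV_cmult Gder t DERIV_subset[OF D(1)]) auto
      show "D s - d\<^sup>2 * C * F s \<le> 0" using D(2)[of s] s sub by (auto simp: mult.assoc)
    qed
    moreover have "G 0 = 0" by (simp add: G_def)
    moreover have "E d 0 \<le> d\<^sup>2 * F 0"
    proof -
      have "(L2_norm (\<lambda>x. v 0 (x + d) - v 0 x))\<^sup>2 \<le> (d * L2_norm (w 0))\<^sup>2"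
        "(L2_norm (\<lambda>x. \<rho> 0 (x + d) - \<rho> 0 x))\<^sup>2 \<le> (d * L2_norm (r 0))\<^sup>2"
        using L2_norm_difference_le[OF vx[OF sub(3)] d] L2_norm_difference_le[OF \<rho>x[OF sub(3)] d]
        by (auto intro: power_mono)
      then show ?thesis by (simp add: E_def F_def power_mult_distrib distrib_left)
    qed
    ultimately show ?thesis by (simp add: algebra_simps)
  qed
  have F_le: "F t \<le> 2 * C * G t + 2 * F 0" if t: "t \<in> I" for t
  proof -
    define A where "A = sqrt (F 0 + C * G t)"
    have nn: "0 \<le> F 0 + C * G t" using F0[of 0] G0[OF t] C by simp
    have *: "L2_norm g' \<le> A" if g: "L2_deriv g g'"
      and le: "\<And>d. 0 < d \<Longrightarrow> (L2_norm (\<lambda>x. g (x + d) - g x))\<^sup>2 \<le> E d t" for g g'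
    proof (rule L2_norm_le_difference_quotients[OF g])
      fix d :: real assume "0 < d"
      then have "(L2_norm (\<lambda>x. g (x + d) - g x))\<^sup>2 \<le> (d * A)\<^sup>2"
        using le[of d] E_le[OF t, of d] nn by (simp add: A_def power_mult_distrib)
      then show "L2_norm (\<lambda>x. g (x + d) - g x) \<le> d * A"
        by (rule power2_le_imp_le) (use \<open>0 < d\<close> nn in \<open>simp add: A_def\<close>)
    qed
    have "L2_norm (w t) \<le> A" "L2_norm (r t) \<le> A"
      by (rule *[OF vx[OF t]], simp add: E_def) (rule *[OF \<rho>x[OF t]], simp add: E_def)
    then have "F t \<le> A\<^sup>2 + A\<^sup>2" unfolding F_def by (intro add_mono power_mono) auto
    then show ?thesis using nn by (simp add: A_def)
  qed
  have "F t \<le> 2 * C * (2 * F 0 / (2 * C) * exp (2 * C * T)) + 2 * F 0" if t: "t \<in> I" for t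
  proof -
    have "0 \<le> t" using t by simp
    from Gronwall[OF this Gder[OF t] F_le _ ] have "G t \<le> (G 0 + 2 * F 0 / (2 * C)) * exp (2 * C * t)"
      using t C F0[of 0] by auto
    also have "\<dots> = 2 * F 0 / (2 * C) * exp (2 * C * t)" by (simp add: G_def)
    also have "\<dots> \<le> 2 * F 0 / (2 * C) * exp (2 * C * T)"
      using t C F0[of 0] by (intro mult_left_mono) auto
    finally have "2 * C * G t \<le> 2 * C * (2 * F 0 / (2 * C) * exp (2 * C * T))"
      using C by (intro mult_left_mono) auto
    then show ?thesis using F_le[OF t] by linarith
  qed
  then show ?thesis unfolding F_def[abs_def] by blast
qed

text \<open>The mean of \<open>u\<close> is not controlled by \<open>v\<close>. The material derivative of \<open>u\<close> is bounded, however, since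
  \<open>\<rho>\<close> and \<open>v\<close> are bounded and \<open>h\<close> is continuous up to time \<open>T\<close>.\<close>

lemma u_bounded: "\<exists>B. \<forall>t\<in>I. (L2_norm (u t))\<^sup>2 \<le> B"
proof -
  obtain R where R: "0 \<le> R" "\<And>t x. t \<in> I \<Longrightarrow> \<bar>\<rho> t x\<bar> \<le> R" using \<rho>_bounded by blast
  obtain K where K: "0 \<le> K" "\<And>t x. t \<in> I \<Longrightarrow> \<bar>v t x\<bar> \<le> K" using v_bounded by blast
  have "compact (h ` {0..T})"
    by (rule compact_continuous_image[OF continuous_on_subset[OF h]]) auto
  then obtain H where H: "\<forall>t\<in>{0..T}. \<bar>h t\<bar> \<le> H"
    using compact_imp_bounded bounded_iff by (metis imageI real_norm_def)
  define A where "A = \<kappa> / 2 * R\<^sup>2 + 1 / 2 * K\<^sup>2"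
  \<comment> \<open>The material derivative of \<open>u\<close>.\<close>
  define q where "q t x = ut t x + u t x * v t x" for t x
  have qL: "q t \<in> L2_circle" if "t \<in> I" for t
    unfolding q_def[abs_def]
    by (intro L2_add L2_differentiableD(2)[OF u_differentiable that] L2_mult_continuous L2_derivD(1,4)[OF ux[OF that]] L2_derivD(5)[OF vx[OF that]])
  have q_norm: "L2_norm (q t) \<le> 2 * A + H" if t: "t \<in> I" for t
  proof (rule L2_norm_bounded[OF qL[OF t]])
    fix x :: real assume x: "x \<in> {0..1}"
    have \<rho>2: "\<kappa> / 2 * (\<rho> t y)\<^sup>2 \<le> \<kappa> / 2 * R\<^sup>2" and v2: "(v t y)\<^sup>2 \<le> K\<^sup>2" for y
      using R(2)[OF t, of y] K(2)[OF t, of y] R(1) K(1) kappa by (auto simp flip: abs_le_square_iff)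
    have pos: "0 \<le> \<kappa> / 2 * (\<rho> t y)\<^sup>2" "0 \<le> (v t y)\<^sup>2" for y using kappa by auto
    have "L2_norm (\<rho> t) \<le> R" "L2_norm (v t) \<le> K"
      using R(2)[OF t] K(2)[OF t] L2_derivD(5)[OF \<rho>x[OF t]] L2_derivD(5)[OF vx[OF t]]
      by (auto intro: L2_norm_bounded)
    then have "(L2_norm (\<rho> t))\<^sup>2 \<le> R\<^sup>2" "(L2_norm (v t))\<^sup>2 \<le> K\<^sup>2" by (auto intro: power_mono)
    moreover from this(1) have "\<kappa> / 2 * (L2_norm (\<rho> t))\<^sup>2 \<le> \<kappa> / 2 * R\<^sup>2"
      using kappa by (intro mult_left_mono) auto
    ultimately have "- A \<le> a t" unfolding a_def A_def by linarith
    define k where "k y = \<kappa> / 2 * (\<rho> t y)\<^sup>2 + 1 / 2 * (v t y)\<^sup>2 + a t" for y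
    have kA: "\<bar>k y\<bar> \<le> 2 * A" for y
    proof (rule abs_leI)
      have "0 \<le> A" using kappa by (simp add: A_def)
      moreover have "0 \<le> k y - a t" "k y - a t \<le> A"
        using \<rho>2[of y] v2[of y] pos[of y] by (simp_all add: k_def A_def)
      ultimately show "k y \<le> 2 * A" "- k y \<le> 2 * A"
        using a_nonpos[of t] \<open>- A \<le> a t\<close> by linarith+
    qed
    have kc: "continuous_on UNIV k"
      unfolding k_def[abs_def] by (intro continuous_intros L2_derivD(4)[OF \<rho>x[OF t]] L2_derivD(4)[OF vx[OF t]])
    have "antideriv0 k x = integral {0..x} k"
      using primD(3)[OF prim_C1[OF antideriv0_has_derivative(1)[OF kc] kc], of 0 x] x
      by (simp add: antideriv0_has_derivative(2)[OF kc])
    also have "\<bar>\<dots>\<bar> \<le> 2 * A * (x - 0)"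
      unfolding real_norm_def[symmetric]
      by (rule integral_bound) (use x kA kc in \<open>auto intro: continuous_on_subset\<close>)
    also have "\<dots> \<le> 2 * A * 1" using x kA[of 0] by (intro mult_left_mono) auto
    finally have "\<bar>antideriv0 k x\<bar> \<le> 2 * A" by simp
    moreover have "q t x = antideriv0 k x + h t" using u_eq[OF t] by (simp add: q_def k_def[abs_def])
    moreover have "\<bar>h t\<bar> \<le> H" using H t by simp
    ultimately show "\<bar>q t x\<bar> \<le> 2 * A + H" by linarith
  qed
  define Q where "Q = 2 * A + H"
  define y where "y t = (L2_norm (u t))\<^sup>2" for t
  define y' where "y' t = integral\<^sup>L circle (\<lambda>x. v t x * (u t x)\<^sup>2) + integral\<^sup>L circle (\<lambda>x. 2 * u t x * q t x)" for t
  have der: "(y has_real_derivative y' t) (at t within I)" if t: "t \<in> I" for t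
    unfolding y_def[abs_def] y'_def L2_norm_sq
    by (rule transport_energy[OF u_differentiable t ux[OF t] ux[OF t] qL[OF t] _ energy_density_square]) (simp add: q_def)
  have le: "y' t \<le> (K + 1) * y t + Q\<^sup>2" if t: "t \<in> I" for t
  proof -
    note uL = L2_derivD(5)[OF ux[OF t]]
    have "integral\<^sup>L circle (\<lambda>x. v t x * (u t x)\<^sup>2) \<le> integral\<^sup>L circle (\<lambda>x. K * (u t x)\<^sup>2)"
    proof (rule integral_mono)
      have "continuous_on UNIV (\<lambda>x. v t x * (u t x)\<^sup>2)"
        by (intro continuous_intros L2_derivD(4)[OF ux[OF t]] L2_derivD(4)[OF vx[OF t]])
      then show "integrable circle (\<lambda>x. v t x * (u t x)\<^sup>2)" by (rule continuous_circle_integrable)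
      show "integrable circle (\<lambda>x. K * (u t x)\<^sup>2)" using L2_circleD(4)[OF uL] by simp
      show "v t x * (u t x)\<^sup>2 \<le> K * (u t x)\<^sup>2" for x using K(2)[OF t, of x] by (intro mult_right_mono) auto
    qed
    also have "\<dots> = K * y t" by (simp add: y_def L2_norm_sq)
    finally have 1: "integral\<^sup>L circle (\<lambda>x. v t x * (u t x)\<^sup>2) \<le> K * y t" .
    have "integral\<^sup>L circle (\<lambda>x. 2 * u t x * q t x) \<le> L2_norm (\<lambda>x. 2 * u t x) * L2_norm (q t)"
      using L2_Cauchy_Schwarz[OF L2_cmult[OF uL] qL[OF t], of 2] by linarith
    also have "\<dots> = 2 * L2_norm (u t) * L2_norm (q t)" by (simp add: L2_norm_cmult)
    also have "\<dots> \<le> 2 * L2_norm (u t) * Q" using q_norm[OF t] by (intro mult_left_mono) (auto simp: Q_def)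
    also have "\<dots> \<le> y t + Q\<^sup>2"
      using zero_le_power2[of "L2_norm (u t) - Q"] unfolding power2_diff y_def by linarith
    finally show ?thesis unfolding y'_def using 1 by (simp add: algebra_simps)
  qed
  have "y t \<le> (y 0 + Q\<^sup>2 / (K + 1)) * exp ((K + 1) * T)" if t: "t \<in> I" for t
  proof -
    have sub: "{0..t} \<subseteq> I" "0 \<le> t" using t by auto
    have "y t \<le> (y 0 + Q\<^sup>2 / (K + 1)) * exp ((K + 1) * t)"
      using sub K(1) by (intro Gronwall[where y' = y']) (auto intro!: le DERIV_subset[OF der])
    also have "\<dots> \<le> (y 0 + Q\<^sup>2 / (K + 1)) * exp ((K + 1) * T)"
      using t K(1) by (intro mult_left_mono) (auto simp: y_def)
    finally show ?thesis .
  qed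
  then show ?thesis unfolding y_def by blast
qed

lemma norms_bounded:
  "\<exists>B. \<forall>t\<in>I. (L2_norm (u t))\<^sup>2 + (L2_norm (v t))\<^sup>2 + (L2_norm (w t))\<^sup>2 
     + ((L2_norm (\<rho> t))\<^sup>2 + (L2_norm (r t))\<^sup>2) \<le> B"
proof -
  obtain R where R: "0 \<le> R" "\<And>t x. t \<in> I \<Longrightarrow> \<bar>\<rho> t x\<bar> \<le> R" using \<rho>_bounded by blast
  obtain K where K: "0 \<le> K" "\<And>t x. t \<in> I \<Longrightarrow> \<bar>v t x\<bar> \<le> K" using v_bounded by blast
  obtain B1 where B1: "\<And>t. t \<in> I \<Longrightarrow> (L2_norm (w t))\<^sup>2 + (L2_norm (r t))\<^sup>2 \<le> B1" using gradient_bounded by blast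
  obtain B2 where B2: "\<And>t. t \<in> I \<Longrightarrow> (L2_norm (u t))\<^sup>2 \<le> B2" using u_bounded by blast
  have "(L2_norm (u t))\<^sup>2 + (L2_norm (v t))\<^sup>2 + (L2_norm (w t))\<^sup>2 
     + ((L2_norm (\<rho> t))\<^sup>2 + (L2_norm (r t))\<^sup>2) \<le> B2 + K\<^sup>2 + R\<^sup>2 + B1" if t: "t \<in> I" for t
  proof -
    have "L2_norm (\<rho> t) \<le> R" "L2_norm (v t) \<le> K"
      using R(2)[OF t] K(2)[OF t] L2_derivD(5)[OF \<rho>x[OF t]] L2_derivD(5)[OF vx[OF t]]
      by (auto intro: L2_norm_bounded)
    then have "(L2_norm (\<rho> t))\<^sup>2 \<le> R\<^sup>2" "(L2_norm (v t))\<^sup>2 \<le> K\<^sup>2" by (auto intro: power_mono)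
    then show ?thesis using B1[OF t] B2[OF t] by linarith
  qed
  then show ?thesis by blast
qed

end

end


section \<open>Blow-up\<close>

lemma sobolev_pair_norm_sq: 
  assumes "f \<in> sobolev 2" "g \<in> sobolev 1"
  shows "(sobolev_pair_norm 2 1 f g)\<^sup>2 = (L2_norm f)\<^sup>2 + (L2_norm (deriv f))\<^sup>2 + (L2_norm (weak_deriv 2 f))\<^sup>2
    + ((L2_norm g)\<^sup>2 + (L2_norm (weak_deriv 1 g))\<^sup>2)"
  using sobolev_norm_2[OF sobolev_2D[OF assms(1)]] sobolev_norm_1[OF sobolev_1D[OF assms(2)]]
  by (simp add: sobolev_pair_norm_def)

text \<open>Convergence in a Sobolev norm is convergence in mean square of each derivative that enters the norm.\<close>

lemma tendsto_zero_bounded_norm: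
  assumes "((\<lambda>s. sobolev_norm j (F s)) \<longlongrightarrow> 0) (at t within S)"
    and "\<And>s. s \<in> S \<Longrightarrow> (L2_norm (G s))\<^sup>2 \<le> (sobolev_norm j (F s))\<^sup>2"
  shows "((\<lambda>s. L2_norm (G s)) \<longlongrightarrow> 0) (at t within S)"
proof (rule Lim_null_comparison[OF _ assms(1)])
  show "\<forall>\<^sub>F s in at t within S. norm (L2_norm (G s)) \<le> sobolev_norm j (F s)"
    using eventually_within
  proof eventually_elim
    case (elim s)
    have "0 \<le> sobolev_norm j (F s)" by (simp add: sobolev_norm_def sum_nonneg)
    from power2_le_imp_le[OF assms(2)[OF elim] this] show ?case by simp
  qed
qed

lemma L2_deriv_quotient:
  assumes "L2_deriv f f'" "L2_deriv g g'" "L2_deriv k k'"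
  shows "L2_deriv (\<lambda>x. (f x - g x) / c - k x) (\<lambda>x. (f' x - g' x) / c - k' x)"
  using L2_deriv_diff[OF L2_deriv_cmult[OF L2_deriv_diff[OF assms(1,2)], of "1 / c"] assms(3)] by simp

text \<open>The one point that is not a translation between Sobolev norms and mean square norms is the equation for
  \<open>u\<^sub>x\<close>: both sides of the integrated equation are the same function, its left-hand side has a derivative by
  the product rule and its right-hand side by the fundamental theorem of calculus, and derivatives are
  unique almost everywhere.\<close>

lemma hs_solution_flow:
  assumes kappa: "\<kappa> > 0" and h: "continuous_on {0..} h" and sol: "hs_solution (-1) \<kappa> h u0 \<rho>0 (ereal T) u \<rho>"
  shows "\<exists>ut \<rho>t. hunter_saxton_flow \<kappa> T h (\<lambda>t. hs_mean (-1) \<kappa> (u t) (\<rho> t)) u (\<lambda>t. deriv (u t)) (\<lambda>t. weak_deriv 2 (u t))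
    ut (\<lambda>t. weak_deriv 1 (ut t)) \<rho> (\<lambda>t. weak_deriv 1 (\<rho> t)) \<rho>t"
proof -
  have I: "time_interval (ereal T) = {0..<T}" by (auto simp: time_interval_def)
  define I where "I = {0..<T}"
  from sol have T: "0 < T" and u2: "C0_sobolev I 2 u" and \<rho>1: "C0_sobolev I 1 \<rho>"
    by (auto simp: hs_solution_def I I_def)
  from sol obtain ut \<rho>t where uC1: "C1_sobolev I 1 u ut" and \<rho>C1: "C1_sobolev I 0 \<rho> \<rho>t"
    and ueq: "\<And>t x. t \<in> I \<Longrightarrow> ut t x + u t x * deriv (u t) x = antideriv0 (\<lambda>y. \<kappa> / 2 * (\<rho> t y)\<^sup>2
      + 1 / 2 * (deriv (u t) y)\<^sup>2 + hs_mean (- 1) \<kappa> (u t) (\<rho> t)) x + h t"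
    and \<rho>eq: "\<And>t. t \<in> I \<Longrightarrow> AE x in lebesgue. \<rho>t t x + u t x * weak_deriv 1 (\<rho> t) x = - 1 * deriv (u t) x * \<rho> t x"
    unfolding hs_solution_def I I_def[symmetric] by auto
  have ux: "L2_deriv (u t) (deriv (u t))" and vx: "L2_deriv (deriv (u t)) (weak_deriv 2 (u t))" if "t \<in> I" for t
    using sobolev_2D u2 that by (auto simp: C0_sobolev_def)
  have \<rho>x: "L2_deriv (\<rho> t) (weak_deriv 1 (\<rho> t))" if "t \<in> I" for t
    using sobolev_1D \<rho>1 that by (auto simp: C0_sobolev_def)
  have utx: "L2_deriv (ut t) (weak_deriv 1 (ut t))" if "t \<in> I" for t
    using sobolev_1D uC1 that by (auto simp: C0_sobolev_def C1_sobolev_def)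
  have quot: "((\<lambda>s. sobolev_norm 1 (\<lambda>x. (u s x - u t x) / (s - t) - ut t x)) \<longlongrightarrow> 0) (at t within I)"
    if "t \<in> I" for t using uC1 that by (auto simp: C1_sobolev_def)
  have quot_norm: "(sobolev_norm 1 (\<lambda>x. (u s x - u t x) / (s - t) - ut t x))\<^sup>2
      = (L2_norm (\<lambda>x. (u s x - u t x) / (s - t) - ut t x))\<^sup>2
        + (L2_norm (\<lambda>x. (deriv (u s) x - deriv (u t) x) / (s - t) - weak_deriv 1 (ut t) x))\<^sup>2"
    if "t \<in> I" "s \<in> I" for s t
    by (rule sobolev_norm_1[OF L2_deriv_quotient[OF ux ux utx]]) (use that in auto)
  have mean: "hs_mean (-1) \<kappa> (u t) (\<rho> t) = - (\<kappa> / 2) * (L2_norm (\<rho> t))\<^sup>2 - 1 / 2 * (L2_norm (deriv (u t)))\<^sup>2" for t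
    by (simp add: hs_mean_def L2_norm_sq circle_integral_eq)
  have "hunter_saxton_flow \<kappa> T h (\<lambda>t. hs_mean (-1) \<kappa> (u t) (\<rho> t)) u (\<lambda>t. deriv (u t)) (\<lambda>t. weak_deriv 2 (u t))
    ut (\<lambda>t. weak_deriv 1 (ut t)) \<rho> (\<lambda>t. weak_deriv 1 (\<rho> t)) \<rho>t"
    unfolding hunter_saxton_flow_def I_def[symmetric]
  proof (intro conjI allI impI)
    show "L2_differentiable I u ut"
      unfolding L2_differentiable_def
    proof (intro ballI conjI)
      fix t assume t: "t \<in> I"
      show "u t \<in> L2_circle" "ut t \<in> L2_circle" using L2_derivD(5) ux[OF t] utx[OF t] by auto
      show "((\<lambda>s. L2_norm (\<lambda>x. (u s x - u t x) / (s - t) - ut t x)) \<longlongrightarrow> 0) (at t within I)"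
        by (rule tendsto_zero_bounded_norm[OF quot[OF t]]) (subst quot_norm[OF t], assumption, simp)
    qed
    show "L2_differentiable I (\<lambda>t. deriv (u t)) (\<lambda>t. weak_deriv 1 (ut t))"
      unfolding L2_differentiable_def
    proof (intro ballI conjI)
      fix t assume t: "t \<in> I"
      show "deriv (u t) \<in> L2_circle" "weak_deriv 1 (ut t) \<in> L2_circle" using L2_derivD(2) ux[OF t] utx[OF t] by auto
      show "((\<lambda>s. L2_norm (\<lambda>x. (deriv (u s) x - deriv (u t) x) / (s - t) - weak_deriv 1 (ut t) x)) \<longlongrightarrow> 0) (at t within I)"
        by (rule tendsto_zero_bounded_norm[OF quot[OF t]]) (subst quot_norm[OF t], assumption, simp)
    qed
    show "L2_differentiable I \<rho> \<rho>t"
      unfolding L2_differentiable_def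
    proof (intro ballI conjI)
      fix t assume t: "t \<in> I"
      show \<rho>tL: "\<rho>t t \<in> L2_circle" using \<rho>C1 t by (auto simp: C1_sobolev_def C0_sobolev_def sobolev_0)
      have \<rho>L: "\<rho> s \<in> L2_circle" if "s \<in> I" for s by (rule L2_derivD(5)[OF \<rho>x[OF that]])
      then show "\<rho> t \<in> L2_circle" using t .
      have "((\<lambda>s. sobolev_norm 0 (\<lambda>x. (\<rho> s x - \<rho> t x) / (s - t) - \<rho>t t x)) \<longlongrightarrow> 0) (at t within I)"
        using \<rho>C1 t by (auto simp: C1_sobolev_def)
      then show "((\<lambda>s. L2_norm (\<lambda>x. (\<rho> s x - \<rho> t x) / (s - t) - \<rho>t t x)) \<longlongrightarrow> 0) (at t within I)"
      proof (rule tendsto_zero_bounded_norm)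
        fix s assume s: "s \<in> I"
        have "(\<lambda>x. (\<rho> s x - \<rho> t x) / (s - t) - \<rho>t t x) \<in> L2_circle"
          by (intro L2_diff L2_divide \<rho>L \<rho>tL s t)
        from sobolev_norm_0[OF this]
        show "(L2_norm (\<lambda>x. (\<rho> s x - \<rho> t x) / (s - t) - \<rho>t t x))\<^sup>2
            \<le> (sobolev_norm 0 (\<lambda>x. (\<rho> s x - \<rho> t x) / (s - t) - \<rho>t t x))\<^sup>2" by simp
      qed
    qed
    fix t
    assume t: "t \<in> I"
    show "((\<lambda>s. L2_norm (\<lambda>x. weak_deriv 2 (u s) x - weak_deriv 2 (u t) x)) \<longlongrightarrow> 0) (at t within I)"
    proof (rule tendsto_zero_bounded_norm)
      show "((\<lambda>s. sobolev_norm 2 (\<lambda>x. u s x - u t x)) \<longlongrightarrow> 0) (at t within I)"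
        using u2 t by (auto simp: C0_sobolev_def)
      show "(L2_norm (\<lambda>x. weak_deriv 2 (u s) x - weak_deriv 2 (u t) x))\<^sup>2 \<le> (sobolev_norm 2 (\<lambda>x. u s x - u t x))\<^sup>2"
        if "s \<in> I" for s
        using sobolev_norm_2[OF L2_deriv_diff[OF ux[OF that] ux[OF t]] L2_deriv_diff[OF vx[OF that] vx[OF t]]] by simp
    qed
    show "((\<lambda>s. L2_norm (\<lambda>x. weak_deriv 1 (\<rho> s) x - weak_deriv 1 (\<rho> t) x)) \<longlongrightarrow> 0) (at t within I)"
    proof (rule tendsto_zero_bounded_norm)
      show "((\<lambda>s. sobolev_norm 1 (\<lambda>x. \<rho> s x - \<rho> t x)) \<longlongrightarrow> 0) (at t within I)"
        using \<rho>1 t by (auto simp: C0_sobolev_def)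
      show "(L2_norm (\<lambda>x. weak_deriv 1 (\<rho> s) x - weak_deriv 1 (\<rho> t) x))\<^sup>2 \<le> (sobolev_norm 1 (\<lambda>x. \<rho> s x - \<rho> t x))\<^sup>2"
        if "s \<in> I" for s
        using sobolev_norm_1[OF L2_deriv_diff[OF \<rho>x[OF that] \<rho>x[OF t]]] by simp
    qed
    show "AE x in circle. \<rho>t t x + u t x * weak_deriv 1 (\<rho> t) x = - (deriv (u t) x * \<rho> t x)"
    proof (subst AE_restrict_space_iff)
      show "AE x in lebesgue. x \<in> {0..1} \<longrightarrow> \<rho>t t x + u t x * weak_deriv 1 (\<rho> t) x = - (deriv (u t) x * \<rho> t x)"
        using \<rho>eq[OF t] by (rule eventually_mono) simp
    qed simp
    define k where "k y = \<kappa> / 2 * (\<rho> t y)\<^sup>2 + 1 / 2 * (deriv (u t) y)\<^sup>2 + hs_mean (- 1) \<kappa> (u t) (\<rho> t)" for y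
    have kc: "continuous_on UNIV k"
      unfolding k_def[abs_def] by (intro continuous_intros L2_derivD(4)[OF \<rho>x[OF t]] L2_derivD(4)[OF vx[OF t]])
    have d1: "L2_deriv (\<lambda>x. ut t x + u t x * deriv (u t) x)
      (\<lambda>x. weak_deriv 1 (ut t) x + (deriv (u t) x * deriv (u t) x + u t x * weak_deriv 2 (u t) x))"
      by (intro L2_deriv_add L2_deriv_mult utx ux vx t)
    have d2: "L2_deriv (\<lambda>x. ut t x + u t x * deriv (u t) x) k"
    proof (rule L2_deriv_C1[OF _ kc L2_derivD(1)[OF d1]])
      fix x
      have "((\<lambda>x. antideriv0 k x + h t) has_real_derivative k x + 0) (at x)"
        by (intro DERIV_add antideriv0_has_derivative kc DERIV_const)
      then show "((\<lambda>x. ut t x + u t x * deriv (u t) x) has_real_derivative k x) (at x)"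
        using ueq[OF t] by (simp add: k_def[abs_def])
    qed
    show "AE x in circle. weak_deriv 1 (ut t) x + u t x * weak_deriv 2 (u t) x
        = \<kappa> / 2 * (\<rho> t x)\<^sup>2 - 1 / 2 * (deriv (u t) x)\<^sup>2 + hs_mean (- 1) \<kappa> (u t) (\<rho> t)"
      using L2_deriv_unique[OF d1 d2] by (rule eventually_mono) (simp add: k_def power2_eq_square)
  qed (use kappa T h ux vx \<rho>x mean ueq in auto)
  then show ?thesis by blast
qed

theorem theorem4p1:
  fixes \<kappa> :: real and h u0 \<rho>0 :: "real \<Rightarrow> real"
    and u \<rho> :: "real \<Rightarrow> real \<Rightarrow> real" and T :: ereal
  assumes "\<kappa> > 0"
    and "continuous_on {0..} h"
    and "u0 \<in> sobolev 2" and "\<rho>0 \<in> sobolev 1"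
    and "T = max_existence_time (-1) \<kappa> h u0 \<rho>0"
    and "hs_solution (-1) \<kappa> h u0 \<rho>0 T u \<rho>"
  shows "blows_up_in_finite_time T u \<rho> \<longleftrightarrow>
    T < \<infinity> \<and>
    Liminf (at_left (real_of_ereal T)) (\<lambda>t. INF x. ereal (deriv (u t) x)) = -\<infinity>"
proof (cases "T < \<infinity>")
  case True
  have "0 < T" using assms(6) by (simp add: hs_solution_def)
  with True obtain S where S: "T = ereal S" "0 < S" by (cases T) auto
  define I where "I = {0..<S}"
  have sol: "hs_solution (-1) \<kappa> h u0 \<rho>0 (ereal S) u \<rho>" using assms(6) S by simp
  have "time_interval (ereal S) = I" by (auto simp: time_interval_def I_def)
  with sol have sob: "u t \<in> sobolev 2" "\<rho> t \<in> sobolev 1" if "t \<in> I" for t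
    using that by (auto simp: hs_solution_def C0_sobolev_def)
  obtain ut \<rho>t where "hunter_saxton_flow \<kappa> S h (\<lambda>t. hs_mean (-1) \<kappa> (u t) (\<rho> t)) u (\<lambda>t. deriv (u t)) (\<lambda>t. weak_deriv 2 (u t))
    ut (\<lambda>t. weak_deriv 1 (ut t)) \<rho> (\<lambda>t. weak_deriv 1 (\<rho> t)) \<rho>t"
    using hs_solution_flow[OF assms(1,2) sol] by blast
  then interpret flow: hunter_saxton_flow \<kappa> S h "\<lambda>t. hs_mean (-1) \<kappa> (u t) (\<rho> t)" u "\<lambda>t. deriv (u t)" "\<lambda>t. weak_deriv 2 (u t)"
    ut "\<lambda>t. weak_deriv 1 (ut t)" \<rho> "\<lambda>t. weak_deriv 1 (\<rho> t)" \<rho>t .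
  define N where "N t = sobolev_pair_norm 2 1 (u t) (\<rho> t)" for t
  define m where "m t = (INF x. ereal (deriv (u t) x))" for t
  have N_sq: "(N t)\<^sup>2 = (L2_norm (u t))\<^sup>2 + (L2_norm (deriv (u t)))\<^sup>2 + (L2_norm (weak_deriv 2 (u t)))\<^sup>2
    + ((L2_norm (\<rho> t))\<^sup>2 + (L2_norm (weak_deriv 1 (\<rho> t)))\<^sup>2)" if "t \<in> I" for t
    unfolding N_def by (rule sobolev_pair_norm_sq[OF sob[OF that]])
  have N_nonneg: "0 \<le> N t" for t by (simp add: N_def sobolev_pair_norm_def)
  have ev_I: "\<forall>\<^sub>F t in at_left S. t \<in> I"
    unfolding eventually_at_left[OF \<open>0 < S\<close>] I_def using \<open>0 < S\<close> by (intro exI[of _ 0]) auto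
  have "Limsup (at_left S) (\<lambda>t. ereal (N t)) = \<infinity> \<longleftrightarrow> Liminf (at_left S) m = -\<infinity>"
  proof
    assume "Liminf (at_left S) m = -\<infinity>"
    then have "\<infinity> = Limsup (at_left S) (\<lambda>t. - m t)"
      using ereal_Limsup_uminus[of "at_left S" m] by simp
    also have "\<dots> \<le> Limsup (at_left S) (\<lambda>t. ereal (N t))"
    proof (rule Limsup_mono)
      show "\<forall>\<^sub>F t in at_left S. - m t \<le> ereal (N t)"
        using ev_I
      proof eventually_elim
        case (elim t)
        have "(L2_norm (weak_deriv 2 (u t)))\<^sup>2 \<le> (N t)\<^sup>2" unfolding N_sq[OF elim] by simp
        then have "L2_norm (weak_deriv 2 (u t)) \<le> N t" using N_nonneg by (rule power2_le_imp_le)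
        then have "- N t \<le> deriv (u t) x" for x
          using flow.v_le_w_norm[of t x] elim by (simp add: I_def)
        then have "- ereal (N t) \<le> m t" unfolding m_def by (intro INF_greatest) simp
        then show ?case using ereal_uminus_le_reorder by blast
      qed
    qed
    finally show "Limsup (at_left S) (\<lambda>t. ereal (N t)) = \<infinity>" by simp
  next
    assume lim: "Limsup (at_left S) (\<lambda>t. ereal (N t)) = \<infinity>"
    show "Liminf (at_left S) m = -\<infinity>"
    proof (rule ccontr)
      assume "Liminf (at_left S) m \<noteq> -\<infinity>"
      then have "-\<infinity> < Liminf (at_left S) m" by simp
      then obtain b where "ereal b < Liminf (at_left S) m"
        using ereal_dense2 by blast
      then have "\<forall>\<^sub>F t in at_left S. ereal b < m t" by (rule less_LiminfD)
      then obtain t0 where t0: "t0 < S" "\<And>t. t0 < t \<Longrightarrow> t < S \<Longrightarrow> ereal b < m t"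
        unfolding eventually_at_left[OF \<open>0 < S\<close>] by blast
      \<comment> \<open>The lower bound for \<open>u\<^sub>x\<close> holds near \<open>T\<close> by assumption and up to \<open>t1\<close> by continuity.\<close>
      define t1 where "t1 = max 0 t0"
      have t1: "t1 \<in> {0..<S}" using t0(1) \<open>0 < S\<close> by (auto simp: t1_def)
      from flow.v_bounded_before[OF this] obtain K
        where K: "0 \<le> K" "\<And>t x. t \<in> {0..t1} \<Longrightarrow> \<bar>deriv (u t) x\<bar> \<le> K" by blast
      have lower: "- (K + \<bar>b\<bar>) \<le> deriv (u t) x" if "t \<in> {0..<S}" for t x
      proof (cases "t \<le> t1")
        case True
        then show ?thesis using K(2)[of t x] that by auto
      next
        case False
        then have "ereal b < m t" using t0(2)[of t] that by (auto simp: t1_def)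
        also have "m t \<le> ereal (deriv (u t) x)" unfolding m_def by (rule INF_lower) simp
        finally show ?thesis using K(1) by simp
      qed
      have "0 \<le> K + \<bar>b\<bar>" using K(1) by simp
      from flow.norms_bounded[OF lower this] obtain B where B: "\<And>t. t \<in> I \<Longrightarrow> (N t)\<^sup>2 \<le> B"
        using N_sq unfolding I_def by metis
      have "\<forall>\<^sub>F t in at_left S. ereal (N t) \<le> ereal (sqrt B)"
        using ev_I by eventually_elim (simp add: B real_le_rsqrt)
      then have "Limsup (at_left S) (\<lambda>t. ereal (N t)) \<le> ereal (sqrt B)" by (rule Limsup_bounded)
      with lim show False by simp
    qed
  qed
  then show ?thesis
    using True S by (simp add: blows_up_in_finite_time_def N_def[abs_def] m_def[abs_def])
qed (simp add: blows_up_in_finite_time_def)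

end
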